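(* Let $I=\{i_1<\cdots<i_k\}$ be a subset of $[1,M+N]=\{1,\ldots,M+N\}$ and let $I^{c}=\{i_{k+1}<\cdots<i_{M+N}\}$ be its complement in $[1,M+N]$. If $I\subseteq[1,M]$ or $[1,M]\subseteq I$, then in $\mathrm{U}_q(\widehat{\mathfrak{gl}}_{M|N})$ $$B_q(L^{\pm}(z))=B_q\bigl(L^{\pm}(z)_I\bigr)\,B_{q^{-1}}\Bigl(\pi\bigl((L^{\pm}(zq^{2M-2N})^{-1})_{I^{c}}\bigr)\Bigr).$$
   Context: Let $M,N\ge 0$ be integers with $M\ne N$. The base field is $\mathbb{C}(q)$ ($q$ is not a root of unity). For $1\le i\le M+N$ put $\bar i=0$ if $i\le M$ and $\bar i=1$ if $i>M$, and $q_i=q^{1-2\bar i}$. $\mathbb{C}^{M|N}$ is the superspace with basis $e_i$ of parity $\bar i$, and $E_{ij}\in\mathrm{End}\,\mathbb{C}^{M|N}$ are the matrix units (of parity $\bar i+\bar j$). Tensor products of superalgebras are graded: $(a\otimes b)(a'\otimes b')=(-1)^{|b||a'|}aa'\otimes bb'$. Put $R(z,w)=\sum_i (zq_i-wq_i^{-1})E_{ii}\otimes E_{ii}+(z-w)\sum_{i\ne j}E_{ii}\otimes E_{jj}+z\sum_{i<j}(q_j-q_j^{-1})E_{ij}\otimes E_{ji}+w\sum_{i>j}(q_j-q_j^{-1})E_{ij}\otimes E_{ji}$, $\overline R(x)=R(x,1)/(xq-q^{-1})$ and $R(x)=f(x)\overline R(x)$, where $f(x)=1+\sum_{k\ge1}f_kx^{-k}$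 is the formal series uniquely determined by $f(xq^{2N-2M})=f(x)\frac{(1-xq^{-2})(1-xq^{2N-2M+2})}{(1-x)(1-xq^{2N-2M})}$; $R(x)$ is expanded in powers of $x^{-1}$. $\mathrm{U}_q(\widehat{\mathfrak{gl}}_{M|N})$ is the superalgebra over $\mathbb{C}(q)$ generated by $l_{ij}^{\pm(r)}$ ($1\le i,j\le M+N$, $r\ge 0$, parity $\bar i+\bar j$) and an invertible central even element $q^c$. Put $l_{ij}^{\pm}(z)=\sum_{r\ge0}l_{ij}^{\pm(r)}z^{\mp r}$, $L^{\pm}(z)=\sum_{i,j}l^{\pm}_{ij}(z)\otimes E_{ij}$, and let $L_a^\pm(z)$ denote $L^\pm(z)$ acting in the $a$-th copy of $\mathrm{End}\,\mathbb{C}^{M|N}$. The defining relations are: $l_{ji}^{+(0)}=l_{ij}^{-(0)}=0$ for $i<j$; $l_{ii}^{-(0)}l_{ii}^{+(0)}=l_{ii}^{+(0)}l_{ii}^{-(0)}=1$; $R(z/w)L_1^{\pm}(z)L_2^{\pm}(w)=L_2^{\pm}(w)L_1^{\pm}(z)R(z/w)$; $R(zq^{c}/w)L_1^{+}(z)L_2^{-}(w)=L_2^{-}(w)L_1^{+}(z)R(zq^{-c}/w)$. Matrices are multiplied and inverted as elements of the graded tensor product with the matrix superalgebra, i.e. $(AB)_{ij}=\sum_k(-1)^{(\bar i+\bar k)(\bar k+\bar j)}A_{ik}B_{kj}$; submatrices inherit the index parities. $A_I$ is the submatrix of $A$ with rows and columns indexed by $I$ (in increasing order). For a $k\times k$ matrix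 $A$, $\pi(A)$ is the matrix whose $(i,j)$ entry is $A_{k+1-i,k+1-j}$. Berezinians: for a matrix $A(z)$ of size $m+n$ with $m$ indices of one parity followed by $n$ indices of the other, $$B_q(A(z))=\sum_{\sigma\in S_m}(-q)^{-l(\sigma)}A(z)_{\sigma(1),1}\cdots A(zq^{2m-2})_{\sigma(m),m}\sum_{\tau\in S_n}(-q)^{-l(\tau)}\bigl(A(zq^{2m-2})^{-1}\bigr)_{m+1,m+\tau(1)}\cdots\bigl(A(zq^{2m-2n})^{-1}\bigr)_{m+n,m+\tau(n)},$$ with arguments $zq^{2j-2}$ in the $j$-th factor of the first product and $zq^{2m-2k}$ in the $k$-th factor of the second. Here $(m,n)=(M,N)$ for $L^\pm(z)$; $(m,n)=(k,0)$ for $L^\pm(z)_I$ if $I\subseteq[1,M]$, and $(m,n)=(M,k-M)$ if $[1,M]\subseteq I$. $B_{q^{-1}}(A(z))$ is the Berezinian with parameter $q^{-1}$ in the inverse spectral variable, i.e. the same expression, with the same arguments $zq^{2j-2}$ and $zq^{2m-2k}$, in which the coefficients $(-q)^{-l(\sigma)}$, $(-q)^{-l(\tau)}$ are replaced by $(-q)^{l(\sigma)}$, $(-q)^{l(\tau)}$. For $A(z)=\pi((L^\pm(z)^{-1})_{I^c})$ one takes $(m,n)=(N,M-k)$ if $I\subseteq[1,M]$ and $(m,n)=(M+N-k,0)$ if $[1,M]\subseteq I$; the factor in the claim is this $B_{q^{-1}}(A(z))$ evaluated at $zq^{2M-2N}$. The Berezinian of an empty matrix is $1$. *)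

theory Defs
  imports
    "HOL-Library.Poly_Mapping"
    "HOL-Library.Type_Length"
    "HOL-Computational_Algebra.Formal_Laurent_Series"
    "HOL-Computational_Algebra.Fraction_Field"
    "HOL-Combinatorics.Permutations"
begin

section \<open>The base field\<close>

text \<open>\<open>\<complex>(q)\<close>; the variable \<open>q\<close> is an indeterminate, so in particular not a root of unity.\<close>

type_synonym base = "complex poly fract"

definition q :: base where
  "q = Fract [:0, 1:] 1"

section \<open>The $R$-matrix\<close>

definition bar :: "nat \<Rightarrow> nat \<Rightarrow> nat" where
  "bar M i = (if i \<le> M then 0 else 1)"

definition qsub :: "nat \<Rightarrow> nat \<Rightarrow> base" where
  "qsub M i = q powi (1 - 2 * int (bar M i))"

text \<open>
  Functions of \<open>x\<close> expanded in powers of \<open>x\<^sup>-\<^sup>1\<close> are Laurent series in the formal variable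
  \<open>u = x\<^sup>-\<^sup>1\<close>; hence \<open>x\<close> itself is the inverse of that variable, and the coefficient of
  \<open>x\<^sup>-\<^sup>k\<close> has index \<open>k\<close>.
\<close>

abbreviation xvar :: "base fls" where
  "xvar \<equiv> fls_X_inv"

abbreviation qpow :: "int \<Rightarrow> base fls" where
  "qpow a \<equiv> fls_const (q powi a)"

text \<open>The substitution \<open>x \<mapsto> x q\<^sup>a\<close> is \<open>u \<mapsto> q\<^sup>-\<^sup>a u\<close>.\<close>

definition fseries :: "nat \<Rightarrow> nat \<Rightarrow> base fps" where
  "fseries M N = (let d = 2 * int N - 2 * int M in
     THE f. fps_nth f 0 = 1 \<and>
       fps_to_fls (fps_compose f (fps_const (q powi (- d)) * fps_X)) =
         fps_to_fls f *
           (((1 - xvar * qpow (- 2)) * (1 - xvar * qpow (d + 2))) /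
            ((1 - xvar) * (1 - xvar * qpow d))))"

text \<open>
  A family \<open>T\<close> of this type stands for \<open>\<Sum> T i j k l \<otimes> E\<^sub>i\<^sub>j \<otimes> E\<^sub>k\<^sub>l\<close>, an element of
  \<open>A \<otimes> End \<otimes> End\<close>; indices run over \<open>{1..M+N}\<close>.
\<close>

type_synonym 'a tens = "nat \<Rightarrow> nat \<Rightarrow> nat \<Rightarrow> nat \<Rightarrow> 'a"

definition Rmat :: "nat \<Rightarrow> base fls \<Rightarrow> base fls \<Rightarrow> base fls tens" where
  "Rmat M z w i j k l =
     (if i = j \<and> k = l then
        (if i = k then z * fls_const (qsub M i) - w * fls_const (inverse (qsub M i)) else z - w)
      else if k = j \<and> l = i then
        (if i < j then z else w) * fls_const (qsub M j - inverse (qsub M j))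
      else 0)"

definition Rseries :: "nat \<Rightarrow> nat \<Rightarrow> base fls tens" where
  "Rseries M N i j k l =
     fps_to_fls (fseries M N) * (Rmat M xvar 1 i j k l / (xvar * qpow 1 - qpow (- 1)))"

definition Rcoeff :: "nat \<Rightarrow> nat \<Rightarrow> nat \<Rightarrow> base tens" where
  "Rcoeff M N e i j k l = fls_nth (Rseries M N i j k l) (int e)"

section \<open>The free algebra\<close>

datatype 'a word = Word (letters: "'a list")

instantiation word :: (type) monoid_add
begin

definition zero_word :: "'a word" where
  "0 = Word []"

definition plus_word :: "'a word \<Rightarrow> 'a word \<Rightarrow> 'a word" where
  "v + w = Word (letters v @ letters w)"

instance
  by standard (simp_all add: zero_word_def plus_word_def)

end

datatype sign = Pos | Neg

fun eps :: "sign \<Rightarrow> int" where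
  "eps Pos = 1"
| "eps Neg = - 1"

text \<open>\<^term>\<open>LGen s i j r\<close> is $l_{ij}^{\pm(r)}$; \<open>QC\<close>, \<open>QCinv\<close> are $q^c$ and its inverse.\<close>

datatype gen = LGen sign nat nat nat | QC | QCinv

text \<open>
  The additive monoid of exponents is the free (noncommutative) monoid of words, so the
  monoid-algebra product is the one of the free associative algebra.
\<close>

type_synonym falg = "gen word \<Rightarrow>\<^sub>0 base"

definition fgen :: "gen \<Rightarrow> falg" where
  "fgen g = Poly_Mapping.single (Word [g]) 1"

definition fscal :: "base \<Rightarrow> falg" where
  "fscal c = Poly_Mapping.single 0 c"

text \<open>
  Product of the graded tensor product \<open>A \<otimes> End \<otimes> End\<close> on even elements: the coefficient of
  \<open>E\<^sub>i\<^sub>j \<otimes> E\<^sub>k\<^sub>l\<close> has the parity of \<open>E\<^sub>i\<^sub>j \<otimes> E\<^sub>k\<^sub>l\<close>.  For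
  \<open>(a \<otimes> E\<^sub>i\<^sub>u \<otimes> E\<^sub>k\<^sub>v) (b \<otimes> E\<^sub>u\<^sub>j \<otimes> E\<^sub>v\<^sub>l)\<close> the first summand of the exponent comes from moving
  \<open>b\<close> past \<open>E\<^sub>i\<^sub>u \<otimes> E\<^sub>k\<^sub>v\<close>, the second from moving \<open>E\<^sub>u\<^sub>j\<close> past \<open>E\<^sub>k\<^sub>v\<close>.
\<close>

definition tmult :: "nat \<Rightarrow> nat \<Rightarrow> 'a::ring_1 tens \<Rightarrow> 'a tens \<Rightarrow> 'a tens" where
  "tmult M N A B i j k l = (\<Sum>u = 1..M + N. \<Sum>v = 1..M + N.
     (- 1) ^ ((bar M i + bar M u + bar M k + bar M v) * (bar M u + bar M j + bar M v + bar M l)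
              + (bar M k + bar M v) * (bar M u + bar M j))
     * A i u k v * B u j v l)"

definition L1 :: "sign \<Rightarrow> nat \<Rightarrow> falg tens" where
  "L1 s r i j k l = (if k = l then fgen (LGen s i j r) else 0)"

definition L2 :: "sign \<Rightarrow> nat \<Rightarrow> falg tens" where
  "L2 s r i j k l = (if i = j then fgen (LGen s k l r) else 0)"

text \<open>The coefficient of \<open>x\<^sup>-\<^sup>e\<close> in \<open>R(x y)\<close>, where \<open>g\<close> is the inverse of \<open>y\<close>.\<close>

definition Rterm :: "nat \<Rightarrow> nat \<Rightarrow> falg \<Rightarrow> nat \<Rightarrow> falg tens" where
  "Rterm M N g e i j k l = fscal (Rcoeff M N e i j k l) * g ^ e"

text \<open>
  Coefficient of \<open>z\<^sup>-\<^sup>a w\<^sup>-\<^sup>b\<close> in \<open>R(z g\<^sup>-\<^sup>1/w) L\<^sub>1\<^sup>s(z) L\<^sub>2\<^sup>t(w) - L\<^sub>2\<^sup>t(w) L\<^sub>1\<^sup>s(z) R(z h\<^sup>-\<^sup>1/w)\<close>: the term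
  \<open>(z/w)\<^sup>-\<^sup>e\<close> of \<open>R\<close> meets the terms $z^{\mp r}$ and $w^{\mp p}$ of the two \<open>L\<close>'s.  The index set
  is finite unless \<open>s = Neg\<close> and \<open>t = Pos\<close>, a combination that does not occur.
\<close>

definition rll :: "nat \<Rightarrow> nat \<Rightarrow> sign \<Rightarrow> sign \<Rightarrow> falg \<Rightarrow> falg \<Rightarrow> int \<Rightarrow> int \<Rightarrow> falg tens" where
  "rll M N s t g h a b i j k l =
     (\<Sum>(e, r, p) \<in> {(e, r, p). int e + eps s * int r = a \<and> eps t * int p - int e = b}.
        tmult M N (tmult M N (Rterm M N g e) (L1 s r)) (L2 t p) i j k l
      - tmult M N (tmult M N (L2 t p) (L1 s r)) (Rterm M N h e) i j k l)"

lemma finite_rll_index: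
  assumes "s = Pos \<or> t = Neg"
  shows "finite {(e, r, p). int e + eps s * int r = a \<and> eps t * int p - int e = b}" (is "finite ?S")
proof (rule finite_subset)
  let ?n = "nat (\<bar>a\<bar> + \<bar>b\<bar>)"
  show "?S \<subseteq> {..?n} \<times> {..?n} \<times> {..?n}"
  proof
    fix x assume "x \<in> ?S"
    then obtain e r p where x: "x = (e, r, p)"
      and "int e + eps s * int r = a" "eps t * int p - int e = b" by auto
    with assms have "int e \<le> \<bar>a\<bar> + \<bar>b\<bar> \<and> int r \<le> \<bar>a\<bar> + \<bar>b\<bar> \<and> int p \<le> \<bar>a\<bar> + \<bar>b\<bar>"
      by (cases s; cases t) (simp_all, presburger+)
    then show "x \<in> {..?n} \<times> {..?n} \<times> {..?n}" by (simp add: x le_nat_iff)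
  qed
qed simp

section \<open>The quantum affine superalgebra\<close>

text \<open>
  The free algebra has generators \<open>LGen s i j r\<close> for all natural \<open>i\<close>, \<open>j\<close>; \<open>range\<close> discards those
  whose indices are not in \<open>{1..M+N}\<close>.
\<close>

inductive_set relators :: "nat \<Rightarrow> nat \<Rightarrow> falg set" for M N :: nat where
  range: "i \<notin> {1..M + N} \<or> j \<notin> {1..M + N} \<Longrightarrow> fgen (LGen s i j r) \<in> relators M N"
| cent_inv1: "fgen QC * fgen QCinv - 1 \<in> relators M N"
| cent_inv2: "fgen QCinv * fgen QC - 1 \<in> relators M N"
| central: "fgen QC * fgen g - fgen g * fgen QC \<in> relators M N"
| tri_pos: "\<lbrakk>1 \<le> i; i < j; j \<le> M + N\<rbrakk> \<Longrightarrow> fgen (LGen Pos j i 0) \<in> relators M N"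
| tri_neg: "\<lbrakk>1 \<le> i; i < j; j \<le> M + N\<rbrakk> \<Longrightarrow> fgen (LGen Neg i j 0) \<in> relators M N"
| diag1: "i \<in> {1..M + N} \<Longrightarrow> fgen (LGen Neg i i 0) * fgen (LGen Pos i i 0) - 1 \<in> relators M N"
| diag2: "i \<in> {1..M + N} \<Longrightarrow> fgen (LGen Pos i i 0) * fgen (LGen Neg i i 0) - 1 \<in> relators M N"
| rll_same: "\<lbrakk>i \<in> {1..M + N}; j \<in> {1..M + N}; k \<in> {1..M + N}; l \<in> {1..M + N}\<rbrakk>
    \<Longrightarrow> rll M N s s 1 1 a b i j k l \<in> relators M N"
| rll_mixed: "\<lbrakk>i \<in> {1..M + N}; j \<in> {1..M + N}; k \<in> {1..M + N}; l \<in> {1..M + N}\<rbrakk>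
    \<Longrightarrow> rll M N Pos Neg (fgen QCinv) (fgen QC) a b i j k l \<in> relators M N"

inductive_set two_sided_ideal :: "'a::ring_1 set \<Rightarrow> 'a set" for S :: "'a set" where
  zero: "0 \<in> two_sided_ideal S"
| add: "x \<in> two_sided_ideal S \<Longrightarrow> y \<in> two_sided_ideal S \<Longrightarrow> x + y \<in> two_sided_ideal S"
| gen: "r \<in> S \<Longrightarrow> a * r * b \<in> two_sided_ideal S"

lemma two_sided_ideal_mult:
  "x \<in> two_sided_ideal S \<Longrightarrow> c * x * d \<in> two_sided_ideal S"
proof (induction rule: two_sided_ideal.induct)
  case (gen r a b)
  have "c * (a * r * b) * d = (c * a) * r * (b * d)" by (simp add: mult.assoc)
  then show ?case by (metis gen two_sided_ideal.gen)
qed (auto simp: distrib_left distrib_right intro: two_sided_ideal.intros)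

lemma two_sided_ideal_multL: "x \<in> two_sided_ideal S \<Longrightarrow> c * x \<in> two_sided_ideal S"
  using two_sided_ideal_mult[of x S c 1] by simp

lemma two_sided_ideal_multR: "x \<in> two_sided_ideal S \<Longrightarrow> x * d \<in> two_sided_ideal S"
  using two_sided_ideal_mult[of x S 1 d] by simp

lemma two_sided_ideal_uminus: "x \<in> two_sided_ideal S \<Longrightarrow> - x \<in> two_sided_ideal S"
  using two_sided_ideal_multL[of x S "- 1"] by simp

lemma two_sided_ideal_diff:
  "x \<in> two_sided_ideal S \<Longrightarrow> y \<in> two_sided_ideal S \<Longrightarrow> x - y \<in> two_sided_ideal S"
  using two_sided_ideal.add[OF _ two_sided_ideal_uminus] by fastforce

subsection \<open>The counit, showing that the quotient is not the zero ring\<close>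

definition word_val :: "('g \<Rightarrow> 'k::comm_ring_1) \<Rightarrow> 'g word \<Rightarrow> 'k" where
  "word_val v w = prod_list (map v (letters w))"

definition feval :: "('g \<Rightarrow> 'k::comm_ring_1) \<Rightarrow> ('g word \<Rightarrow>\<^sub>0 'k) \<Rightarrow> 'k" where
  "feval v p = (\<Sum>w\<in>Poly_Mapping.keys p. Poly_Mapping.lookup p w * word_val v w)"

lemma feval_superset:
  assumes "finite A" "Poly_Mapping.keys p \<subseteq> A"
  shows "feval v p = (\<Sum>w\<in>A. Poly_Mapping.lookup p w * word_val v w)"
  unfolding feval_def using assms
  by (intro sum.mono_neutral_left) (auto simp: in_keys_iff)

lemma feval_zero [simp]: "feval v 0 = 0"
  by (simp add: feval_def)

lemma feval_add: "feval v (p + r) = feval v p + feval v r"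
proof -
  let ?A = "Poly_Mapping.keys p \<union> Poly_Mapping.keys r"
  have "Poly_Mapping.keys (p + r) \<subseteq> ?A" by (rule Poly_Mapping.keys_add)
  then show ?thesis
    by (simp add: feval_superset[of ?A] lookup_add sum.distrib distrib_right)
qed

lemma feval_single [simp]: "feval v (Poly_Mapping.single w c) = c * word_val v w"
  by (cases "c = 0") (simp_all add: feval_def)

lemma feval_sum: "feval v (\<Sum>i\<in>A. h i) = (\<Sum>i\<in>A. feval v (h i))"
  by (induction A rule: infinite_finite_induct) (auto simp: feval_add)

lemma sum_singles:
  "p = (\<Sum>w\<in>Poly_Mapping.keys p. Poly_Mapping.single w (Poly_Mapping.lookup p w))"
  by (rule poly_mapping_eqI)
    (simp add: lookup_sum lookup_single when_def sum.delta in_keys_iff)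

lemma feval_mult: "feval v (p * r) = feval v p * feval v r"
proof -
  have "feval v (p * r) =
      feval v ((\<Sum>w\<in>Poly_Mapping.keys p. Poly_Mapping.single w (Poly_Mapping.lookup p w)) *
       (\<Sum>w\<in>Poly_Mapping.keys r. Poly_Mapping.single w (Poly_Mapping.lookup r w)))"
    by (simp flip: sum_singles)
  also have "\<dots> = feval v p * feval v r"
    unfolding feval_def[of v p] feval_def[of v r] sum_product feval_sum mult_single feval_single
    by (intro sum.cong refl) (simp add: word_val_def plus_word_def algebra_simps)
  finally show ?thesis .
qed

lemma feval_one [simp]: "feval v 1 = 1"
  unfolding single_one[symmetric] feval_single by (simp add: word_val_def zero_word_def)

lemma feval_uminus: "feval v (- p) = - feval v p"
  using feval_add[of v p "- p"] by (simp add: eq_neg_iff_add_eq_0 add.commute)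

lemma feval_diff: "feval v (p - r) = feval v p - feval v r"
  using feval_add[of v p "- r"] by (simp add: feval_uminus)

lemma feval_power: "feval v (p ^ n) = feval v p ^ n"
  by (induction n) (simp_all add: feval_mult)

lemma feval_fgen [simp]: "feval v (fgen g) = v g"
  by (simp add: fgen_def word_val_def)

lemma feval_fscal [simp]: "feval v (fscal c) = c"
  by (simp add: fscal_def word_val_def zero_word_def)

lemma feval_tmult:
  "feval v (tmult M N A B i j k l) =
   tmult M N (\<lambda>i j k l. feval v (A i j k l)) (\<lambda>i j k l. feval v (B i j k l)) i j k l"
  by (simp add: tmult_def feval_sum feval_mult feval_power feval_uminus)

lemma tmult_id_right:
  assumes "j \<in> {1..M + N}" "l \<in> {1..M + N}"
    and B: "\<And>u v. u \<in> {1..M + N} \<Longrightarrow> v \<in> {1..M + N} \<Longrightarrow>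
      B u j v l = (if u = j \<and> v = l then c else 0)"
  shows "tmult M N A B i j k l = A i j k l * c"
proof -
  have "tmult M N A B i j k l = (\<Sum>u = 1..M + N. \<Sum>v = 1..M + N.
     if u = j then if v = l then A i j k l * c else 0 else 0)"
    unfolding tmult_def
    by (intro sum.cong refl) (simp add: B minus_one_power_iff)
  also have "\<dots> = (\<Sum>u = 1..M + N. if u = j then A i j k l * c else 0)"
    using assms(2) by (intro sum.cong refl) (simp add: sum.delta)
  also have "\<dots> = A i j k l * c"
    using assms(1) by (simp add: sum.delta)
  finally show ?thesis .
qed

lemma tmult_id_left:
  assumes "i \<in> {1..M + N}" "k \<in> {1..M + N}"
    and A: "\<And>u v. u \<in> {1..M + N} \<Longrightarrow> v \<in> {1..M + N} \<Longrightarrow>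
      A i u k v = (if i = u \<and> k = v then c else 0)"
  shows "tmult M N A B i j k l = c * B i j k l"
proof -
  have "tmult M N A B i j k l = (\<Sum>u = 1..M + N. \<Sum>v = 1..M + N.
     if i = u then if k = v then c * B i j k l else 0 else 0)"
    unfolding tmult_def
    by (intro sum.cong refl) (simp add: A minus_one_power_iff)
  also have "\<dots> = (\<Sum>u = 1..M + N. if i = u then c * B i j k l else 0)"
    using assms(2) by (intro sum.cong refl) (simp add: sum.delta')
  also have "\<dots> = c * B i j k l"
    using assms(1) by (simp add: sum.delta')
  finally show ?thesis .
qed

definition counit :: "nat \<Rightarrow> nat \<Rightarrow> gen \<Rightarrow> base" where
  "counit M N g = (case g of
     LGen s i j r \<Rightarrow> if i = j \<and> i \<in> {1..M + N} \<and> r = 0 then 1 else 0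
   | _ \<Rightarrow> 1)"

lemma counit_rll:
  assumes "i \<in> {1..M + N}" "j \<in> {1..M + N}" "k \<in> {1..M + N}" "l \<in> {1..M + N}"
    and "feval (counit M N) g = 1" "feval (counit M N) h = 1"
  shows "feval (counit M N) (rll M N s t g h a b i j k l) = 0"
proof -
  let ?v = "counit M N"
  let ?c = "\<lambda>r::nat. if r = 0 then 1 else 0 :: base"
  have v1: "feval ?v (L1 s r i j k l) = (if i = j \<and> k = l then ?c r else 0)"
    if "i \<in> {1..M + N}" for s r i j k l using that by (simp add: L1_def counit_def)
  have v2: "feval ?v (L2 s r i j k l) = (if i = j \<and> k = l then ?c r else 0)"
    if "k \<in> {1..M + N}" for s r i j k l using that by (simp add: L2_def counit_def)
  have R: "feval ?v (Rterm M N g e i j k l) = Rcoeff M N e i j k l"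
    "feval ?v (Rterm M N h e i j k l) = Rcoeff M N e i j k l" for e i j k l
    using assms(5,6) by (simp_all add: Rterm_def feval_mult feval_power)
  have a: "feval ?v (tmult M N (tmult M N (Rterm M N g e) (L1 s r)) (L2 t p) i j k l)
      = Rcoeff M N e i j k l * ?c r * ?c p" for e r p
    unfolding feval_tmult R
    by (subst tmult_id_right[where c = "?c p"], (use assms(1-4) in \<open>simp_all add: v2\<close>)[3],
        subst tmult_id_right[where c = "?c r"], (use assms(1-4) in \<open>simp_all add: v1\<close>)[3], rule refl)
  have b': "feval ?v (tmult M N (L2 t p) (L1 s r) i u k w)
      = (if i = u \<and> k = w then ?c p * ?c r else 0)"
    if "u \<in> {1..M + N}" "w \<in> {1..M + N}" for r p u w
    unfolding feval_tmult
    by (subst tmult_id_left[where c = "?c p"])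
      (use assms(1-4) that in \<open>simp_all add: v1 v2\<close>)
  have b: "feval ?v (tmult M N (tmult M N (L2 t p) (L1 s r)) (Rterm M N h e) i j k l)
      = ?c p * ?c r * Rcoeff M N e i j k l" for e r p
    unfolding feval_tmult[where A = "tmult M N (L2 t p) (L1 s r)"] R
    by (rule tmult_id_left) (use assms(1-4) in \<open>simp_all add: b'\<close>)
  show ?thesis
    unfolding rll_def feval_sum by (rule sum.neutral) (auto simp: feval_diff a b)
qed

lemma counit_simps [simp]:
  "counit M N QC = 1"
  "counit M N QCinv = 1"
  "counit M N (LGen s i j r) = (if i = j \<and> i \<in> {1..M + N} \<and> r = 0 then 1 else 0)"
  by (simp_all add: counit_def)

lemma counit_relators: "x \<in> relators M N \<Longrightarrow> feval (counit M N) x = 0"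
proof (induction rule: relators.induct)
  case (rll_same i j k l s a b)
  then show ?case by (intro counit_rll) simp_all
next
  case (rll_mixed i j k l a b)
  then show ?case by (intro counit_rll) simp_all
qed (auto simp: feval_diff feval_mult)

lemma counit_ideal: "x \<in> two_sided_ideal (relators M N) \<Longrightarrow> feval (counit M N) x = 0"
  by (induction rule: two_sided_ideal.induct) (auto simp: feval_add feval_mult counit_relators)

lemma one_notin_ideal: "1 \<notin> two_sided_ideal (relators M N)"
  using counit_ideal[of 1 M N] by auto

subsection \<open>The algebra\<close>

text \<open>
  \<open>('m, 'n) uqgl\<close> is $U_q(\widehat{gl}_{M|N})$ for \<open>M = LENGTH('m)\<close> and \<open>N = LENGTH('n)\<close>;
  class \<^class>\<open>len0\<close> admits every length, \<open>0\<close> included.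
\<close>

quotient_type (overloaded) ('m, 'n) uqgl = falg /
  "\<lambda>x y. x - y \<in> two_sided_ideal (relators LENGTH('m::len0) LENGTH('n::len0))"
proof (rule equivpI)
  let ?I = "two_sided_ideal (relators LENGTH('m::len0) LENGTH('n::len0))"
  show "reflp (\<lambda>x y. x - y \<in> ?I)"
    by (simp add: reflp_def two_sided_ideal.zero)
  show "symp (\<lambda>x y. x - y \<in> ?I)"
    unfolding symp_def by (metis minus_diff_eq two_sided_ideal_uminus)
  show "transp (\<lambda>x y. x - y \<in> ?I)"
  proof (rule transpI)
    fix x y z assume "x - y \<in> ?I" "y - z \<in> ?I"
    from two_sided_ideal.add[OF this] show "x - z \<in> ?I" by simp
  qed
qed

instantiation uqgl :: (len0, len0) ring_1
begin

lift_definition zero_uqgl :: "('a, 'b) uqgl" is 0 .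

lift_definition one_uqgl :: "('a, 'b) uqgl" is 1 .

lift_definition plus_uqgl :: "('a, 'b) uqgl \<Rightarrow> ('a, 'b) uqgl \<Rightarrow> ('a, 'b) uqgl" is "(+)"
  by (simp add: add_diff_add two_sided_ideal.add)

lift_definition minus_uqgl :: "('a, 'b) uqgl \<Rightarrow> ('a, 'b) uqgl \<Rightarrow> ('a, 'b) uqgl" is "(-)"
proof -
  fix x x' y y' :: falg
  let ?I = "two_sided_ideal (relators LENGTH('a) LENGTH('b))"
  assume "x - x' \<in> ?I" "y - y' \<in> ?I"
  from two_sided_ideal_diff[OF this] show "(x - y) - (x' - y') \<in> ?I"
    by (simp add: algebra_simps)
qed

lift_definition uminus_uqgl :: "('a, 'b) uqgl \<Rightarrow> ('a, 'b) uqgl" is uminus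
proof -
  fix x x' :: falg
  let ?I = "two_sided_ideal (relators LENGTH('a) LENGTH('b))"
  assume "x - x' \<in> ?I"
  from two_sided_ideal_uminus[OF this] show "- x - - x' \<in> ?I"
    by simp
qed

lift_definition times_uqgl :: "('a, 'b) uqgl \<Rightarrow> ('a, 'b) uqgl \<Rightarrow> ('a, 'b) uqgl" is "(*)"
proof -
  fix x x' y y' :: falg
  let ?I = "two_sided_ideal (relators LENGTH('a) LENGTH('b))"
  assume "x - x' \<in> ?I" "y - y' \<in> ?I"
  then have "(x - x') * y + x' * (y - y') \<in> ?I"
    by (intro two_sided_ideal.add two_sided_ideal_multL two_sided_ideal_multR)
  then show "x * y - x' * y' \<in> ?I" by (simp add: algebra_simps)
qed

instance
proof
  show "(0 :: ('a, 'b) uqgl) \<noteq> 1"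
    by transfer (metis diff_0 minus_minus one_notin_ideal two_sided_ideal_uminus)
qed (transfer; simp add: algebra_simps two_sided_ideal.zero)+

end

lift_definition ugen :: "gen \<Rightarrow> ('m::len0, 'n::len0) uqgl" is fgen .

lift_definition uscal :: "base \<Rightarrow> ('m::len0, 'n::len0) uqgl" is fscal .

section \<open>Matrices over the superalgebra and Berezinians\<close>

text \<open>
  A series \<open>F\<close> carrying the sign \<open>s\<close> stands for \<open>\<Sum> F\<^sub>r z\<^sup>-\<^sup>r\<close> if \<open>s = Pos\<close> and for \<open>\<Sum> F\<^sub>r z\<^sup>r\<close> if
  \<open>s = Neg\<close>; \<open>shift s a F\<close> is \<open>F(z q\<^sup>a)\<close>.
\<close>

definition shift :: "sign \<Rightarrow> int \<Rightarrow> ('m::len0, 'n::len0) uqgl fps \<Rightarrow> ('m, 'n) uqgl fps" where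
  "shift s a F = Abs_fps (\<lambda>r. uscal (q powi (- eps s * int r * a)) * fps_nth F r)"

type_synonym 'a mat = "nat \<Rightarrow> nat \<Rightarrow> 'a"

definition Lmat :: "sign \<Rightarrow> ('m::len0, 'n::len0) uqgl fps mat" where
  "Lmat s i j = Abs_fps (\<lambda>r. ugen (LGen s i j r))"

definition mshift :: "sign \<Rightarrow> int \<Rightarrow> ('m::len0, 'n::len0) uqgl fps mat \<Rightarrow> ('m, 'n) uqgl fps mat" where
  "mshift s a A i j = shift s a (A i j)"

text \<open>Matrices of size \<open>k\<close> have indices in \<open>{1..k}\<close>; \<open>p\<close> gives the parities of the indices.\<close>

definition smult :: "(nat \<Rightarrow> nat) \<Rightarrow> nat \<Rightarrow> 'a::ring_1 mat \<Rightarrow> 'a mat \<Rightarrow> 'a mat" where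
  "smult p k A B i j = (\<Sum>u = 1..k. (- 1) ^ ((p i + p u) * (p u + p j)) * A i u * B u j)"

definition sinverse_of :: "(nat \<Rightarrow> nat) \<Rightarrow> nat \<Rightarrow> 'a::ring_1 mat \<Rightarrow> 'a mat \<Rightarrow> bool" where
  "sinverse_of p k A B \<longleftrightarrow> (\<forall>i\<in>{1..k}. \<forall>j\<in>{1..k}.
     smult p k A B i j = (if i = j then 1 else 0) \<and>
     smult p k B A i j = (if i = j then 1 else 0))"

text \<open>The entries outside \<open>{1..k}\<close> are normalised to \<open>0\<close> to make the inverse unique as a function.\<close>

definition sinv :: "(nat \<Rightarrow> nat) \<Rightarrow> nat \<Rightarrow> 'a::ring_1 mat \<Rightarrow> 'a mat" where
  "sinv p k A = (THE B. sinverse_of p k A B \<and>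
     (\<forall>i j. i \<notin> {1..k} \<or> j \<notin> {1..k} \<longrightarrow> B i j = 0))"

text \<open>\<open>elt I a\<close> is the \<open>a\<close>-th smallest element of \<open>I\<close>, counting from \<open>1\<close>.\<close>

definition elt :: "nat set \<Rightarrow> nat \<Rightarrow> nat" where
  "elt I a = sorted_list_of_set I ! (a - 1)"

definition submat :: "nat set \<Rightarrow> 'a mat \<Rightarrow> 'a mat" where
  "submat I A a b = A (elt I a) (elt I b)"

definition subpar :: "nat set \<Rightarrow> (nat \<Rightarrow> nat) \<Rightarrow> nat \<Rightarrow> nat" where
  "subpar I p a = p (elt I a)"

definition revmat :: "nat \<Rightarrow> 'a mat \<Rightarrow> 'a mat" where
  "revmat k A i j = A (k + 1 - i) (k + 1 - j)"

definition revpar :: "nat \<Rightarrow> (nat \<Rightarrow> nat) \<Rightarrow> nat \<Rightarrow> nat" where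
  "revpar k p i = p (k + 1 - i)"

definition inversions :: "nat \<Rightarrow> (nat \<Rightarrow> nat) \<Rightarrow> nat" where
  "inversions m \<sigma> = card {(i, j). 1 \<le> i \<and> i < j \<and> j \<le> m \<and> \<sigma> j < \<sigma> i}"

text \<open>
  \<open>t\<close> is the parameter of the Berezinian and enters only through the coefficients; the spectral
  shifts are by powers of \<open>q\<close> for either parameter.
\<close>

definition berezinian ::
    "base \<Rightarrow> sign \<Rightarrow> (nat \<Rightarrow> nat) \<Rightarrow> nat \<Rightarrow> nat \<Rightarrow> ('m::len0, 'n::len0) uqgl fps mat
      \<Rightarrow> ('m, 'n) uqgl fps" where
  "berezinian t s p m n A =
     (\<Sum>\<sigma> | \<sigma> permutes {1..m}.
        fps_const (uscal ((- t) powi (- int (inversions m \<sigma>)))) *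
        prod_list (map (\<lambda>j. mshift s (2 * int j - 2) A (\<sigma> j) j) [1..<m + 1])) *
     (\<Sum>\<tau> | \<tau> permutes {1..n}.
        fps_const (uscal ((- t) powi (- int (inversions n \<tau>)))) *
        prod_list (map (\<lambda>k. sinv p (m + n) (mshift s (2 * int m - 2 * int k) A) (m + k) (m + \<tau> k))
          [1..<n + 1]))"

end

theory Submission
  imports Defs "HOL-Combinatorics.Multiset_Permutations"
begin

text \<open>
  At $w = q^2 z$ the matrix $R(z,w)$ has rank one on each pair of distinct indices. Hence the rows
  of $L$, with arguments $z, zq^{-2}, \ldots$, and its columns, with arguments $z, zq^2, \ldots$,
  multiply like elements of a $q$-exterior algebra, and row and column determinants are the
  coefficients of the top form. Row operations there give
  $\det X = \det (X_{JJ} - X_{JI} X_{II}^{-1} X_{IJ}) \cdot \det X_{II}$ for the row determinant and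
  every splitting $I \sqcup J$ of the indices; the opposite ring gives the version for columns.

  By the RTT relation $L_{ij}(z)$ commutes with $(L^{-1})_{ab}(w)$ if $i \neq b$, $j \neq a$ and
  $\bar i = \bar j$, $\bar a = \bar b$. Since Schur complements are inverses of blocks of the
  inverse matrix, the two expansions with $|J| = 1$ show inductively that row and column
  determinants agree.

  Both the even block of $L$ and the odd block of $L^{-1}$ satisfy the RTT relation of
  $\mathfrak{gl}$, and the Berezinian is the product of their determinants. The theorem is the
  Schur complement expansion of the first factor if $I \subseteq [1,M]$ and of the second one if
  $[1,M] \subseteq I$.
\<close>

section \<open>Matrices over a noncommutative ring\<close>

text \<open>A Berezinian multiplies a column determinant of the even block by a row determinant of
  the odd block of the inverse, while a Schur complement stands on the left in the row expansion and
  on the right in the column expansion. This mismatch is why row and column determinants must be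
  shown equal. It is also why commutation is proved with two independent spectral arguments: a
  determinant contains many shifts of its entries, and coefficientwise commutation survives them
  all. Two obstacles come before that. The scalar factor of \<open>R\<close> is an infinite series
  that has to be divided out of the relations; \<open>M \<noteq> N\<close> makes it well defined.
  And all products are graded, so the signs are absorbed once by a twist, after which ordinary
  matrix algebra applies. As for the constants of the claim: \<open>\<pi>\<close> reverses the
  indices, which turns the weights for \<open>inverse q\<close> into a common multiple of those for
  \<open>q\<close>; the argument \<open>zq^(2M-2N)\<close> makes the second Berezinian start at the
  common argument \<open>zq^(2M-2)\<close> when the \<open>N\<close> odd indices come first.\<close>

definition mm :: "'i set \<Rightarrow> ('i \<Rightarrow> 'i \<Rightarrow> 'a::ring_1) \<Rightarrow> ('i \<Rightarrow> 'i \<Rightarrow> 'a) \<Rightarrow> 'i \<Rightarrow> 'i \<Rightarrow> 'a" where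
  "mm K A B i j = (\<Sum>u\<in>K. A i u * B u j)"

definition idm :: "'i \<Rightarrow> 'i \<Rightarrow> 'a::ring_1" where
  "idm i j = (if i = j then 1 else 0)"

definition eq_on :: "'i set \<Rightarrow> ('i \<Rightarrow> 'i \<Rightarrow> 'a) \<Rightarrow> ('i \<Rightarrow> 'i \<Rightarrow> 'a) \<Rightarrow> bool" where
  "eq_on K A B \<longleftrightarrow> (\<forall>i\<in>K. \<forall>j\<in>K. A i j = B i j)"

definition inv_on :: "'i set \<Rightarrow> ('i \<Rightarrow> 'i \<Rightarrow> 'a::ring_1) \<Rightarrow> ('i \<Rightarrow> 'i \<Rightarrow> 'a) \<Rightarrow> bool" where
  "inv_on K A B \<longleftrightarrow> eq_on K (mm K A B) idm \<and> eq_on K (mm K B A) idm"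

text \<open>\<open>B\<close> is meant to be an inverse of the block of \<open>A\<close> on
  \<open>I\<close>, so on complementary indices \<open>J\<close> this is
  \<open>A_JJ - A_JI A_II^{-1} A_IJ\<close>.\<close>

definition schur :: "'i set \<Rightarrow> ('i \<Rightarrow> 'i \<Rightarrow> 'a::ring_1) \<Rightarrow> ('i \<Rightarrow> 'i \<Rightarrow> 'a) \<Rightarrow> 'i \<Rightarrow> 'i \<Rightarrow> 'a" where
  "schur I A B i j = A i j - mm I A (mm I B A) i j"

lemma mm_assoc: "mm K (mm L A B) C = mm L A (mm K B C)"
proof (intro ext)
  fix i j
  have "mm K (mm L A B) C i j = (\<Sum>v\<in>K. \<Sum>u\<in>L. A i u * B u v * C v j)"
    by (simp add: mm_def sum_distrib_right)
  also have "\<dots> = (\<Sum>u\<in>L. \<Sum>v\<in>K. A i u * B u v * C v j)" by (rule sum.swap)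
  also have "\<dots> = mm L A (mm K B C) i j"
    by (simp add: mm_def sum_distrib_left mult.assoc)
  finally show "mm K (mm L A B) C i j = mm L A (mm K B C) i j" .
qed

lemma mm_cong:
  "(\<And>u. u \<in> K \<Longrightarrow> A i u = A' i u) \<Longrightarrow> (\<And>u. u \<in> K \<Longrightarrow> B u j = B' u j) \<Longrightarrow> mm K A B i j = mm K A' B' i j"
  by (simp add: mm_def)

lemma mm_idm_left: "finite K \<Longrightarrow> i \<in> K \<Longrightarrow> mm K idm A i j = A i j"
proof -
  assume "finite K" "i \<in> K"
  have "mm K idm A i j = (\<Sum>u\<in>K. if i = u then A u j else 0)"
    unfolding mm_def idm_def by (intro sum.cong) auto
  then show ?thesis using \<open>finite K\<close> \<open>i \<in> K\<close> by (simp add: sum.delta')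
qed

lemma mm_idm_right: "finite K \<Longrightarrow> j \<in> K \<Longrightarrow> mm K A idm i j = A i j"
proof -
  assume "finite K" "j \<in> K"
  have "mm K A idm i j = (\<Sum>u\<in>K. if u = j then A i u else 0)"
    unfolding mm_def idm_def by (intro sum.cong) auto
  then show ?thesis using \<open>finite K\<close> \<open>j \<in> K\<close> by (simp add: sum.delta)
qed

lemma mm_union:
  "finite I \<Longrightarrow> finite J \<Longrightarrow> I \<inter> J = {} \<Longrightarrow> mm (I \<union> J) A B i j = mm I A B i j + mm J A B i j"
  by (simp add: mm_def sum.union_disjoint)

lemma mm_diff_left: "mm K (\<lambda>i j. A i j - B i j) C i j = mm K A C i j - mm K B C i j"
  by (simp add: mm_def left_diff_distrib sum_subtractf)

lemma mm_diff_right: "mm K C (\<lambda>i j. A i j - B i j) i j = mm K C A i j - mm K C B i j"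
  by (simp add: mm_def right_diff_distrib sum_subtractf)

lemma mm_minus_left: "mm K (\<lambda>i j. - A i j) C i j = - mm K A C i j"
  by (simp add: mm_def sum_negf)

lemma mm_minus_right: "mm K C (\<lambda>i j. - A i j) i j = - mm K C A i j"
  by (simp add: mm_def sum_negf)

lemma eq_onD: "eq_on K A B \<Longrightarrow> i \<in> K \<Longrightarrow> j \<in> K \<Longrightarrow> A i j = B i j"
  by (simp add: eq_on_def)

lemma eq_on_refl: "eq_on K A A"
  by (simp add: eq_on_def)

lemma eq_on_sym: "eq_on K A B \<Longrightarrow> eq_on K B A"
  by (simp add: eq_on_def)

lemma eq_on_trans [trans]: "eq_on K A B \<Longrightarrow> eq_on K B C \<Longrightarrow> eq_on K A C"
  by (simp add: eq_on_def)

lemma eq_on_mm: "eq_on K A A' \<Longrightarrow> eq_on K B B' \<Longrightarrow> eq_on K (mm K A B) (mm K A' B')"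
  by (simp add: eq_on_def mm_def)

lemma inv_on_sym: "inv_on K A B \<Longrightarrow> inv_on K B A"
  by (simp add: inv_on_def)

lemma inv_onD:
  assumes "inv_on K A B" "i \<in> K" "j \<in> K"
  shows "mm K A B i j = idm i j" "mm K B A i j = idm i j"
  using assms by (auto simp: inv_on_def eq_on_def)

lemma eq_on_mm_inv:
  assumes "finite K" "inv_on K A B"
  shows "eq_on K (mm K A (mm K B C)) C" "eq_on K (mm K (mm K C A) B) C"
proof -
  show "eq_on K (mm K A (mm K B C)) C"
    unfolding mm_assoc[symmetric] eq_on_def
  proof (intro ballI)
    fix i j assume ij: "i \<in> K" "j \<in> K"
    have "mm K (mm K A B) C i j = mm K idm C i j"
      by (rule mm_cong) (use assms ij in \<open>auto simp: inv_onD\<close>)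
    then show "mm K (mm K A B) C i j = C i j" using assms ij by (simp add: mm_idm_left)
  qed
  show "eq_on K (mm K (mm K C A) B) C"
    unfolding mm_assoc eq_on_def
  proof (intro ballI)
    fix i j assume ij: "i \<in> K" "j \<in> K"
    have "mm K C (mm K A B) i j = mm K C idm i j"
      by (rule mm_cong) (use assms ij in \<open>auto simp: inv_onD\<close>)
    then show "mm K C (mm K A B) i j = C i j" using assms ij by (simp add: mm_idm_right)
  qed
qed

lemma inv_on_unique:
  assumes "finite K" "inv_on K A B" "inv_on K A C"
  shows "eq_on K B C"
proof -
  have "eq_on K (mm K (mm K B A) C) B"
    unfolding mm_assoc
    by (rule eq_on_trans[OF eq_on_mm[OF eq_on_refl, of K _ idm]])
      (use assms in \<open>auto simp: inv_on_def eq_on_def mm_idm_right\<close>)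
  moreover have "eq_on K (mm K (mm K B A) C) C"
    by (rule eq_on_trans[OF eq_on_mm[OF _ eq_on_refl], of _ _ idm])
      (use assms in \<open>auto simp: inv_on_def eq_on_def mm_idm_left\<close>)
  ultimately show ?thesis by (meson eq_on_sym eq_on_trans)
qed

lemma inv_on_cong:
  assumes "inv_on K A B" "eq_on K A A'" "eq_on K B B'"
  shows "inv_on K A' B'"
  using assms unfolding inv_on_def by (meson eq_on_mm eq_on_sym eq_on_trans)

lemma inv_on_commutes:
  assumes "finite K" "inv_on K A B" "\<And>i j. i \<in> K \<Longrightarrow> j \<in> K \<Longrightarrow> a * A i j = A i j * a"
    and ij: "i \<in> K" "j \<in> K"
  shows "a * B i j = B i j * a"
proof -
  have aB: "a * B i j = mm K idm (\<lambda>u v. a * B u v) i j" using assms by (simp add: mm_idm_left)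
  also have "\<dots> = mm K (mm K B A) (\<lambda>u v. a * B u v) i j"
    by (rule mm_cong) (use assms in \<open>auto simp: inv_onD\<close>)
  also have "\<dots> = mm K B (mm K A (\<lambda>u v. a * B u v)) i j" by (simp add: mm_assoc)
  also have "\<dots> = mm K B (\<lambda>u v. a * mm K A B u v) i j"
    by (rule mm_cong) (auto simp: mm_def sum_distrib_left mult.assoc[symmetric] assms intro!: sum.cong)
  also have "\<dots> = mm K B (\<lambda>u v. a * idm u v) i j"
    by (rule mm_cong) (use assms in \<open>auto simp: inv_onD\<close>)
  also have "\<dots> = mm K B idm i j * a"
    unfolding mm_def sum_distrib_right by (intro sum.cong refl) (auto simp: idm_def)
  also have "\<dots> = B i j * a" using assms by (simp add: mm_idm_right)
  finally show ?thesis .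
qed

text \<open>The rows in \<open>I\<close> of \<open>A B = 1\<close> give
  \<open>A_IJ B_JJ = - A_II B_IJ\<close>. After this substitution \<open>N\<close> cancels
  \<open>A_II\<close>, and what remains is the \<open>J\<close> part of \<open>A B = 1\<close>. The
  product in the other order is symmetric.\<close>

lemma inv_on_schur:
  assumes fin: "finite I" "finite J" and dj: "I \<inter> J = {}"
    and AB: "inv_on (I \<union> J) A B" and AN: "inv_on I A N"
  shows "inv_on J (schur I A N) B"
  unfolding inv_on_def eq_on_def
proof (intro conjI ballI)
  fix i j assume ij: "i \<in> J" "j \<in> J"
  have 1: "mm I A B u j + mm J A B u j = idm u j" if "u \<in> I \<union> J" for u
    using inv_onD(1)[OF AB that] ij mm_union[OF fin dj, of A B u j] by auto
  have 2: "mm I B A i u + mm J B A i u = idm i u" if "u \<in> I \<union> J" for u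
    using inv_onD(2)[OF AB _ that] ij mm_union[OF fin dj, of B A i u] by auto
  have "mm J (mm I A (mm I N A)) B i j = mm I A (mm I N (mm J A B)) i j" by (simp add: mm_assoc)
  also have "\<dots> = mm I A (mm I N (\<lambda>u v. - mm I A B u v)) i j"
    by (intro mm_cong refl) (use 1 ij dj in \<open>force simp: idm_def eq_neg_iff_add_eq_0 add.commute\<close>)
  also have "\<dots> = - mm I A (mm I (mm I N A) B) i j"
    by (simp add: mm_minus_right[abs_def] mm_assoc mm_minus_right)
  also have "mm I A (mm I (mm I N A) B) i j = mm I A B i j"
  proof (intro mm_cong refl)
    fix u assume "u \<in> I"
    then have "mm I (mm I N A) B u j = mm I idm B u j"
      by (intro mm_cong refl) (simp add: inv_onD[OF AN])
    then show "mm I (mm I N A) B u j = B u j" using \<open>u \<in> I\<close> fin by (simp add: mm_idm_left)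
  qed
  finally show "mm J (schur I A N) B i j = idm i j"
    using 1[of i] ij by (simp add: schur_def[abs_def] mm_diff_left algebra_simps)
  have "mm J B (mm I A (mm I N A)) i j = mm I (mm I (mm J B A) N) A i j" by (simp add: mm_assoc)
  also have "\<dots> = mm I (mm I (\<lambda>u v. - mm I B A u v) N) A i j"
    by (intro mm_cong refl) (use 2 ij dj in \<open>force simp: idm_def eq_neg_iff_add_eq_0 add.commute\<close>)
  also have "\<dots> = - mm I (mm I B (mm I A N)) A i j"
    by (simp add: mm_minus_left[abs_def] mm_assoc mm_minus_left)
  also have "mm I (mm I B (mm I A N)) A i j = mm I B A i j"
  proof (intro mm_cong refl)
    fix u assume "u \<in> I"
    then have "mm I B (mm I A N) i u = mm I B idm i u"
      by (intro mm_cong refl) (simp add: inv_onD[OF AN])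
    then show "mm I B (mm I A N) i u = B i u" using \<open>u \<in> I\<close> fin by (simp add: mm_idm_right)
  qed
  finally show "mm J B (schur I A N) i j = idm i j"
    using 2[of j] ij by (simp add: schur_def[abs_def] mm_diff_right algebra_simps)
qed

lemma inv_on_extend:
  assumes fin: "finite I" "finite J" and dj: "I \<inter> J = {}"
    and AN: "inv_on I A N" and ST: "inv_on J (schur I A N) T"
  shows "\<exists>B. inv_on (I \<union> J) A B"
proof -
  \<comment> \<open>The block inversion formula, with blocks \<open>T\<close>,
    \<open>- T A_JI N\<close>, \<open>- N A_IJ T\<close> and
    \<open>N + N A_IJ T A_JI N\<close>.\<close>
  define B where "B i j =
    (if i \<in> J then if j \<in> J then T i j else - mm J T (mm I A N) i j
     else if j \<in> J then - mm I N (mm J A T) i j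
     else N i j + mm I N (mm J A (mm J T (mm I A N))) i j)" for i j
  have AN': "mm I (mm I C A) N i j = C i j" "mm I (mm I C N) A i j = C i j" if "j \<in> I" for C i j
  proof -
    have "mm I C (mm I A N) i j = mm I C idm i j" "mm I C (mm I N A) i j = mm I C idm i j"
      by (intro mm_cong refl; use that in \<open>simp add: inv_onD[OF AN]\<close>)+
    then show "mm I (mm I C A) N i j = C i j" "mm I (mm I C N) A i j = C i j"
      using that fin by (simp_all add: mm_assoc mm_idm_right)
  qed
  have AN'': "mm I A (mm I N C) i j = C i j" "mm I N (mm I A C) i j = C i j" if "i \<in> I" for C i j
  proof -
    have "mm I (mm I A N) C i j = mm I idm C i j" "mm I (mm I N A) C i j = mm I idm C i j"
      by (intro mm_cong refl; use that in \<open>simp add: inv_onD[OF AN]\<close>)+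
    then show "mm I A (mm I N C) i j = C i j" "mm I N (mm I A C) i j = C i j"
      using that fin by (simp_all add: mm_assoc[symmetric] mm_idm_left)
  qed
  have S1: "mm J A (mm J T C) i j = mm I A (mm I N (mm J A (mm J T C))) i j + C i j"
    if "i \<in> J" for C i j
  proof -
    have "mm J (mm J (schur I A N) T) C i j = mm J idm C i j"
      by (intro mm_cong refl) (use that in \<open>simp add: inv_onD[OF ST]\<close>)
    then show ?thesis using that fin
      by (simp add: mm_idm_left mm_assoc schur_def[abs_def] mm_diff_left algebra_simps)
  qed
  have S1': "mm J A T i j = mm I A (mm I N (mm J A T)) i j + idm i j" if "i \<in> J" "j \<in> J" for i j
  proof -
    have "mm J (schur I A N) T i j = idm i j" using that inv_onD[OF ST] by simp
    then show ?thesis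
      by (simp add: mm_assoc schur_def[abs_def] mm_diff_left algebra_simps)
  qed
  have S2: "mm J (mm J C T) A i j = mm I (mm I (mm J (mm J C T) A) N) A i j + C i j"
    if "j \<in> J" for C i j
  proof -
    have "mm J C (mm J T (schur I A N)) i j = mm J C idm i j"
      by (intro mm_cong refl) (use that in \<open>simp add: inv_onD[OF ST]\<close>)
    then show ?thesis using that fin
      by (simp add: mm_idm_right mm_assoc schur_def[abs_def] mm_diff_right[abs_def] mm_diff_right algebra_simps)
  qed
  have S2': "mm J T A i j = mm I (mm I (mm J T A) N) A i j + idm i j" if "i \<in> J" "j \<in> J" for i j
  proof -
    have "mm J T (schur I A N) i j = idm i j" using that inv_onD[OF ST] by simp
    then show ?thesis
      by (simp add: mm_assoc schur_def[abs_def] mm_diff_right algebra_simps)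
  qed
  have dj': "i \<in> J \<Longrightarrow> i \<notin> I" "i \<in> I \<Longrightarrow> i \<notin> J" for i using dj by auto
  let ?X = "mm J T (mm I A N)" and ?Y = "mm I N (mm J A T)"
  let ?Z = "mm I N (mm J A ?X)"
  have "inv_on (I \<union> J) A B"
    unfolding inv_on_def eq_on_def
  proof (intro conjI ballI)
    fix i j assume i: "i \<in> I \<union> J" and j: "j \<in> I \<union> J"
    show "mm (I \<union> J) A B i j = idm i j"
    proof (cases "j \<in> J")
      case True
      have "mm (I \<union> J) A B i j = mm I A (\<lambda>u v. - ?Y u v) i j + mm J A T i j"
        unfolding mm_union[OF fin dj]
        by (intro arg_cong2[of _ _ _ _ "(+)"] mm_cong refl) (use True dj' in \<open>auto simp: B_def\<close>)
      also have "\<dots> = mm J A T i j - mm I A ?Y i j" by (simp add: mm_minus_right)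
      also have "\<dots> = idm i j"
      proof (cases "i \<in> I")
        case ii: True
        then have "i \<noteq> j" using True dj' by auto
        with ii show ?thesis by (simp add: AN'' idm_def)
      next
        case False
        then show ?thesis using i S1'[of i j] True by simp
      qed
      finally show ?thesis .
    next
      case False
      then have jI: "j \<in> I" using j by simp
      have "mm (I \<union> J) A B i j = mm I A (\<lambda>u v. N u v - (- ?Z u v)) i j + mm J A (\<lambda>u v. - ?X u v) i j"
        unfolding mm_union[OF fin dj]
        by (intro arg_cong2[of _ _ _ _ "(+)"] mm_cong refl) (use jI dj' in \<open>auto simp: B_def\<close>)
      also have "\<dots> = mm I A N i j + mm I A ?Z i j - mm J A ?X i j"
        by (simp only: mm_diff_right mm_minus_right) simp
      also have "\<dots> = idm i j"
      proof (cases "i \<in> I")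
        case ii: True
        then show ?thesis using jI by (simp add: AN'' inv_onD[OF AN])
      next
        case False
        then show ?thesis using i S1[of i "mm I A N" j] jI dj' by (auto simp: idm_def)
      qed
      finally show ?thesis .
    qed
    show "mm (I \<union> J) B A i j = idm i j"
    proof (cases "i \<in> J")
      case True
      have "mm (I \<union> J) B A i j = mm I (\<lambda>u v. - ?X u v) A i j + mm J T A i j"
        unfolding mm_union[OF fin dj]
        by (intro arg_cong2[of _ _ _ _ "(+)"] mm_cong refl) (use True dj' in \<open>auto simp: B_def\<close>)
      also have "\<dots> = mm J T A i j - mm I ?X A i j" by (simp add: mm_minus_left)
      also have "mm I ?X A i j = mm I (mm I (mm J T A) N) A i j" by (simp add: mm_assoc)
      also have "mm J T A i j - \<dots> = idm i j"
      proof (cases "j \<in> I")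
        case jj: True
        then have "i \<noteq> j" using True dj' by auto
        with jj show ?thesis by (simp add: AN' idm_def)
      next
        case False
        then show ?thesis using j S2'[of i j] True by simp
      qed
      finally show ?thesis .
    next
      case False
      then have iI: "i \<in> I" using i by simp
      have "mm (I \<union> J) B A i j = mm I (\<lambda>u v. N u v - (- ?Z u v)) A i j + mm J (\<lambda>u v. - ?Y u v) A i j"
        unfolding mm_union[OF fin dj]
        by (intro arg_cong2[of _ _ _ _ "(+)"] mm_cong refl) (use iI dj' in \<open>auto simp: B_def\<close>)
      also have "\<dots> = mm I N A i j + mm I ?Z A i j - mm J ?Y A i j"
        by (simp only: mm_diff_left mm_minus_left) simp
      also have "mm I ?Z A i j = mm I (mm I (mm J (mm J (mm I N A) T) A) N) A i j" by (simp add: mm_assoc)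
      also have "mm J ?Y A i j = mm J (mm J (mm I N A) T) A i j" by (simp add: mm_assoc)
      also have "mm I N A i j + mm I (mm I (mm J (mm J (mm I N A) T) A) N) A i j - \<dots> = idm i j"
      proof (cases "j \<in> I")
        case jj: True
        then show ?thesis using iI by (simp add: AN' inv_onD[OF AN])
      next
        case False
        then show ?thesis using j S2[of j "mm I N A" i] iI dj' by (auto simp: idm_def)
      qed
      finally show ?thesis .
    qed
  qed
  then show ?thesis by blast
qed

section \<open>Twisted determinants of Manin matrices\<close>

text \<open>\<open>\<theta>\<close> abstracts the shift of the spectral argument, later
  \<open>shift s (- 2)\<close>: the factor at position \<open>n\<close> of an ordered product
  carries \<open>\<theta> ^^ n\<close>. The axioms are symmetric under reversing products, so the
  same theory in the opposite ring yields column determinants.\<close>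

locale scalar_ext =
  fixes sc :: "'k::field \<Rightarrow> 'a::ring_1" and \<theta> :: "'a \<Rightarrow> 'a"
  assumes sc_1 [simp]: "sc 1 = 1"
    and sc_add: "sc (a + b) = sc a + sc b"
    and sc_mult: "sc (a * b) = sc a * sc b"
    and sc_central: "sc a * x = x * sc a"
    and theta_1 [simp]: "\<theta> 1 = 1"
    and theta_add: "\<theta> (x + y) = \<theta> x + \<theta> y"
    and theta_mult: "\<theta> (x * y) = \<theta> x * \<theta> y"
    and theta_sc [simp]: "\<theta> (sc a) = sc a"
begin

lemma sc_0 [simp]: "sc 0 = 0"
  using sc_add[of 0 0] by simp

lemma theta_0 [simp]: "\<theta> 0 = 0"
  using theta_add[of 0 0] by simp

lemma theta_sum: "\<theta> (sum f A) = (\<Sum>x\<in>A. \<theta> (f x))"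
  by (induction A rule: infinite_finite_induct) (auto simp: theta_add)

definition scl :: "'k \<Rightarrow> 'a \<Rightarrow> 'a" (infixr "\<bullet>" 69) where
  "a \<bullet> x = sc a * x"

lemma scl_1 [simp]: "1 \<bullet> x = x"
  and scl_zero [simp]: "a \<bullet> 0 = 0"
  by (simp_all add: scl_def)

lemma scl_add: "a \<bullet> (x + y) = a \<bullet> x + a \<bullet> y"
  and scl_diff: "a \<bullet> (x - y) = a \<bullet> x - a \<bullet> y"
  and scl_sum: "a \<bullet> sum f A = (\<Sum>t\<in>A. a \<bullet> f t)"
  by (simp_all add: scl_def algebra_simps sum_distrib_left)

lemma scl_scl: "a \<bullet> b \<bullet> x = (a * b) \<bullet> x"
  and scl_mult: "(a \<bullet> x) * y = a \<bullet> x * y"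
  and mult_scl: "x * (a \<bullet> y) = a \<bullet> x * y"
  and theta_scl: "\<theta> (a \<bullet> x) = a \<bullet> \<theta> x"
  by (simp_all add: scl_def sc_mult mult.assoc theta_mult) (metis mult.assoc sc_central)

lemma scl_left_commute: "a \<bullet> b \<bullet> x = b \<bullet> a \<bullet> x"
  by (simp add: scl_scl mult.commute)

lemma scl_cancel: "a \<noteq> 0 \<Longrightarrow> a \<bullet> x = a \<bullet> y \<longleftrightarrow> x = y"
proof
  assume "a \<noteq> 0" "a \<bullet> x = a \<bullet> y"
  then have "inverse a \<bullet> a \<bullet> x = inverse a \<bullet> a \<bullet> y" by simp
  then show "x = y" using \<open>a \<noteq> 0\<close> by (simp add: scl_scl)
qed simp

lemma theta_power_scl: "(\<theta> ^^ n) (a \<bullet> x) = a \<bullet> (\<theta> ^^ n) x"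
  by (induction n) (simp_all add: theta_scl)

lemmas scl_simps = scl_scl mult_scl scl_mult theta_scl theta_power_scl mult_ac theta_mult

lemma theta_power_mult: "(\<theta> ^^ n) (x * y) = (\<theta> ^^ n) x * (\<theta> ^^ n) y"
  by (induction n) (simp_all add: theta_mult)

text \<open>
  In the algebra with generators $\psi_i$ and relations $\psi_i^2 = 0$,
  $e_{ji}\,\psi_j\psi_i = e_{ij}\,\psi_i\psi_j$, with basis $\psi_S$ such that
  $\psi_c\,\psi_{S - c} = \prod_{s \in S - c} e_{sc}\,\psi_S$, the value \<open>wedge e X rs S\<close> is the
  coefficient of $\psi_S$ in the product of the $\sum_c \theta^k(X_{rc})\,\psi_c$, where \<open>r\<close> is the
  entry number \<open>k\<close> of the list \<open>rs\<close>.
\<close>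

primrec wedge :: "('i \<Rightarrow> 'i \<Rightarrow> 'k) \<Rightarrow> ('j \<Rightarrow> 'i \<Rightarrow> 'a) \<Rightarrow> 'j list \<Rightarrow> 'i set \<Rightarrow> 'a" where
  "wedge e X [] S = (if S = {} then 1 else 0)"
| "wedge e X (r # rs) S =
     (\<Sum>c\<in>S. (\<Prod>s\<in>S - {c}. e s c) \<bullet> X r c * \<theta> (wedge e X rs (S - {c})))"

text \<open>For a list with distinct entries and set \<open>S\<close>, this is the coefficient of
  \<open>\<psi>_S\<close> in the product of the \<open>\<psi>_r\<close> along the list. Dividing by
  it makes \<open>rdet\<close> equal to 1 on the identity matrix and, for Manin matrices,
  independent of the order of the list.\<close>

primrec nrm :: "('i \<Rightarrow> 'i \<Rightarrow> 'k) \<Rightarrow> 'i list \<Rightarrow> 'k" where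
  "nrm e [] = 1"
| "nrm e (r # rs) = (\<Prod>s\<in>set rs. e s r) * nrm e rs"

definition rdet :: "('i \<Rightarrow> 'i \<Rightarrow> 'k) \<Rightarrow> ('i \<Rightarrow> 'i \<Rightarrow> 'a) \<Rightarrow> 'i list \<Rightarrow> 'a" where
  "rdet e X rs = inverse (nrm e rs) \<bullet> wedge e X rs (set rs)"

text \<open>Since \<open>\<psi>_i \<psi>_j = e_ji \<psi>_{ij}\<close>, this is the coefficient of
  \<open>\<psi>_{ij}\<close> in the product of row \<open>r\<close> with the shifted row
  \<open>r'\<close>.\<close>

definition minor2 :: "('i \<Rightarrow> 'i \<Rightarrow> 'k) \<Rightarrow> ('j \<Rightarrow> 'i \<Rightarrow> 'a) \<Rightarrow> 'j \<Rightarrow> 'j \<Rightarrow> 'i \<Rightarrow> 'i \<Rightarrow> 'a" where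
  "minor2 e X r r' i j = e j i \<bullet> X r i * \<theta> (X r' j) + e i j \<bullet> X r j * \<theta> (X r' i)"

text \<open>The rows, read as one-forms with \<open>\<theta>\<close> applied to the second factor,
  obey the relations of the generators: squares vanish, and two rows exchange with the same weights
  as \<open>\<psi>_r\<close> and \<open>\<psi>_r'\<close>.\<close>

definition manin :: "('i \<Rightarrow> 'i \<Rightarrow> 'k) \<Rightarrow> ('i \<Rightarrow> 'i \<Rightarrow> 'a) \<Rightarrow> 'i set \<Rightarrow> bool" where
  "manin e X K \<longleftrightarrow> (\<forall>i\<in>K. \<forall>j\<in>K. i \<noteq> j \<longrightarrow>
     (\<forall>r\<in>K. minor2 e X r r i j = 0) \<and>
     (\<forall>r\<in>K. \<forall>r'\<in>K. r \<noteq> r' \<longrightarrow> e r r' \<bullet> minor2 e X r r' i j = e r' r \<bullet> minor2 e X r' r i j))"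

end

lemma sum_offdiag_pairs:
  fixes f :: "'i::linorder \<Rightarrow> 'i \<Rightarrow> 'a::comm_monoid_add"
  assumes "finite S"
  shows "(\<Sum>i\<in>S. \<Sum>j\<in>S - {i}. f i j) = (\<Sum>(i, j)\<in>{(i, j). i \<in> S \<and> j \<in> S \<and> i < j}. f i j + f j i)"
proof -
  let ?A = "{(i, j). i \<in> S \<and> j \<in> S \<and> i < j}" and ?B = "{(i, j). i \<in> S \<and> j \<in> S \<and> j < i}"
  have fin: "finite ?A" "finite ?B"
    by (rule finite_subset[of _ "S \<times> S"]; use assms in auto)+
  have "(\<Sum>i\<in>S. \<Sum>j\<in>S - {i}. f i j) = (\<Sum>(i, j)\<in>Sigma S (\<lambda>i. S - {i}). f i j)"
    using assms by (simp add: sum.Sigma)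
  also have "Sigma S (\<lambda>i. S - {i}) = ?A \<union> ?B" by (auto simp: neq_iff)
  also have "(\<Sum>(i, j)\<in>\<dots>. f i j) = (\<Sum>(i, j)\<in>?A. f i j) + (\<Sum>(i, j)\<in>?B. f i j)"
    using fin by (intro sum.union_disjoint) auto
  also have "(\<Sum>(i, j)\<in>?B. f i j) = (\<Sum>(i, j)\<in>?A. f j i)"
    by (rule sum.reindex_bij_witness[of _ prod.swap prod.swap]) auto
  finally show ?thesis by (simp add: sum.distrib split_def)
qed

context scalar_ext
begin

text \<open>Laplace expansion along the first two rows: taking the columns \<open>i\<close>,
  \<open>j\<close> in either order gives the same factor except for \<open>e j i\<close> against
  \<open>e i j\<close>, so the two terms add up to a minor. Conditions on pairs of rows thus control
  every exchange of neighbours.\<close>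

lemma wedge_Cons2:
  fixes rs :: "'j list" and S :: "'i::linorder set"
  assumes "finite S"
  shows "wedge e X (r # r' # rs) S = (\<Sum>(i, j)\<in>{(i, j). i \<in> S \<and> j \<in> S \<and> i < j}.
    (\<Prod>s\<in>S - {i, j}. e s i * e s j) \<bullet> minor2 e X r r' i j * \<theta> (\<theta> (wedge e X rs (S - {i, j}))))"
proof -
  let ?k = "\<lambda>i j. \<Prod>s\<in>S - {i, j}. e s i * e s j"
  let ?f = "\<lambda>i j. (?k i j) \<bullet> (e j i \<bullet> X r i * \<theta> (X r' j)) * \<theta> (\<theta> (wedge e X rs (S - {i, j})))"
  have "wedge e X (r # r' # rs) S = (\<Sum>i\<in>S. \<Sum>j\<in>S - {i}. ?f i j)"
  proof (subst wedge.simps(2), rule sum.cong[OF refl])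
    fix i assume i: "i \<in> S"
    have "(\<Prod>s\<in>S - {i}. e s i) \<bullet> X r i * \<theta> (wedge e X (r' # rs) (S - {i})) =
      (\<Sum>j\<in>S - {i}. (\<Prod>s\<in>S - {i}. e s i) \<bullet> X r i * ((\<Prod>s\<in>S - {i} - {j}. e s j) \<bullet> \<theta> (X r' j) *
         \<theta> (\<theta> (wedge e X rs (S - {i} - {j})))))"
      by (simp add: theta_sum theta_mult scl_sum sum_distrib_left scl_simps)
    also have "\<dots> = (\<Sum>j\<in>S - {i}. ?f i j)"
    proof (rule sum.cong[OF refl])
      fix j assume j: "j \<in> S - {i}"
      have S: "S - {i} - {j} = S - {i, j}" by auto
      have "(\<Prod>s\<in>S - {i}. e s i) = e j i * (\<Prod>s\<in>S - {i, j}. e s i)"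
        using j assms by (subst prod.remove[of _ j]) (auto simp: S)
      then show "(\<Prod>s\<in>S - {i}. e s i) \<bullet> X r i * ((\<Prod>s\<in>S - {i} - {j}. e s j) \<bullet> \<theta> (X r' j) *
         \<theta> (\<theta> (wedge e X rs (S - {i} - {j})))) = ?f i j"
        by (simp add: S scl_simps prod.distrib)
    qed
    finally show "(\<Prod>s\<in>S - {i}. e s i) \<bullet> X r i * \<theta> (wedge e X (r' # rs) (S - {i})) = \<dots>" .
  qed
  also have "\<dots> = (\<Sum>(i, j)\<in>{(i, j). i \<in> S \<and> j \<in> S \<and> i < j}. ?f i j + ?f j i)"
    by (rule sum_offdiag_pairs[OF assms])
  also have "\<dots> = (\<Sum>(i, j)\<in>{(i, j). i \<in> S \<and> j \<in> S \<and> i < j}.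
    (?k i j) \<bullet> minor2 e X r r' i j * \<theta> (\<theta> (wedge e X rs (S - {i, j}))))"
    by (intro sum.cong refl)
      (auto simp: minor2_def scl_simps scl_add distrib_right distrib_left insert_commute add.commute)
  finally show ?thesis .
qed

lemma wedge_swap:
  fixes S :: "'i::linorder set"
  assumes "manin e X K" "finite S" "S \<subseteq> K" "r \<in> K" "r' \<in> K" "r \<noteq> r'"
  shows "e r r' \<bullet> wedge e X (r # r' # rs) S = e r' r \<bullet> wedge e X (r' # r # rs) S"
proof -
  have *: "e r r' \<bullet> minor2 e X r r' i j = e r' r \<bullet> minor2 e X r' r i j"
    if "i \<in> S" "j \<in> S" "i < j" for i j
    using assms that unfolding manin_def by (metis less_irrefl subsetD)
  show ?thesis
    unfolding wedge_Cons2[OF assms(2)] scl_sum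
  proof (rule sum.cong[OF refl], clarify)
    fix i j assume ij: "i \<in> S" "j \<in> S" "i < j"
    let ?k = "\<Prod>s\<in>S - {i, j}. e s i * e s j" and ?w = "\<theta> (\<theta> (wedge e X rs (S - {i, j})))"
    have "e r r' \<bullet> (?k \<bullet> minor2 e X r r' i j * ?w) = ?k \<bullet> (e r r' \<bullet> minor2 e X r r' i j) * ?w"
      by (simp add: scl_simps)
    also have "\<dots> = e r' r \<bullet> (?k \<bullet> minor2 e X r' r i j * ?w)"
      unfolding *[OF ij] by (simp add: scl_simps)
    finally show "e r r' \<bullet> (?k \<bullet> minor2 e X r r' i j * ?w) = e r' r \<bullet> (?k \<bullet> minor2 e X r' r i j * ?w)" .
  qed
qed

lemma wedge_repeat:
  fixes S :: "'i::linorder set"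
  assumes "manin e X K" "finite S" "S \<subseteq> K" "r \<in> K"
  shows "wedge e X (r # r # rs) S = 0"
proof -
  have *: "minor2 e X r r i j = 0" if "i \<in> S" "j \<in> S" "i < j" for i j
    using assms that unfolding manin_def by (metis less_irrefl subsetD)
  show ?thesis
    unfolding wedge_Cons2[OF assms(2)]
    by (rule sum.neutral) (auto simp: *)
qed

lemma wedge_Cons_scaled:
  assumes "\<And>c. c \<in> S \<Longrightarrow> a \<bullet> wedge e X rs (S - {c}) = b \<bullet> wedge e X rs' (S - {c})"
  shows "a \<bullet> wedge e X (r # rs) S = b \<bullet> wedge e X (r # rs') S"
proof -
  have *: "a \<bullet> wedge e X (r # rs) S =
    (\<Sum>c\<in>S. (\<Prod>s\<in>S - {c}. e s c) \<bullet> X r c * \<theta> (a \<bullet> wedge e X rs (S - {c})))" for a rs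
    by (simp add: scl_sum scl_simps)
  show ?thesis unfolding * using assms by (intro sum.cong) auto
qed

lemma nrm_nonzero:
  "(\<And>i j. i \<in> K \<Longrightarrow> j \<in> K \<Longrightarrow> i \<noteq> j \<Longrightarrow> e i j \<noteq> 0) \<Longrightarrow> distinct rs \<Longrightarrow> set rs \<subseteq> K \<Longrightarrow> nrm e rs \<noteq> 0"
  by (induction rs) (auto simp: prod_zero_iff)

text \<open>Each exchange of \<open>r\<close> with a row \<open>a\<close> costs \<open>e a r\<close>
  against \<open>e r a\<close>, which is exactly how the two values of \<open>nrm\<close> differ.
  The statement is cross-multiplied so that no inverse scalar occurs in the induction.\<close>

lemma wedge_move:
  fixes S :: "'i::linorder set"
  assumes "manin e X K" "finite S" "S \<subseteq> K" "distinct (as @ r # bs)" "set (as @ r # bs) \<subseteq> K"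
    and e: "\<And>i j. i \<in> K \<Longrightarrow> j \<in> K \<Longrightarrow> i \<noteq> j \<Longrightarrow> e i j \<noteq> 0"
  shows "nrm e (r # as @ bs) \<bullet> wedge e X (as @ r # bs) S =
    nrm e (as @ r # bs) \<bullet> wedge e X (r # as @ bs) S"
  using assms(2-5)
proof (induction as arbitrary: S)
  case (Cons a as)
  let ?P = "\<Prod>s\<in>set (as @ bs). e s a" and ?Q = "\<Prod>s\<in>set (as @ bs). e s r"
  have ar: "a \<in> K" "r \<in> K" "a \<noteq> r" using Cons.prems by auto
  have IH: "nrm e (r # as @ bs) \<bullet> wedge e X (a # as @ r # bs) S =
    nrm e (as @ r # bs) \<bullet> wedge e X (a # r # as @ bs) S"
    by (rule wedge_Cons_scaled, rule Cons.IH) (use Cons.prems in auto)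
  have n: "nrm e (r # (a # as) @ bs) = e a r * ?P * nrm e (r # as @ bs)"
    "nrm e ((a # as) @ r # bs) = e r a * ?P * nrm e (as @ r # bs)"
    using Cons.prems by (auto simp: mult_ac)
  have "nrm e (r # (a # as) @ bs) \<bullet> wedge e X ((a # as) @ r # bs) S =
    (e a r * ?P) \<bullet> (nrm e (r # as @ bs) \<bullet> wedge e X (a # as @ r # bs) S)"
    unfolding n by (simp add: scl_simps)
  also have "\<dots> = ?P \<bullet> nrm e (as @ r # bs) \<bullet> (e a r \<bullet> wedge e X (a # r # as @ bs) S)"
    unfolding IH by (simp add: scl_simps)
  also have "e a r \<bullet> wedge e X (a # r # as @ bs) S = e r a \<bullet> wedge e X (r # a # as @ bs) S"
    by (rule wedge_swap[OF assms(1)]) (use Cons.prems ar in auto)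
  also have "?P \<bullet> nrm e (as @ r # bs) \<bullet> (e r a \<bullet> wedge e X (r # a # as @ bs) S) =
    nrm e ((a # as) @ r # bs) \<bullet> wedge e X (r # (a # as) @ bs) S"
    unfolding n by (simp add: scl_simps)
  finally show ?case .
qed simp

lemma wedge_perm:
  fixes S :: "'i::linorder set"
  assumes "manin e X K" "finite S" "S \<subseteq> K" "distinct rs" "set rs \<subseteq> K"
    and e: "\<And>i j. i \<in> K \<Longrightarrow> j \<in> K \<Longrightarrow> i \<noteq> j \<Longrightarrow> e i j \<noteq> 0" and "distinct rs'" "set rs' = set rs"
  shows "nrm e rs' \<bullet> wedge e X rs S = nrm e rs \<bullet> wedge e X rs' S"
  using assms(2-5,7,8)
proof (induction rs arbitrary: S rs')
  case (Cons r rs)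
  have "r \<in> set rs'" using Cons.prems by simp
  then obtain as bs where rs': "rs' = as @ r # bs" by (meson split_list)
  have set: "set (as @ bs) = set rs" using Cons.prems unfolding rs' by auto
  have e': "nrm e (r # as @ bs) \<noteq> 0"
    by (rule nrm_nonzero[OF e]) (use Cons.prems e set rs' in auto)
  have e'': "nrm e (as @ bs) \<noteq> 0" using e' by simp
  have 1: "nrm e (as @ bs) \<bullet> wedge e X (r # rs) S = nrm e rs \<bullet> wedge e X (r # as @ bs) S"
    by (rule wedge_Cons_scaled, rule Cons.IH) (use Cons.prems set rs' in auto)
  have 2: "nrm e (r # as @ bs) \<bullet> wedge e X rs' S = nrm e rs' \<bullet> wedge e X (r # as @ bs) S"
    unfolding rs' by (rule wedge_move[OF assms(1)]) (use Cons.prems set rs' e in auto)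
  have "nrm e (as @ bs) \<bullet> (nrm e rs' \<bullet> wedge e X (r # rs) S) =
      nrm e rs \<bullet> (nrm e rs' \<bullet> wedge e X (r # as @ bs) S)"
    unfolding scl_left_commute[of "nrm e (as @ bs)"] 1 by (rule scl_left_commute)
  also have "\<dots> = nrm e rs \<bullet> (nrm e (r # as @ bs) \<bullet> wedge e X rs' S)" by (simp only: 2)
  also have "\<dots> = nrm e (as @ bs) \<bullet> (nrm e (r # rs) \<bullet> wedge e X rs' S)"
    unfolding nrm.simps set by (simp add: scl_simps)
  finally show ?case by (simp only: scl_cancel[OF e''])
qed simp

text \<open>The second copy of \<open>r\<close> is moved next to the first; the scalar of the move
  is nonzero and cancels.\<close>

lemma wedge_repeat':
  fixes S :: "'i::linorder set"
  assumes "manin e X K" "finite S" "S \<subseteq> K" "distinct rs" "set rs \<subseteq> K" "r \<in> set rs"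
    and e: "\<And>i j. i \<in> K \<Longrightarrow> j \<in> K \<Longrightarrow> i \<noteq> j \<Longrightarrow> e i j \<noteq> 0"
  shows "wedge e X (r # rs) S = 0"
proof -
  obtain as bs where rs: "rs = as @ r # bs" using assms by (meson split_list)
  have nz: "nrm e (r # as @ bs) \<noteq> 0"
    by (rule nrm_nonzero[OF e]) (use assms rs in auto)
  have "nrm e (r # as @ bs) \<bullet> wedge e X (r # rs) S = nrm e rs \<bullet> wedge e X (r # r # as @ bs) S"
    by (rule wedge_Cons_scaled, unfold rs, rule wedge_move[OF assms(1)]) (use assms rs in auto)
  also have "\<dots> = 0" using wedge_repeat[of e X K S r "as @ bs"] assms by auto
  finally show ?thesis using nz scl_cancel[OF nz, of _ 0] by simp
qed

lemma rdet_perm: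
  fixes rs :: "'i::linorder list"
  assumes "manin e X K" "distinct rs" "set rs \<subseteq> K" "distinct rs'" "set rs' = set rs"
    and e: "\<And>i j. i \<in> K \<Longrightarrow> j \<in> K \<Longrightarrow> i \<noteq> j \<Longrightarrow> e i j \<noteq> 0"
  shows "rdet e X rs = rdet e X rs'"
proof -
  have nz: "nrm e rs \<noteq> 0" "nrm e rs' \<noteq> 0" by (rule nrm_nonzero[OF e]; use assms in auto)+
  have "nrm e rs' \<bullet> wedge e X rs (set rs) = nrm e rs \<bullet> wedge e X rs' (set rs)"
    by (rule wedge_perm[OF assms(1)]) (use assms in auto)
  then have "(inverse (nrm e rs) * inverse (nrm e rs')) \<bullet> (nrm e rs' \<bullet> wedge e X rs (set rs)) =
    (inverse (nrm e rs) * inverse (nrm e rs')) \<bullet> (nrm e rs \<bullet> wedge e X rs' (set rs))" by simp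
  then show ?thesis
    using nz by (simp add: rdet_def assms(5) scl_simps) (simp add: field_simps)
qed

lemma wedge_cong:
  "(\<And>r c. r \<in> set rs \<Longrightarrow> c \<in> S \<Longrightarrow> X r c = Y r c) \<Longrightarrow>
   (\<And>s c. s \<in> S \<Longrightarrow> c \<in> S \<Longrightarrow> s \<noteq> c \<Longrightarrow> e s c = f s c) \<Longrightarrow> wedge e X rs S = wedge f Y rs S"
proof (induction rs arbitrary: S)
  case (Cons r rs)
  have "wedge e X rs (S - {c}) = wedge f Y rs (S - {c})" for c
    by (rule Cons.IH) (use Cons.prems in auto)
  moreover have "(\<Prod>s\<in>S - {c}. e s c) = (\<Prod>s\<in>S - {c}. f s c)" if "c \<in> S" for c
    using Cons.prems that by (intro prod.cong) auto
  ultimately show ?case using Cons.prems by simp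
qed simp

text \<open>
  Replacing the rows in \<open>J\<close> by those of the Schur complement subtracts left multiples of later
  rows, so the product is unchanged; afterwards the columns in \<open>I\<close> must come from the rows in \<open>I\<close>.
\<close>

lemma wedge_row_op:
  fixes S :: "'i::linorder set"
  assumes "manin e X K" "finite S" "S \<subseteq> K" "distinct (js @ is)" "set (js @ is) \<subseteq> K"
    and e: "\<And>i j. i \<in> K \<Longrightarrow> j \<in> K \<Longrightarrow> i \<noteq> j \<Longrightarrow> e i j \<noteq> 0"
    and Y: "\<And>j c. j \<in> set js \<Longrightarrow> c \<in> K \<Longrightarrow> Y j c = X j c - (\<Sum>b\<in>set is. N j b * X b c)"
    and Y': "\<And>b c. b \<in> set is \<Longrightarrow> c \<in> K \<Longrightarrow> Y b c = X b c"
  shows "wedge e Y (js @ is) S = wedge e X (js @ is) S"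
  using assms(2-5) Y
proof (induction js arbitrary: S)
  case Nil
  then show ?case by (intro wedge_cong) (auto simp: Y')
next
  case (Cons j js)
  let ?p = "\<lambda>c. \<Prod>s\<in>S - {c}. e s c" and ?w = "\<lambda>c. \<theta> (wedge e X (js @ is) (S - {c}))"
  have IH: "wedge e Y (js @ is) (S - {c}) = wedge e X (js @ is) (S - {c})" for c
    by (rule Cons.IH) (use Cons.prems in auto)
  have "wedge e Y ((j # js) @ is) S = (\<Sum>c\<in>S. ?p c \<bullet> Y j c * ?w c)"
    by (simp add: IH)
  also have "\<dots> = (\<Sum>c\<in>S. ?p c \<bullet> X j c * ?w c - (\<Sum>b\<in>set is. N j b * (?p c \<bullet> X b c * ?w c)))"
    by (intro sum.cong refl, subst Cons.prems)
      (use Cons.prems in \<open>auto simp: algebra_simps scl_diff scl_sum sum_distrib_left sum_distrib_right scl_simps\<close>)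
  \<comment> \<open>The subtracted rows stand in first position, unshifted like row
    \<open>j\<close>. So each of them contributes a full wedge with \<open>b\<close> in front, and
    \<open>b\<close> occurs again in \<open>is\<close>.\<close>
  also have "\<dots> = wedge e X (j # js @ is) S - (\<Sum>b\<in>set is. N j b * wedge e X (b # js @ is) S)"
    unfolding sum_subtractf by (subst sum.swap) (simp add: sum_distrib_left)
  also have "(\<Sum>b\<in>set is. N j b * wedge e X (b # js @ is) S) = 0"
  proof (rule sum.neutral, rule ballI)
    fix b assume "b \<in> set is"
    then have "wedge e X (b # js @ is) S = 0"
      by (intro wedge_repeat'[OF assms(1)]) (use Cons.prems e in auto)
    then show "N j b * wedge e X (b # js @ is) S = 0" by simp
  qed
  finally show ?case by simp
qed

text \<open>The first \<open>card T\<close> rows have no entries in the columns \<open>I\<close>, so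
  they use up \<open>T\<close>, and the remaining rows get exactly \<open>I\<close>, shifted by the
  number of rows before them. The double product of \<open>e\<close> compares
  \<open>\<psi>_T \<psi>_I\<close> with the basis element of the union.\<close>

lemma wedge_split:
  assumes fin: "finite T" "finite I" and "T \<inter> I = {}" and "length js = card T"
    and Y: "\<And>j c. j \<in> set js \<Longrightarrow> c \<in> I \<Longrightarrow> Y j c = 0"
  shows "wedge e Y (js @ is) (T \<union> I) =
    (\<Prod>t\<in>T. \<Prod>s\<in>I. e s t) \<bullet> wedge e Y js T * (\<theta> ^^ length js) (wedge e Y is I)"
  using assms
proof (induction js arbitrary: T)
  case Nil
  then have "T = {}" by simp
  then show ?case by simp
next
  case (Cons j js)
  let ?g = "\<lambda>T. \<Prod>t\<in>T. \<Prod>s\<in>I. e s t"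
  have "wedge e Y ((j # js) @ is) (T \<union> I) =
    (\<Sum>c\<in>T. (\<Prod>s\<in>T \<union> I - {c}. e s c) \<bullet> Y j c * \<theta> (wedge e Y (js @ is) (T \<union> I - {c})))"
    unfolding append_Cons wedge.simps
    by (rule sum.mono_neutral_right) (use Cons.prems in auto)
  also have "\<dots> = (\<Sum>c\<in>T. (?g T) \<bullet> ((\<Prod>s\<in>T - {c}. e s c) \<bullet> Y j c * \<theta> (wedge e Y js (T - {c}))) *
     (\<theta> ^^ length (j # js)) (wedge e Y is I))"
  proof (rule sum.cong[OF refl])
    fix c assume c: "c \<in> T"
    have T: "T \<union> I - {c} = (T - {c}) \<union> I" using c Cons.prems by auto
    have IH: "wedge e Y (js @ is) (T \<union> I - {c}) =
      (?g (T - {c})) \<bullet> wedge e Y js (T - {c}) * (\<theta> ^^ length js) (wedge e Y is I)"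
      unfolding T by (rule Cons.IH) (use Cons.prems c in auto)
    have g: "?g T = (\<Prod>s\<in>I. e s c) * ?g (T - {c})"
      using c Cons.prems by (subst prod.remove[of _ c]) auto
    have p: "(\<Prod>s\<in>T \<union> I - {c}. e s c) = (\<Prod>s\<in>T - {c}. e s c) * (\<Prod>s\<in>I. e s c)"
      unfolding T using Cons.prems by (intro prod.union_disjoint) auto
    show "(\<Prod>s\<in>T \<union> I - {c}. e s c) \<bullet> Y j c * \<theta> (wedge e Y (js @ is) (T \<union> I - {c})) =
      (?g T) \<bullet> ((\<Prod>s\<in>T - {c}. e s c) \<bullet> Y j c * \<theta> (wedge e Y js (T - {c}))) *
     (\<theta> ^^ length (j # js)) (wedge e Y is I)"
      unfolding IH g p by (simp add: scl_simps)
  qed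
  also have "\<dots> = (?g T) \<bullet> wedge e Y (j # js) T * (\<theta> ^^ length (j # js)) (wedge e Y is I)"
    by (simp add: scl_sum sum_distrib_right)
  finally show ?case .
qed

lemma nrm_append:
  assumes "distinct (js @ is)"
  shows "nrm e (js @ is) = (\<Prod>t\<in>set js. \<Prod>s\<in>set is. e s t) * nrm e js * nrm e is"
  using assms by (induction js) (auto simp: prod.union_disjoint mult_ac Un_commute)

text \<open>\<open>N\<close> plays the role of \<open>X_JI X_II^{-1}\<close>, the multipliers that
  clear the columns \<open>I\<close> in the rows \<open>J\<close>. The rows \<open>J\<close> are put
  first; hence the Schur factor is on the left and unshifted, while the determinant on
  \<open>I\<close> carries one shift per row of \<open>J\<close>.\<close>

theorem rdet_schur:
  fixes ks :: "'i::linorder list"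
  assumes "manin e X K" and K: "K = set ks" "set js \<union> set is = set ks" "distinct ks" "distinct (js @ is)"
    and e: "\<And>i j. i \<in> K \<Longrightarrow> j \<in> K \<Longrightarrow> i \<noteq> j \<Longrightarrow> e i j \<noteq> 0"
    and S: "\<And>j c. j \<in> set js \<Longrightarrow> c \<in> set js \<Longrightarrow> S j c = X j c - (\<Sum>b\<in>set is. N j b * X b c)"
    and N: "\<And>j c. j \<in> set js \<Longrightarrow> c \<in> set is \<Longrightarrow> X j c = (\<Sum>b\<in>set is. N j b * X b c)"
  shows "rdet e X ks = rdet e S js * (\<theta> ^^ length js) (rdet e X is)"
proof -
  define Y where "Y j c = (if j \<in> set js then X j c - (\<Sum>b\<in>set is. N j b * X b c) else X j c)" for j c
  let ?g = "\<Prod>t\<in>set js. \<Prod>s\<in>set is. e s t"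
  have nz: "nrm e (js @ is) \<noteq> 0" by (rule nrm_nonzero[OF e]; use K in auto)
  have dj: "set js \<inter> set is = {}" using K by auto
  have "rdet e X ks = rdet e X (js @ is)"
    by (rule rdet_perm[OF assms(1)]) (use assms in auto)
  also have "\<dots> = inverse (nrm e (js @ is)) \<bullet> wedge e X (js @ is) (set (js @ is))"
    by (simp add: rdet_def)
  also have "wedge e X (js @ is) (set (js @ is)) = wedge e Y (js @ is) (set (js @ is))"
    by (rule wedge_row_op[OF assms(1), symmetric, where N = N]) (use assms dj in \<open>auto simp: Y_def\<close>)
  also have "\<dots> = ?g \<bullet> wedge e Y js (set js) * (\<theta> ^^ length js) (wedge e Y is (set is))"
    unfolding set_append
    by (rule wedge_split) (use K N in \<open>auto simp: Y_def distinct_card\<close>)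
  also have "wedge e Y js (set js) = wedge e S js (set js)"
    by (rule wedge_cong) (auto simp: Y_def S)
  also have "wedge e Y is (set is) = wedge e X is (set is)"
    by (rule wedge_cong) (use dj in \<open>auto simp: Y_def\<close>)
  also have "inverse (nrm e (js @ is)) \<bullet>
    (?g \<bullet> wedge e S js (set js) * (\<theta> ^^ length js) (wedge e X is (set is))) =
    (inverse (nrm e (js @ is)) * ?g) \<bullet> (wedge e S js (set js) * (\<theta> ^^ length js) (wedge e X is (set is)))"
    by (simp add: scl_simps)
  also have "inverse (nrm e (js @ is)) * ?g = inverse (nrm e js) * inverse (nrm e is)"
    using nz unfolding nrm_append[OF K(4)] by (simp add: field_simps)
  finally show ?thesis
    by (simp add: rdet_def sc_mult theta_power_mult scl_simps)
qed

lemma rdet_schur_inv: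
  fixes ks :: "'i::linorder list"
  assumes "manin e X K" and K: "K = set ks" "set js \<union> set is = set ks" "distinct ks" "distinct (js @ is)"
    and e: "\<And>i j. i \<in> K \<Longrightarrow> j \<in> K \<Longrightarrow> i \<noteq> j \<Longrightarrow> e i j \<noteq> 0"
    and N: "inv_on (set is) X N"
  shows "rdet e X ks = rdet e (schur (set is) X N) js * (\<theta> ^^ length js) (rdet e X is)"
proof (rule rdet_schur[OF assms(1) K e, where N = "mm (set is) X N"])
  fix j c assume "c \<in> set is"
  have "X j c = mm (set is) X idm j c" using \<open>c \<in> set is\<close> by (simp add: mm_idm_right)
  also have "\<dots> = mm (set is) X (mm (set is) N X) j c"
    by (rule mm_cong) (use N \<open>c \<in> set is\<close> in \<open>auto simp: inv_onD\<close>)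
  finally show "X j c = (\<Sum>b\<in>set is. mm (set is) X N j b * X b c)"
    unfolding mm_assoc[symmetric] by (simp add: mm_def[of _ "mm _ _ _"])
next
  fix j c
  show "schur (set is) X N j c = X j c - (\<Sum>b\<in>set is. mm (set is) X N j b * X b c)"
    unfolding schur_def mm_assoc[symmetric] by (simp add: mm_def[of _ "mm _ _ _"])
qed auto

section \<open>Relabelling of indices, rescaling of weights, and the Leibniz expansion\<close>

lemma wedge_map:
  assumes "inj_on f S"
  shows "wedge e X (map f rs) (f ` S) = wedge (\<lambda>s c. e (f s) (f c)) (\<lambda>r c. X (f r) (f c)) rs S"
  using assms
proof (induction rs arbitrary: S)
  case (Cons r rs)
  have im: "f ` S - {f c} = f ` (S - {c})" if "c \<in> S" for c
    using Cons.prems that by (auto simp: inj_on_def)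
  have "wedge e X (map f (r # rs)) (f ` S) =
    (\<Sum>c\<in>S. (\<Prod>s\<in>f ` S - {f c}. e s (f c)) \<bullet> X (f r) (f c) * \<theta> (wedge e X (map f rs) (f ` S - {f c})))"
    using Cons.prems by (simp add: sum.reindex)
  also have "\<dots> = (\<Sum>c\<in>S. (\<Prod>s\<in>S - {c}. e (f s) (f c)) \<bullet> X (f r) (f c) *
     \<theta> (wedge (\<lambda>s c. e (f s) (f c)) (\<lambda>r c. X (f r) (f c)) rs (S - {c})))"
  proof (rule sum.cong[OF refl])
    fix c assume c: "c \<in> S"
    have inj: "inj_on f (S - {c})" using Cons.prems by (rule inj_on_subset) auto
    show "(\<Prod>s\<in>f ` S - {f c}. e s (f c)) \<bullet> X (f r) (f c) * \<theta> (wedge e X (map f rs) (f ` S - {f c})) =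
      (\<Prod>s\<in>S - {c}. e (f s) (f c)) \<bullet> X (f r) (f c) *
      \<theta> (wedge (\<lambda>s c. e (f s) (f c)) (\<lambda>r c. X (f r) (f c)) rs (S - {c}))"
      unfolding im[OF c] Cons.IH[OF inj] prod.reindex[OF inj] by simp
  qed
  finally show ?case by simp
qed simp

lemma nrm_map: "inj_on f (set rs) \<Longrightarrow> nrm e (map f rs) = nrm (\<lambda>s c. e (f s) (f c)) rs"
  by (induction rs) (auto simp: prod.reindex)

lemma rdet_map:
  "inj_on f (set rs) \<Longrightarrow> rdet e X (map f rs) = rdet (\<lambda>s c. e (f s) (f c)) (\<lambda>r c. X (f r) (f c)) rs"
  by (simp add: rdet_def nrm_map wedge_map)

lemma nrm_cong:
  "(\<And>s c. s \<in> set rs \<Longrightarrow> c \<in> set rs \<Longrightarrow> s \<noteq> c \<Longrightarrow> e s c = f s c) \<Longrightarrow> distinct rs \<Longrightarrow> nrm e rs = nrm f rs"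
  by (induction rs) (auto intro!: prod.cong arg_cong2[of _ _ _ _ "(*)"])

lemma rdet_cong:
  assumes "\<And>r c. r \<in> set rs \<Longrightarrow> c \<in> set rs \<Longrightarrow> X r c = Y r c" "distinct rs"
    and "\<And>s c. s \<in> set rs \<Longrightarrow> c \<in> set rs \<Longrightarrow> s \<noteq> c \<Longrightarrow> e s c = f s c"
  shows "rdet e X rs = rdet f Y rs"
proof -
  have "nrm e rs = nrm f rs" by (rule nrm_cong) (use assms in auto)
  moreover have "wedge e X rs (set rs) = wedge f Y rs (set rs)" by (rule wedge_cong) (use assms in auto)
  ultimately show ?thesis by (simp add: rdet_def)
qed

lemma wedge_scaled:
  assumes "finite S" "length rs = card S"
  shows "wedge (\<lambda>s c. g * e s c) X rs S = (g ^ (\<Sum>i<card S. i)) \<bullet> wedge e X rs S"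
  using assms
proof (induction rs arbitrary: S)
  case (Cons r rs)
  have c: "card (S - {c}) = length rs" if "c \<in> S" for c using Cons.prems that by simp
  have IH: "wedge (\<lambda>s c. g * e s c) X rs (S - {c}) = (g ^ (\<Sum>i<length rs. i)) \<bullet> wedge e X rs (S - {c})"
    if "c \<in> S" for c
    using Cons.IH[of "S - {c}"] Cons.prems c[OF that] that by simp
  have cS: "card S = Suc (length rs)" using Cons.prems by simp
  show ?case
    unfolding wedge.simps scl_sum cS
    by (intro sum.cong refl)
      (use Cons.prems in \<open>simp add: cS IH c prod.distrib scl_simps power_add\<close>)
qed auto

lemma nrm_scaled:
  "distinct rs \<Longrightarrow> nrm (\<lambda>s c. g * e s c) rs = g ^ (\<Sum>i<length rs. i) * nrm e rs"
  by (induction rs) (auto simp: prod.distrib distinct_card power_add mult_ac)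

text \<open>Every term of \<open>wedge\<close> and also \<open>nrm\<close> contain
  \<open>n(n-1)/2\<close> weights, so the power of \<open>g\<close> cancels. This is what makes
  \<open>q\<close> and its inverse interchangeable when the indices are reversed.\<close>

lemma rdet_scaled:
  assumes "distinct rs" "g \<noteq> 0"
    and "\<And>s c. s \<in> set rs \<Longrightarrow> c \<in> set rs \<Longrightarrow> s \<noteq> c \<Longrightarrow> f s c = g * e s c"
  shows "rdet f X rs = rdet e X rs"
proof -
  have "rdet f X rs = rdet (\<lambda>s c. g * e s c) X rs"
    by (rule rdet_cong) (use assms in auto)
  also have "\<dots> = rdet e X rs"
    using assms
    by (simp add: rdet_def nrm_scaled wedge_scaled distinct_card scl_simps)
  finally show ?thesis .
qed

primrec prodrow :: "('j \<Rightarrow> 'i \<Rightarrow> 'a) \<Rightarrow> 'j list \<Rightarrow> 'i list \<Rightarrow> 'a" where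
  "prodrow X [] cs = 1"
| "prodrow X (r # rs) cs = X r (hd cs) * \<theta> (prodrow X rs (tl cs))"

text \<open>Expanding the product of one-forms, the choice \<open>cs\<close> of columns contributes
  the product of the \<open>\<psi>_c\<close> along \<open>cs\<close>, whose coefficient is
  \<open>nrm e cs\<close>.\<close>

lemma wedge_permutations:
  assumes "finite S" "length rs = card S"
  shows "wedge e X rs S = (\<Sum>cs\<in>permutations_of_set S. nrm e cs \<bullet> prodrow X rs cs)"
  using assms
proof (induction rs arbitrary: S)
  case (Cons r rs)
  then have "S \<noteq> {}" by auto
  have "(\<Sum>cs\<in>permutations_of_set S. nrm e cs \<bullet> prodrow X (r # rs) cs) =
    (\<Sum>cs\<in>(\<Union>c\<in>S. (#) c ` permutations_of_set (S - {c})). nrm e cs \<bullet> prodrow X (r # rs) cs)"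
    by (simp only: permutations_of_set_nonempty[OF \<open>S \<noteq> {}\<close>])
  also have "\<dots> = (\<Sum>c\<in>S. \<Sum>cs\<in>(#) c ` permutations_of_set (S - {c}). nrm e cs \<bullet> prodrow X (r # rs) cs)"
    by (rule sum.UNION_disjoint) (use Cons.prems in auto)
  also have "\<dots> = (\<Sum>c\<in>S. \<Sum>cs\<in>permutations_of_set (S - {c}). nrm e (c # cs) \<bullet> prodrow X (r # rs) (c # cs))"
    by (simp add: sum.reindex)
  also have "\<dots> = (\<Sum>c\<in>S. \<Sum>cs\<in>permutations_of_set (S - {c}).
     (\<Prod>s\<in>S - {c}. e s c) \<bullet> X r c * \<theta> (nrm e cs \<bullet> prodrow X rs cs))"
    by (intro sum.cong refl) (auto simp: permutations_of_setD scl_simps)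
  also have "\<dots> = wedge e X (r # rs) S"
    unfolding wedge.simps
    by (intro sum.cong refl, subst Cons.IH) (use Cons.prems in \<open>auto simp: theta_sum scl_sum sum_distrib_left theta_scl\<close>)
  finally show ?case ..
qed auto

end

section \<open>Column determinants via the opposite ring\<close>

datatype 'a opp = Opp (unopp: 'a)

instantiation opp :: (ring_1) ring_1
begin

definition zero_opp :: "'a opp" where "0 = Opp 0"
definition one_opp :: "'a opp" where "1 = Opp 1"
definition plus_opp :: "'a opp \<Rightarrow> 'a opp \<Rightarrow> 'a opp" where "x + y = Opp (unopp x + unopp y)"
definition minus_opp :: "'a opp \<Rightarrow> 'a opp \<Rightarrow> 'a opp" where "x - y = Opp (unopp x - unopp y)"
definition uminus_opp :: "'a opp \<Rightarrow> 'a opp" where "- x = Opp (- unopp x)"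
definition times_opp :: "'a opp \<Rightarrow> 'a opp \<Rightarrow> 'a opp" where "x * y = Opp (unopp y * unopp x)"

instance
  by standard (auto simp: zero_opp_def one_opp_def plus_opp_def minus_opp_def uminus_opp_def
    times_opp_def algebra_simps intro: opp.expand)

end

lemma unopp_simps [simp]:
  "unopp 0 = 0" "unopp 1 = 1" "unopp (x + y) = unopp x + unopp y"
  "unopp (x - y) = unopp x - unopp y" "unopp (x * y) = unopp y * unopp x"
  by (simp_all add: zero_opp_def one_opp_def plus_opp_def minus_opp_def times_opp_def)

lemma unopp_sum: "unopp (sum f A) = (\<Sum>x\<in>A. unopp (f x))"
  by (induction A rule: infinite_finite_induct) auto

lemma unopp_prod_list: "unopp (prod_list xs) = prod_list (rev (map unopp xs))"
  by (induction xs) auto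

lemma unopp_inject: "unopp x = unopp y \<longleftrightarrow> x = y"
  by (auto intro: opp.expand)

lemma scalar_ext_opp:
  fixes sc :: "'k::field \<Rightarrow> 'a::ring_1"
  assumes "scalar_ext sc \<theta>"
  shows "scalar_ext (\<lambda>a. Opp (sc a)) (\<lambda>x. Opp (\<theta> (unopp x)))"
proof -
  interpret scalar_ext sc \<theta> by fact
  show ?thesis
  proof
    fix a and x :: "'a opp"
    have "unopp x * sc a = sc a * unopp x" by (rule sc_central[symmetric])
    then show "Opp (sc a) * x = x * Opp (sc a)" by (simp flip: unopp_inject)
  next
    fix a b
    have "sc a * sc b = sc b * sc a" by (rule sc_central)
    then show "Opp (sc (a * b)) = Opp (sc a) * Opp (sc b)" by (simp add: sc_mult flip: unopp_inject)
  qed (simp_all add: sc_add theta_add theta_mult flip: unopp_inject)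
qed

context scalar_ext
begin

definition cmanin :: "('i \<Rightarrow> 'i \<Rightarrow> 'k) \<Rightarrow> ('i \<Rightarrow> 'i \<Rightarrow> 'a) \<Rightarrow> 'i set \<Rightarrow> bool" where
  "cmanin e X = scalar_ext.manin (\<lambda>a. Opp (sc a)) (\<lambda>x. Opp (\<theta> (unopp x))) e (\<lambda>r c. Opp (X c r))"

text \<open>Undoing the opposite product reverses the factors: the column \<open>rs ! p\<close>
  gives the factor with \<open>p\<close> factors to its right, and it carries
  \<open>\<theta> ^^ p\<close>. Shifts therefore grow from right to left, and a column determinant
  in natural order uses a reversed list.\<close>

definition cdet :: "('i \<Rightarrow> 'i \<Rightarrow> 'k) \<Rightarrow> ('i \<Rightarrow> 'i \<Rightarrow> 'a) \<Rightarrow> 'i list \<Rightarrow> 'a" where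
  "cdet e X rs = unopp
     (scalar_ext.rdet (\<lambda>a. Opp (sc a)) (\<lambda>x. Opp (\<theta> (unopp x))) e (\<lambda>r c. Opp (X c r)) rs)"

lemma funpow_opp: "((\<lambda>x. Opp (\<theta> (unopp x))) ^^ n) x = Opp ((\<theta> ^^ n) (unopp x))"
  by (induction n) auto

lemma cdet_schur:
  fixes ks :: "'i::linorder list"
  assumes "cmanin e X K" and K: "K = set ks" "set js \<union> set is = set ks" "distinct ks" "distinct (js @ is)"
    and e: "\<And>i j. i \<in> K \<Longrightarrow> j \<in> K \<Longrightarrow> i \<noteq> j \<Longrightarrow> e i j \<noteq> 0"
    and S: "\<And>j c. j \<in> set js \<Longrightarrow> c \<in> set js \<Longrightarrow> S c j = X c j - (\<Sum>b\<in>set is. X c b * N b j)"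
    and N: "\<And>j c. j \<in> set js \<Longrightarrow> c \<in> set is \<Longrightarrow> X c j = (\<Sum>b\<in>set is. X c b * N b j)"
  shows "cdet e X ks = (\<theta> ^^ length js) (cdet e X is) * cdet e S js"
proof -
  interpret op: scalar_ext "\<lambda>a. Opp (sc a)" "\<lambda>x. Opp (\<theta> (unopp x))"
    by (rule scalar_ext_opp) unfold_locales
  have "op.rdet e (\<lambda>r c. Opp (X c r)) ks = op.rdet e (\<lambda>r c. Opp (S c r)) js *
    ((\<lambda>x. Opp (\<theta> (unopp x))) ^^ length js) (op.rdet e (\<lambda>r c. Opp (X c r)) is)"
    by (rule op.rdet_schur[where N = "\<lambda>r c. Opp (N c r)", OF assms(1)[unfolded cmanin_def]])
      (use assms in \<open>auto simp: unopp_sum simp flip: unopp_inject\<close>)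
  then show ?thesis by (simp add: cdet_def funpow_opp flip: unopp_inject)
qed

lemma cdet_schur_inv:
  fixes ks :: "'i::linorder list"
  assumes "cmanin e X K" and K: "K = set ks" "set js \<union> set is = set ks" "distinct ks" "distinct (js @ is)"
    and e: "\<And>i j. i \<in> K \<Longrightarrow> j \<in> K \<Longrightarrow> i \<noteq> j \<Longrightarrow> e i j \<noteq> 0"
    and N: "inv_on (set is) X N"
  shows "cdet e X ks = (\<theta> ^^ length js) (cdet e X is) * cdet e (schur (set is) X N) js"
proof (rule cdet_schur[OF assms(1) K e, where N = "mm (set is) N X"])
  fix j c assume "c \<in> set is"
  have "X c j = mm (set is) idm X c j" using \<open>c \<in> set is\<close> by (simp add: mm_idm_left)
  also have "\<dots> = mm (set is) (mm (set is) X N) X c j"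
    by (rule mm_cong) (use N \<open>c \<in> set is\<close> in \<open>auto simp: inv_onD\<close>)
  finally show "X c j = (\<Sum>b\<in>set is. X c b * mm (set is) N X b j)"
    unfolding mm_assoc by (simp add: mm_def[of _ _ "mm _ _ _"])
next
  fix j c
  show "schur (set is) X N c j = X c j - (\<Sum>b\<in>set is. X c b * mm (set is) N X b j)"
    unfolding schur_def by (simp add: mm_def[of _ _ "mm _ _ _"])
qed auto

lemma rdet_singleton: "rdet e X [j] = X j j"
  by (simp add: rdet_def)

lemma cdet_singleton: "cdet e X [j] = X j j"
proof -
  interpret op: scalar_ext "\<lambda>a. Opp (sc a)" "\<lambda>x. Opp (\<theta> (unopp x))"
    by (rule scalar_ext_opp) unfold_locales
  show ?thesis by (simp add: cdet_def op.rdet_singleton)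
qed

lemma rdet_Nil [simp]: "rdet e X [] = 1"
  by (simp add: rdet_def)

lemma cdet_Nil [simp]: "cdet e X [] = 1"
proof -
  interpret op: scalar_ext "\<lambda>a. Opp (sc a)" "\<lambda>x. Opp (\<theta> (unopp x))"
    by (rule scalar_ext_opp) unfold_locales
  show ?thesis by (simp add: cdet_def)
qed

lemma cdet_map:
  "inj_on f (set rs) \<Longrightarrow> cdet e X (map f rs) = cdet (\<lambda>s c. e (f s) (f c)) (\<lambda>r c. X (f r) (f c)) rs"
proof -
  assume *: "inj_on f (set rs)"
  interpret op: scalar_ext "\<lambda>a. Opp (sc a)" "\<lambda>x. Opp (\<theta> (unopp x))"
    by (rule scalar_ext_opp) unfold_locales
  show ?thesis by (simp add: cdet_def op.rdet_map[OF *])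
qed

lemma cdet_cong:
  assumes "\<And>r c. r \<in> set rs \<Longrightarrow> c \<in> set rs \<Longrightarrow> X r c = Y r c" "distinct rs"
    and "\<And>s c. s \<in> set rs \<Longrightarrow> c \<in> set rs \<Longrightarrow> s \<noteq> c \<Longrightarrow> e s c = f s c"
  shows "cdet e X rs = cdet f Y rs"
proof -
  interpret op: scalar_ext "\<lambda>a. Opp (sc a)" "\<lambda>x. Opp (\<theta> (unopp x))"
    by (rule scalar_ext_opp) unfold_locales
  show ?thesis unfolding cdet_def
    by (rule arg_cong[of _ _ unopp], rule op.rdet_cong) (use assms in auto)
qed

lemma cdet_scaled:
  assumes "distinct rs" "g \<noteq> 0"
    and "\<And>s c. s \<in> set rs \<Longrightarrow> c \<in> set rs \<Longrightarrow> s \<noteq> c \<Longrightarrow> f s c = g * e s c"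
  shows "cdet f X rs = cdet e X rs"
proof -
  interpret op: scalar_ext "\<lambda>a. Opp (sc a)" "\<lambda>x. Opp (\<theta> (unopp x))"
    by (rule scalar_ext_opp) unfold_locales
  show ?thesis unfolding cdet_def
    by (rule arg_cong[of _ _ unopp], rule op.rdet_scaled[OF assms])
qed

lemma theta_power_add: "(\<theta> ^^ n) (x + y) = (\<theta> ^^ n) x + (\<theta> ^^ n) y"
  by (induction n) (simp_all add: theta_add)

lemma theta_power_0 [simp]: "(\<theta> ^^ n) 0 = 0" and theta_power_1 [simp]: "(\<theta> ^^ n) 1 = 1"
  by (induction n) simp_all

lemma theta_power_sum: "(\<theta> ^^ n) (sum f A) = (\<Sum>x\<in>A. (\<theta> ^^ n) (f x))"
  by (induction A rule: infinite_finite_induct) (auto simp: theta_power_add)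

lemma wedge_commutes:
  assumes "\<And>m r c. r \<in> set rs \<Longrightarrow> c \<in> S \<Longrightarrow> x * (\<theta> ^^ m) (X r c) = (\<theta> ^^ m) (X r c) * x"
  shows "x * (\<theta> ^^ n) (wedge e X rs S) = (\<theta> ^^ n) (wedge e X rs S) * x"
  using assms
proof (induction rs arbitrary: n S)
  case (Cons r rs)
  have IH: "x * (\<theta> ^^ Suc n) (wedge e X rs (S - {c})) = (\<theta> ^^ Suc n) (wedge e X rs (S - {c})) * x" for c
    by (rule Cons.IH) (use Cons.prems in auto)
  show ?case
    unfolding wedge.simps theta_power_sum sum_distrib_left sum_distrib_right
  proof (rule sum.cong[OF refl])
    fix c assume "c \<in> S"
    then have "x * (\<theta> ^^ n) (X r c) = (\<theta> ^^ n) (X r c) * x" using Cons.prems by simp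
    then have "x * ((\<theta> ^^ n) (X r c) * (\<theta> ^^ Suc n) (wedge e X rs (S - {c}))) =
      (\<theta> ^^ n) (X r c) * (\<theta> ^^ Suc n) (wedge e X rs (S - {c})) * x"
      using IH[of c] by (metis mult.assoc)
    then show "x * (\<theta> ^^ n) ((\<Prod>s\<in>S - {c}. e s c) \<bullet> X r c * \<theta> (wedge e X rs (S - {c}))) =
         (\<theta> ^^ n) ((\<Prod>s\<in>S - {c}. e s c) \<bullet> X r c * \<theta> (wedge e X rs (S - {c}))) * x"
      by (simp add: scl_simps theta_power_mult funpow_swap1)
  qed
qed simp

lemma rdet_commutes:
  assumes "\<And>m r c. r \<in> set rs \<Longrightarrow> c \<in> set rs \<Longrightarrow> x * (\<theta> ^^ m) (X r c) = (\<theta> ^^ m) (X r c) * x"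
  shows "x * (\<theta> ^^ n) (rdet e X rs) = (\<theta> ^^ n) (rdet e X rs) * x"
  using wedge_commutes[of rs "set rs" x X n e, OF assms]
  by (simp add: rdet_def scl_simps)

text \<open>
  The form taken by the relation $R(z,w)L_1(z)L_2(w) = L_2(w)L_1(z)R(z,w)$ at \<open>w = z q\<^sup>2\<close>,
  for \<open>X = L(w)\<close> and \<open>\<theta> X = L(z)\<close>, where $R$ has rank one on each pair of distinct indices.
\<close>

definition fused :: "('i \<Rightarrow> 'i \<Rightarrow> 'k) \<Rightarrow> ('i \<Rightarrow> 'i \<Rightarrow> 'a) \<Rightarrow> 'i set \<Rightarrow> bool" where
  "fused e X K \<longleftrightarrow> (\<forall>i\<in>K. \<forall>j\<in>K. \<forall>k\<in>K. \<forall>l\<in>K.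
     (if i = k then 0 else \<theta> (X i j) * X k l + (e i k / e k i) \<bullet> \<theta> (X k j) * X i l) =
     (if j = l then 0 else X k l * \<theta> (X i j) + (e l j / e j l) \<bullet> X k j * \<theta> (X i l)))"

lemma fusedD:
  assumes "fused e X K" "i \<in> K" "j \<in> K" "k \<in> K" "l \<in> K"
  shows "(if i = k then 0 else \<theta> (X i j) * X k l + (e i k / e k i) \<bullet> \<theta> (X k j) * X i l) =
     (if j = l then 0 else X k l * \<theta> (X i j) + (e l j / e j l) \<bullet> X k j * \<theta> (X i l))"
  using assms unfolding fused_def by blast

text \<open>For \<open>j \<noteq> l\<close> the right side of the fused relation is a row minor up
  to the factor \<open>e j l\<close>. It vanishes for \<open>i = k\<close>, and exchanging
  \<open>i\<close> and \<open>k\<close> changes the left side only by a ratio of weights. These are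
  the two Manin conditions.\<close>

lemma fused_manin:
  assumes X: "fused e X K" and e: "\<And>i j. i \<in> K \<Longrightarrow> j \<in> K \<Longrightarrow> i \<noteq> j \<Longrightarrow> e i j \<noteq> 0"
  shows "manin e X K"
proof -
  have m: "minor2 e X k i l j = e j l \<bullet> (X k l * \<theta> (X i j) + (e l j / e j l) \<bullet> X k j * \<theta> (X i l))"
    if "l \<in> K" "j \<in> K" "j \<noteq> l" for i j k l
    using e[of j l] that by (simp add: minor2_def scl_add scl_scl scl_simps)
  show ?thesis
    unfolding manin_def
  proof (intro ballI impI conjI)
    fix l j r assume K: "l \<in> K" "j \<in> K" "l \<noteq> j" "r \<in> K"
    show "minor2 e X r r l j = 0"
      using fusedD[OF X, of r j r l] K by (simp add: m)
  next
    fix l j r r' assume K: "l \<in> K" "j \<in> K" "l \<noteq> j" "r \<in> K" "r' \<in> K" "r \<noteq> r'"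
    have 1: "minor2 e X r r' l j = e j l \<bullet> (\<theta> (X r' j) * X r l + (e r' r / e r r') \<bullet> \<theta> (X r j) * X r' l)"
      using fusedD[OF X, of r' j r l] K by (simp add: m)
    have 2: "minor2 e X r' r l j = e j l \<bullet> (\<theta> (X r j) * X r' l + (e r r' / e r' r) \<bullet> \<theta> (X r' j) * X r l)"
      using fusedD[OF X, of r j r' l] K by (simp add: m)
    show "e r r' \<bullet> minor2 e X r r' l j = e r' r \<bullet> minor2 e X r' r l j"
      unfolding 1 2 using e K by (simp add: scl_add scl_scl mult_ac add.commute)
  qed
qed

text \<open>The two sides of the fused relation change roles: now the left side is the minor, taken
  in the opposite ring for two columns, and its weights appear with exchanged indices.\<close>

lemma fused_cmanin:
  assumes X: "fused e X K" and e: "\<And>i j. i \<in> K \<Longrightarrow> j \<in> K \<Longrightarrow> i \<noteq> j \<Longrightarrow> e i j \<noteq> 0"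
  shows "cmanin (\<lambda>s c. e c s) X K"
proof -
  interpret op: scalar_ext "\<lambda>a. Opp (sc a)" "\<lambda>x. Opp (\<theta> (unopp x))"
    by (rule scalar_ext_opp) unfold_locales
  have oscl: "unopp (op.scl a x) = a \<bullet> unopp x" for a x
    by (simp add: op.scl_def scl_def sc_central)
  have m: "unopp (op.minor2 (\<lambda>s c. e c s) (\<lambda>r c. Opp (X c r)) l j k i) =
    e k i \<bullet> (\<theta> (X i j) * X k l + (e i k / e k i) \<bullet> \<theta> (X k j) * X i l)"
    if "i \<in> K" "k \<in> K" "i \<noteq> k" for i j k l
    using e[of k i] that by (simp add: op.minor2_def oscl scl_add scl_scl scl_simps)
  show ?thesis
    unfolding cmanin_def op.manin_def
  proof (intro ballI impI conjI)
    fix i k r assume K: "k \<in> K" "i \<in> K" "k \<noteq> i" "r \<in> K"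
    show "op.minor2 (\<lambda>s c. e c s) (\<lambda>r c. Opp (X c r)) r r k i = 0"
      using fusedD[OF X, of i r k r] K by (simp add: m flip: unopp_inject)
  next
    fix i k r r' assume K: "k \<in> K" "i \<in> K" "k \<noteq> i" "r \<in> K" "r' \<in> K" "r \<noteq> r'"
    let ?m = "op.minor2 (\<lambda>s c. e c s) (\<lambda>r c. Opp (X c r))"
    have 1: "unopp (?m r r' k i) = e k i \<bullet> (X k r * \<theta> (X i r') + (e r r' / e r' r) \<bullet> X k r' * \<theta> (X i r))"
      using fusedD[OF X, of i r' k r] K by (simp add: m)
    have 2: "unopp (?m r' r k i) = e k i \<bullet> (X k r' * \<theta> (X i r) + (e r' r / e r r') \<bullet> X k r * \<theta> (X i r'))"
      using fusedD[OF X, of i r k r'] K by (simp add: m)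
    show "op.scl (e r' r) (?m r r' k i) = op.scl (e r r') (?m r' r k i)"
      using e K by (simp add: oscl 1 2 scl_add scl_scl mult_ac add.commute flip: unopp_inject)
  qed
qed

theorem cdet_eq_rdet:
  fixes ks :: "'i::linorder list"
  assumes X: "fused e X K" and e: "\<And>i j. i \<in> K \<Longrightarrow> j \<in> K \<Longrightarrow> i \<noteq> j \<Longrightarrow> e i j \<noteq> 0"
    and inv: "\<And>I. I \<subseteq> K \<Longrightarrow> \<exists>N. inv_on I X N"
    and comm: "\<And>I N i j k l m. I \<subseteq> K \<Longrightarrow> inv_on I X N \<Longrightarrow> i \<in> I \<Longrightarrow> j \<in> I \<Longrightarrow> k \<in> I \<Longrightarrow> l \<in> I \<Longrightarrow>
      i \<noteq> l \<Longrightarrow> j \<noteq> k \<Longrightarrow> (\<theta> ^^ m) (X i j) * N k l = N k l * (\<theta> ^^ m) (X i j)"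
    and "distinct ks" "set ks \<subseteq> K"
  shows "cdet (\<lambda>s c. e c s) X ks = rdet e X ks"
  using assms(5,6)
proof (induction ks)
  case (Cons j "is")
  let ?I = "set is" and ?S = "\<lambda>N. schur (set is) X N"
  have fused: "fused e X (set (j # is))" using X Cons.prems unfolding fused_def by blast
  obtain N where N: "inv_on ?I X N" using inv Cons.prems by force
  obtain Z where Z: "inv_on (set (j # is)) X Z" using inv[of "set (j # is)"] Cons.prems by force
  have SZ: "inv_on {j} (?S N) Z"
    by (rule inv_on_schur) (use Z N Cons.prems in auto)
  have 1: "rdet e X (j # is) = rdet e (?S N) [j] * (\<theta> ^^ length [j]) (rdet e X is)"
    by (rule rdet_schur_inv[OF fused_manin[OF fused]]) (use Cons.prems e N in auto)
  have 2: "cdet (\<lambda>s c. e c s) X (j # is) =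
    (\<theta> ^^ length [j]) (cdet (\<lambda>s c. e c s) X is) * cdet (\<lambda>s c. e c s) (?S N) [j]"
    by (rule cdet_schur_inv[OF fused_cmanin[OF fused]]) (use Cons.prems e N in auto)
  have IH: "cdet (\<lambda>s c. e c s) X is = rdet e X is" using Cons by simp
  \<comment> \<open>\<open>a\<close> and \<open>b\<close> differ from \<open>j\<close>, so
    \<open>comm\<close> applies to the entry \<open>Z j j\<close> of the larger inverse, and
    commutation passes on to its inverse \<open>?S N j j\<close>.\<close>
  have S: "?S N j j * (\<theta> ^^ m) (X a b) = (\<theta> ^^ m) (X a b) * ?S N j j" if "a \<in> ?I" "b \<in> ?I" for a b m
  proof (rule inv_on_commutes[OF _ inv_on_sym[OF SZ], symmetric])
    fix i' j' assume "i' \<in> {j}" "j' \<in> {j}"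
    then show "(\<theta> ^^ m) (X a b) * Z i' j' = Z i' j' * (\<theta> ^^ m) (X a b)"
      using comm[OF _ Z, of a b j j m] that Cons.prems by auto
  qed auto
  have "?S N j j * (\<theta> ^^ 1) (rdet e X is) = (\<theta> ^^ 1) (rdet e X is) * ?S N j j"
    by (rule rdet_commutes) (use S in auto)
  then show ?case unfolding 1 2 by (simp add: IH rdet_singleton cdet_singleton)
qed simp

end

subsection \<open>Expansion over permutations\<close>

text \<open>With these weights \<open>\<psi>_j \<psi>_i = - t^{-1} \<psi>_i \<psi>_j\<close> for
  \<open>i < j\<close>, so sorting a product of generators counts inversions.\<close>

definition asc :: "'k::field \<Rightarrow> nat \<Rightarrow> nat \<Rightarrow> 'k" where
  "asc t s c = (if s < c then inverse (- t) else 1)"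

lemma inversions_from:
  fixes a n :: nat
  shows
  "(\<Sum>i\<in>{a..n}. card {j\<in>{i<..n}. \<sigma> j < \<sigma> i}) = card {(i, j). a \<le> i \<and> i < j \<and> j \<le> n \<and> \<sigma> j < (\<sigma> i :: nat)}"
proof -
  have "{(i, j). a \<le> i \<and> i < j \<and> j \<le> n \<and> \<sigma> j < \<sigma> i} = Sigma {a..n} (\<lambda>i. {j\<in>{i<..n}. \<sigma> j < \<sigma> i})"
    by auto
  then show ?thesis by simp
qed

context scalar_ext
begin

lemma nrm_rev: "distinct xs \<Longrightarrow> nrm e (rev xs) = nrm (\<lambda>s c. e c s) xs"
proof (induction xs)
  case (Cons x xs)
  then have "distinct (rev xs @ [x])" by auto
  from nrm_append[OF this, of e] Cons show ?case by (simp add: mult_ac)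
qed simp

lemma nrm_asc:
  assumes "inj_on \<sigma> {a..n}"
  shows "nrm (asc t) (map \<sigma> [a..<Suc n]) = inverse (- t) ^ (\<Sum>i\<in>{a..n}. card {j\<in>{i<..n}. \<sigma> j < \<sigma> i})"
  using assms
proof (induction "Suc n - a" arbitrary: a)
  case (Suc d)
  then have a: "a \<le> n" by simp
  have up: "[a..<Suc n] = a # [Suc a..<Suc n]" using a by (simp add: upt_conv_Cons)
  have inj: "inj_on \<sigma> {Suc a..n}" "inj_on \<sigma> (set [Suc a..<Suc n])"
    by (rule inj_on_subset[OF Suc.prems]; auto)+
  have IH: "nrm (asc t) (map \<sigma> [Suc a..<Suc n]) =
      inverse (- t) ^ (\<Sum>i\<in>{Suc a..n}. card {j\<in>{i<..n}. \<sigma> j < \<sigma> i})"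
    by (rule Suc.hyps(1)) (use Suc.hyps(2) inj in auto)
  have "(\<Prod>s\<in>set (map \<sigma> [Suc a..<Suc n]). asc t s (\<sigma> a)) = (\<Prod>j\<in>{a<..n}. asc t (\<sigma> j) (\<sigma> a))"
    unfolding set_map prod.reindex[OF inj(2)] by (intro prod.cong) auto
  also have "\<dots> = (\<Prod>j\<in>{j\<in>{a<..n}. \<sigma> j < \<sigma> a}. inverse (- t))"
    unfolding asc_def by (simp add: prod.If_cases Int_def)
  also have "\<dots> = inverse (- t) ^ card {j\<in>{a<..n}. \<sigma> j < \<sigma> a}" by simp
  finally have P: "(\<Prod>s\<in>set (map \<sigma> [Suc a..<Suc n]). asc t s (\<sigma> a)) =
    inverse (- t) ^ card {j\<in>{a<..n}. \<sigma> j < \<sigma> a}" .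
  have "{a..n} = insert a {Suc a..n}" using a by auto
  then show ?case
    unfolding up list.map nrm.simps IH P by (simp add: power_add)
qed simp

lemma nrm_asc_permutes:
  assumes "\<sigma> permutes {1..n}"
  shows "nrm (asc t) (map \<sigma> [1..<n + 1]) = (- t) powi (- int (inversions n \<sigma>))"
proof -
  have "inj_on \<sigma> {1..n}" using assms by (rule permutes_inj_on)
  from nrm_asc[OF this, of t] inversions_from[of n \<sigma> 1] show ?thesis
    by (simp add: inversions_def power_int_minus power_inverse del: upt_Suc inverse_minus_eq)
qed

lemma prodrow_conv:
  "length cs = length rs \<Longrightarrow> prodrow X rs cs = prod_list (map (\<lambda>p. (\<theta> ^^ p) (X (rs ! p) (cs ! p))) [0..<length rs])"
proof (induction rs arbitrary: cs)
  case (Cons r rs)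
  obtain c cs' where cs: "cs = c # cs'" using Cons.prems by (cases cs) auto
  have th: "\<theta> (prod_list xs) = prod_list (map \<theta> xs)" for xs
    by (induction xs) (simp_all add: theta_mult)
  have "[0..<length (r # rs)] = 0 # map Suc [0..<length rs]"
    by (simp add: upt_conv_Cons map_Suc_upt del: upt_Suc)
  then show ?case
    using Cons by (simp add: cs th o_def del: upt_Suc)
qed simp

lemma permutations_permutes:
  assumes "set rs = {1..n}" "distinct rs"
  shows "(\<Sum>cs\<in>permutations_of_set {1..n}. f cs) = (\<Sum>\<sigma> | \<sigma> permutes {1..n}. f (map \<sigma> rs))"
proof -
  have "permutations_of_set {1..n} = (\<lambda>\<sigma>. map \<sigma> rs) ` {\<sigma>. \<sigma> permutes {1..n}}"
  proof (intro equalityI subsetI)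
    fix cs assume cs: "cs \<in> permutations_of_set {1..n}"
    have "mset rs = mset cs" using cs assms by (simp add: permutations_of_setD set_eq_iff_mset_eq_distinct[symmetric])
    then obtain \<pi> where "\<pi> permutes {..<length cs}" "permute_list \<pi> cs = rs"
      by (metis mset_eq_permutation)
    show "cs \<in> (\<lambda>\<sigma>. map \<sigma> rs) ` {\<sigma>. \<sigma> permutes {1..n}}"
    proof -
      define \<sigma> where "\<sigma> x = (case map_of (zip rs cs) x of Some y \<Rightarrow> y | None \<Rightarrow> x)" for x
      have len: "length rs = length cs" using \<open>mset rs = mset cs\<close> by (metis size_mset)
      have m: "map \<sigma> rs = cs"
        by (rule nth_equalityI) (use assms len in \<open>auto simp: \<sigma>_def map_of_zip_nth\<close>)
      have "bij_betw \<sigma> {1..n} {1..n}"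
        unfolding bij_betw_def
      proof
        have "distinct (map \<sigma> rs)" using m cs by (simp add: permutations_of_setD)
        then show "inj_on \<sigma> {1..n}" using assms by (simp add: distinct_map)
        show "\<sigma> ` {1..n} = {1..n}" using m cs assms by (metis permutations_of_setD(1) set_map)
      qed
      moreover have "\<sigma> x = x" if "x \<notin> {1..n}" for x
        using that assms len by (simp add: \<sigma>_def map_of_zip_is_None[symmetric] split: option.splits)
          (metis assms(1) atLeastAtMost_iff set_zip_leftD)
      ultimately have "\<sigma> permutes {1..n}" by (intro bij_imp_permutes) auto
      then show ?thesis using m by auto
    qed
  next
    fix cs assume "cs \<in> (\<lambda>\<sigma>. map \<sigma> rs) ` {\<sigma>. \<sigma> permutes {1..n}}"
    then obtain \<sigma> where s: "\<sigma> permutes {1..n}" "cs = map \<sigma> rs" by auto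
    then show "cs \<in> permutations_of_set {1..n}"
      using assms by (intro permutations_of_setI) (auto simp: distinct_map permutes_inj_on permutes_image)
  qed
  moreover have "inj_on (\<lambda>\<sigma>. map \<sigma> rs) {\<sigma>. \<sigma> permutes {1..n}}"
  proof (rule inj_onI, rule ext)
    fix \<sigma> \<tau> x assume "\<sigma> \<in> {\<sigma>. \<sigma> permutes {1..n}}" "\<tau> \<in> {\<sigma>. \<sigma> permutes {1..n}}" "map \<sigma> rs = map \<tau> rs"
    then show "\<sigma> x = \<tau> x" using assms by (cases "x \<in> {1..n}") (auto simp: permutes_not_in)
  qed
  ultimately show ?thesis by (simp add: sum.reindex)
qed

text \<open>The increasing list has \<open>nrm\<close> equal to 1, so no normalisation is left and
  the Leibniz expansion is literally a sum from the definition of the Berezinian; \<open>B\<close>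
  collects the shifted entries.\<close>

lemma rdet_asc:
  assumes "\<And>k l. k \<in> {1..n} \<Longrightarrow> B k l = (\<theta> ^^ (k - 1)) (X k l)"
  shows "(\<Sum>\<sigma> | \<sigma> permutes {1..n}. sc ((- t) powi (- int (inversions n \<sigma>))) *
     prod_list (map (\<lambda>k. B k (\<sigma> k)) [1..<n + 1])) = rdet (asc t) X [1..<n + 1]"
proof -
  have "nrm (asc t) [1..<n + 1] = (- t) powi (- int (inversions n id))"
    using nrm_asc_permutes[OF permutes_id, where n = n and t = t] by simp
  also have "inversions n id = 0" by (auto simp: inversions_def card_eq_0_iff)
  finally have n1: "nrm (asc t) [1..<n + 1] = 1" by simp
  have st: "set [1..<n + 1] = {1..n}" by auto
  have "rdet (asc t) X [1..<n + 1] = (\<Sum>cs\<in>permutations_of_set {1..n}. nrm (asc t) cs \<bullet> prodrow X [1..<n + 1] cs)"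
    unfolding rdet_def n1 st by (subst wedge_permutations) auto
  also have "\<dots> = (\<Sum>\<sigma> | \<sigma> permutes {1..n}. nrm (asc t) (map \<sigma> [1..<n + 1]) \<bullet> prodrow X [1..<n + 1] (map \<sigma> [1..<n + 1]))"
    by (rule permutations_permutes) auto
  also have "\<dots> = (\<Sum>\<sigma> | \<sigma> permutes {1..n}. sc ((- t) powi (- int (inversions n \<sigma>))) *
     prod_list (map (\<lambda>k. B k (\<sigma> k)) [1..<n + 1]))"
  proof (rule sum.cong[OF refl], clarify)
    fix \<sigma> assume s: "\<sigma> permutes {1..n}"
    have "prodrow X [1..<n + 1] (map \<sigma> [1..<n + 1]) = prod_list (map (\<lambda>k. B k (\<sigma> k)) [1..<n + 1])"
      by (subst prodrow_conv, simp, rule arg_cong[of _ _ prod_list], rule nth_equalityI)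
        (auto simp: assms simp del: upt_Suc)
    then show "nrm (asc t) (map \<sigma> [1..<n + 1]) \<bullet> prodrow X [1..<n + 1] (map \<sigma> [1..<n + 1]) =
      sc ((- t) powi (- int (inversions n \<sigma>))) * prod_list (map (\<lambda>k. B k (\<sigma> k)) [1..<n + 1])"
      by (simp only: nrm_asc_permutes[OF s] scl_def)
  qed
  finally show ?thesis ..
qed

text \<open>The factor of column \<open>k\<close> has \<open>n - k\<close> factors to its right,
  whence its shift. The reversed list and the transposed weights compensate each other by
  \<open>nrm_rev\<close>, so inversions are counted as before.\<close>

lemma cdet_asc:
  assumes "\<And>k l. k \<in> {1..n} \<Longrightarrow> B k l = (\<theta> ^^ (n - k)) (X l k)"
  shows "(\<Sum>\<sigma> | \<sigma> permutes {1..n}. sc ((- t) powi (- int (inversions n \<sigma>))) *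
     prod_list (map (\<lambda>k. B k (\<sigma> k)) [1..<n + 1])) = cdet (\<lambda>s c. asc t c s) X (rev [1..<n + 1])"
proof -
  interpret op: scalar_ext "\<lambda>a. Opp (sc a)" "\<lambda>x. Opp (\<theta> (unopp x))"
    by (rule scalar_ext_opp) unfold_locales
  let ?e = "\<lambda>s c. asc t c s" and ?l = "rev [1..<n + 1]" and ?X = "\<lambda>r c. Opp (X c r)"
  have nr: "op.nrm ?e (map \<sigma> ?l) = (- t) powi (- int (inversions n \<sigma>))" if "\<sigma> permutes {1..n}" for \<sigma>
  proof -
    have "distinct (map \<sigma> [1..<n + 1])" using permutes_inj_on[OF that] by (auto simp: distinct_map intro: inj_on_subset)
    then show ?thesis
      unfolding rev_map[symmetric] by (subst op.nrm_rev) (use op.nrm_asc_permutes[OF that] in auto)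
  qed
  have "op.nrm ?e ?l = (- t) powi (- int (inversions n id))"
    using nr[OF permutes_id] by simp
  also have "inversions n id = 0" by (auto simp: inversions_def card_eq_0_iff)
  finally have n1: "op.nrm ?e ?l = 1" by simp
  have st: "set ?l = {1..n}" by auto
  have "op.rdet ?e ?X ?l = (\<Sum>cs\<in>permutations_of_set {1..n}. op.scl (op.nrm ?e cs) (op.prodrow ?X ?l cs))"
    unfolding op.rdet_def n1 st by (subst op.wedge_permutations) auto
  also have "\<dots> = (\<Sum>\<sigma> | \<sigma> permutes {1..n}. op.scl (op.nrm ?e (map \<sigma> ?l)) (op.prodrow ?X ?l (map \<sigma> ?l)))"
    by (rule permutations_permutes) auto
  finally have A: "op.rdet ?e ?X ?l = (\<Sum>\<sigma> | \<sigma> permutes {1..n}. op.scl (op.nrm ?e (map \<sigma> ?l)) (op.prodrow ?X ?l (map \<sigma> ?l)))" .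
  have "unopp (op.rdet ?e ?X ?l) = (\<Sum>\<sigma> | \<sigma> permutes {1..n}. sc ((- t) powi (- int (inversions n \<sigma>))) *
     prod_list (map (\<lambda>k. B k (\<sigma> k)) [1..<n + 1]))"
    unfolding A unopp_sum
  proof (rule sum.cong[OF refl], clarify)
    fix \<sigma> assume s: "\<sigma> permutes {1..n}"
    have "unopp (op.prodrow ?X ?l (map \<sigma> ?l)) = prod_list (map (\<lambda>k. B k (\<sigma> k)) [1..<n + 1])"
      by (subst op.prodrow_conv, simp, unfold unopp_prod_list, rule arg_cong[of _ _ prod_list], rule nth_equalityI)
        (auto simp: assms rev_nth funpow_opp simp del: upt_Suc)
    then show "unopp (op.scl (op.nrm ?e (map \<sigma> ?l)) (op.prodrow ?X ?l (map \<sigma> ?l))) =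
      sc ((- t) powi (- int (inversions n \<sigma>))) * prod_list (map (\<lambda>k. B k (\<sigma> k)) [1..<n + 1])"
      by (simp only: nr[OF s] op.scl_def unopp_simps opp.sel sc_central)
  qed
  then show ?thesis by (simp add: cdet_def)
qed

end

section \<open>The graded RTT relation\<close>

text \<open>
  All super matrices are twisted to ordinary ones by multiplying the entry \<open>(i, j)\<close> with
  $(-1)^{(\bar i + 1)\bar j}$, and $E_{ij} \otimes E_{kl}$ in the tensor square with
  $(-1)^{(\bar k + \bar l)\bar j + (\bar i + \bar k + 1)(\bar j + \bar l)}$; the entries of
  $R(z,w)$ become \<open>diag_coeff\<close> and \<open>swap_coeff\<close>, and $L_1$, $L_2$ become \<open>lift1\<close>, \<open>lift2\<close>.
\<close>

definition diag_coeff :: "'a::ring_1 \<Rightarrow> 'a \<Rightarrow> 'a \<Rightarrow> 'a \<Rightarrow> ('i \<Rightarrow> nat) \<Rightarrow> 'i \<Rightarrow> 'i \<Rightarrow> 'a" where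
  "diag_coeff z w h h' p i k =
     (if i = k then if even (p i) then z * h - w * h' else z * h' - w * h else z - w)"

definition swap_coeff :: "'a::ring_1 \<Rightarrow> 'a \<Rightarrow> 'a \<Rightarrow> 'a \<Rightarrow> ('i::linorder \<Rightarrow> nat) \<Rightarrow> 'i \<Rightarrow> 'i \<Rightarrow> 'a" where
  "swap_coeff z w h h' p i k =
     (if i = k then 0 else (- 1) ^ (p i * p k) * (h - h') * (if i < k then z else w))"

text \<open>The entry at row \<open>(i, k)\<close> and column \<open>(j, l)\<close> of
  \<open>R A_1 B_2 = B_2 A_1 R\<close> after the twist. The parameters \<open>z\<close>,
  \<open>w\<close>, \<open>h\<close>, \<open>h'\<close> are ring elements, since \<open>z\<close>
  and \<open>w\<close> will be formal variables; \<open>h\<close> and \<open>h'\<close> stand for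
  \<open>q\<close> and its inverse.\<close>

definition rtt :: "'a::ring_1 \<Rightarrow> 'a \<Rightarrow> 'a \<Rightarrow> 'a \<Rightarrow> ('i::linorder \<Rightarrow> nat) \<Rightarrow> 'i set \<Rightarrow>
    ('i \<Rightarrow> 'i \<Rightarrow> 'a) \<Rightarrow> ('i \<Rightarrow> 'i \<Rightarrow> 'a) \<Rightarrow> bool" where
  "rtt z w h h' p K A B \<longleftrightarrow> (\<forall>i\<in>K. \<forall>j\<in>K. \<forall>k\<in>K. \<forall>l\<in>K.
     diag_coeff z w h h' p i k * ((- 1) ^ (p k * (p i + p j)) * A i j * B k l) +
     swap_coeff z w h h' p i k * ((- 1) ^ (p i * (p k + p j)) * A k j * B i l) =
     (B k l * ((- 1) ^ (p l * (p i + p j)) * A i j)) * diag_coeff z w h h' p j l +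
     (B k j * ((- 1) ^ (p j * (p i + p l)) * A i l)) * swap_coeff z w h h' p l j)"

definition rmat :: "'a::ring_1 \<Rightarrow> 'a \<Rightarrow> 'a \<Rightarrow> 'a \<Rightarrow> ('i::linorder \<Rightarrow> nat) \<Rightarrow> 'i \<times> 'i \<Rightarrow> 'i \<times> 'i \<Rightarrow> 'a" where
  "rmat z w h h' p x y = (if x = y then diag_coeff z w h h' p (fst x) (snd x)
     else if y = (snd x, fst x) then swap_coeff z w h h' p (fst x) (snd x) else 0)"

definition lift1 :: "('i \<Rightarrow> nat) \<Rightarrow> ('i \<Rightarrow> 'i \<Rightarrow> 'a::ring_1) \<Rightarrow> 'i \<times> 'i \<Rightarrow> 'i \<times> 'i \<Rightarrow> 'a" where
  "lift1 p A x y = (if snd x = snd y then (- 1) ^ (p (snd x) * (p (fst x) + p (fst y))) * A (fst x) (fst y) else 0)"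

definition lift2 :: "('i \<Rightarrow> 'i \<Rightarrow> 'a::ring_1) \<Rightarrow> 'i \<times> 'i \<Rightarrow> 'i \<times> 'i \<Rightarrow> 'a" where
  "lift2 A x y = (if fst x = fst y then A (snd x) (snd y) else 0)"

lemma mm_pairs: "mm (K \<times> L) A B x y = (\<Sum>u\<in>K. \<Sum>v\<in>L. A x (u, v) * B (u, v) y)"
  by (simp add: mm_def sum.cartesian_product)

lemma mm_lift2_left:
  assumes "finite K" "i \<in> K"
  shows "mm (K \<times> K) (lift2 C) P (i, a) y = (\<Sum>k\<in>K. C a k * P (i, k) y)"
proof -
  have "mm (K \<times> K) (lift2 C) P (i, a) y = (\<Sum>u\<in>K. if i = u then \<Sum>k\<in>K. C a k * P (i, k) y else 0)"
    unfolding mm_pairs by (intro sum.cong refl) (auto simp: lift2_def)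
  then show ?thesis using assms by simp
qed

lemma mm_lift2_right:
  assumes "finite K" "j \<in> K"
  shows "mm (K \<times> K) P (lift2 C) x (j, b) = (\<Sum>l\<in>K. P x (j, l) * C l b)"
proof -
  have "mm (K \<times> K) P (lift2 C) x (j, b) = (\<Sum>u\<in>K. if u = j then \<Sum>k\<in>K. P x (j, k) * C k b else 0)"
    unfolding mm_pairs by (intro sum.cong refl) (auto simp: lift2_def)
  then show ?thesis using assms by simp
qed

lemma mm_lift1_left:
  assumes "finite K" "a \<in> K"
  shows "mm (K \<times> K) (lift1 p C) P (i, a) y = (\<Sum>k\<in>K. (- 1) ^ (p a * (p i + p k)) * C i k * P (k, a) y)"
proof -
  have "mm (K \<times> K) (lift1 p C) P (i, a) y =
    (\<Sum>u\<in>K. \<Sum>v\<in>K. if a = v then (- 1) ^ (p a * (p i + p u)) * C i u * P (u, a) y else 0)"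
    unfolding mm_pairs by (intro sum.cong refl) (auto simp: lift1_def)
  then show ?thesis using assms by simp
qed

lemma mm_rmat_left:
  assumes "finite K" "i \<in> K" "k \<in> K"
  shows "mm (K \<times> K) (rmat z w h h' p) P (i, k) y =
    diag_coeff z w h h' p i k * P (i, k) y + swap_coeff z w h h' p i k * P (k, i) y"
proof -
  have "mm (K \<times> K) (rmat z w h h' p) P (i, k) y =
    (\<Sum>x\<in>K \<times> K. (if x = (i, k) then diag_coeff z w h h' p i k * P x y else 0) +
       (if x = (k, i) then swap_coeff z w h h' p i k * P x y else 0))"
    unfolding mm_def
  proof (rule sum.cong[OF refl])
    fix x
    show "rmat z w h h' p (i, k) x * P x y = (if x = (i, k) then diag_coeff z w h h' p i k * P x y else 0) +
       (if x = (k, i) then swap_coeff z w h h' p i k * P x y else 0)"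
    proof (cases "x = (i, k)")
      case True
      then show ?thesis by (cases "i = k") (simp_all add: rmat_def swap_coeff_def)
    next
      case False
      then show ?thesis by (cases "x = (k, i)") (simp_all add: rmat_def)
    qed
  qed
  then show ?thesis using assms by (simp add: sum.distrib)
qed

lemma mm_rmat_right:
  assumes "finite K" "j \<in> K" "l \<in> K"
  shows "mm (K \<times> K) P (rmat z w h h' p) x (j, l) =
    P x (j, l) * diag_coeff z w h h' p j l + P x (l, j) * swap_coeff z w h h' p l j"
proof -
  have "mm (K \<times> K) P (rmat z w h h' p) x (j, l) =
    (\<Sum>y\<in>K \<times> K. (if y = (j, l) then P x y * diag_coeff z w h h' p j l else 0) +
       (if y = (l, j) then P x y * swap_coeff z w h h' p l j else 0))"
    unfolding mm_def
  proof (rule sum.cong[OF refl])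
    fix y
    have sw: "y \<noteq> (j, l) \<Longrightarrow> (j, l) = (snd y, fst y) \<longleftrightarrow> y = (l, j)" by (cases y) auto
    show "P x y * rmat z w h h' p y (j, l) = (if y = (j, l) then P x y * diag_coeff z w h h' p j l else 0) +
       (if y = (l, j) then P x y * swap_coeff z w h h' p l j else 0)"
    proof (cases "y = (j, l)")
      case True
      then show ?thesis by (cases "j = l") (simp_all add: rmat_def swap_coeff_def)
    next
      case False
      then show ?thesis by (cases "y = (l, j)") (simp_all only: rmat_def sw, auto)
    qed
  qed
  then show ?thesis using assms by (simp add: sum.distrib)
qed

lemma mm_lift1_lift2:
  assumes "finite K" "j \<in> K" "k \<in> K"
  shows "mm (K \<times> K) (lift1 p A) (lift2 B) (i, k) (j, l) = (- 1) ^ (p k * (p i + p j)) * A i j * B k l"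
proof -
  have "mm (K \<times> K) (lift1 p A) (lift2 B) (i, k) (j, l) =
    (\<Sum>u\<in>K. if k = u then (- 1) ^ (p k * (p i + p j)) * A i j * B k l else 0)"
    unfolding mm_lift2_right[OF assms(1,2)] by (intro sum.cong refl) (auto simp: lift1_def)
  then show ?thesis using assms by simp
qed

lemma mm_lift2_lift1:
  assumes "finite K" "i \<in> K" "l \<in> K"
  shows "mm (K \<times> K) (lift2 B) (lift1 p A) (i, k) (j, l) = B k l * ((- 1) ^ (p l * (p i + p j)) * A i j)"
proof -
  have "mm (K \<times> K) (lift2 B) (lift1 p A) (i, k) (j, l) =
    (\<Sum>v\<in>K. if v = l then B k l * ((- 1) ^ (p l * (p i + p j)) * A i j) else 0)"
    unfolding mm_lift2_left[OF assms(1,2)] by (intro sum.cong refl) (auto simp: lift1_def)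
  then show ?thesis using assms by simp
qed

lemma rtt_matrix:
  assumes "finite K"
  shows "rtt z w h h' p K A B \<longleftrightarrow>
    eq_on (K \<times> K) (mm (K \<times> K) (rmat z w h h' p) (mm (K \<times> K) (lift1 p A) (lift2 B)))
      (mm (K \<times> K) (mm (K \<times> K) (lift2 B) (lift1 p A)) (rmat z w h h' p))"
  using assms
  by (auto simp: rtt_def eq_on_def mm_rmat_left mm_rmat_right mm_lift1_lift2 mm_lift2_lift1)

lemma inv_on_lift1:
  assumes "finite K" "inv_on K A A'"
  shows "inv_on (K \<times> K) (lift1 p A) (lift1 p A')"
proof -
  have *: "mm (K \<times> K) (lift1 p A) (lift1 p C) (i, k) (j, l) =
    (if k = l then (- 1) ^ (p k * (p i + p j)) * mm K A C i j else 0)"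
    if "k \<in> K" for A C :: "'a \<Rightarrow> 'a \<Rightarrow> 'b" and i j k l
  proof (cases "k = l")
    case True
    have s: "(- 1) ^ (p l * (p i + p u)) * x * ((- 1) ^ (p l * (p u + p j)) * y) =
      (- 1) ^ (p l * (p i + p j)) * (x * y :: 'b)" for x y :: 'b and u
      by (auto simp: minus_one_power_iff)
    show ?thesis
      unfolding mm_lift1_left[OF assms(1) that] using True
      by (simp add: lift1_def s mm_def sum_distrib_left)
  qed (simp add: mm_lift1_left[OF assms(1) that] lift1_def)
  show ?thesis
    unfolding inv_on_def eq_on_def
    by (auto simp: * inv_onD[OF assms(2)] idm_def minus_one_power_iff)
qed

lemma inv_on_lift2:
  assumes "finite K" "inv_on K A A'"
  shows "inv_on (K \<times> K) (lift2 A) (lift2 A')"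
proof -
  have *: "mm (K \<times> K) (lift2 A) (lift2 C) (i, k) (j, l) = (if i = j then mm K A C k l else 0)"
    if "i \<in> K" for A C :: "'a \<Rightarrow> 'a \<Rightarrow> 'b" and i j k l
    unfolding mm_lift2_left[OF assms(1) that] by (simp add: lift2_def mm_def)
  show ?thesis
    unfolding inv_on_def eq_on_def
    by (auto simp: * inv_onD[OF assms(2)] idm_def)
qed

text \<open>The relation is multiplied by the inverse of \<open>B_2\<close> on both sides;
  \<open>R\<close> stays where it is and is never inverted.\<close>

lemma rtt_conj_second:
  assumes fin: "finite K" and R: "rtt z w h h' p K A B" and B: "inv_on K B B'"
  defines "P \<equiv> K \<times> K"
  shows "eq_on P (mm P (lift2 B') (mm P (rmat z w h h' p) (lift1 p A)))
    (mm P (mm P (lift1 p A) (rmat z w h h' p)) (lift2 B'))"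
proof -
  let ?R = "rmat z w h h' p" and ?A = "lift1 p A" and ?B = "lift2 B" and ?B' = "lift2 B'"
  have fP: "finite P" using fin by (simp add: P_def)
  have iB: "inv_on P ?B ?B'" unfolding P_def by (rule inv_on_lift2[OF fin B])
  have "eq_on P (mm P (mm P ?B' (mm P ?R ?A)) (mm P ?B ?B')) (mm P ?B' (mm P ?R ?A))"
    using eq_on_mm_inv(2)[OF fP iB, of "mm P ?B' (mm P ?R ?A)"] by (simp add: mm_assoc)
  moreover have "eq_on P (mm P (mm P ?B' (mm P ?R ?A)) (mm P ?B ?B')) (mm P (mm P ?A ?R) ?B')"
  proof -
    have "eq_on P (mm P ?R (mm P ?A ?B)) (mm P (mm P ?B ?A) ?R)"
      using R rtt_matrix[OF fin] unfolding P_def by blast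
    then have "eq_on P (mm P ?B' (mm P (mm P ?R (mm P ?A ?B)) ?B')) (mm P ?B' (mm P (mm P (mm P ?B ?A) ?R) ?B'))"
      by (intro eq_on_mm[OF eq_on_refl eq_on_mm[OF _ eq_on_refl]])
    moreover have "eq_on P (mm P ?B' (mm P ?B (mm P (mm P ?A ?R) ?B'))) (mm P (mm P ?A ?R) ?B')"
      by (rule eq_on_mm_inv(1)[OF fP inv_on_sym[OF iB]])
    ultimately show ?thesis by (simp add: mm_assoc) (meson eq_on_trans)
  qed
  ultimately show ?thesis by (meson eq_on_sym eq_on_trans)
qed

lemma rtt_inverse_matrix:
  assumes fin: "finite K" and R: "rtt z w h h' p K A B" and A: "inv_on K A A'" and B: "inv_on K B B'"
  defines "P \<equiv> K \<times> K"
  shows "eq_on P (mm P (mm P (lift1 p A') (lift2 B')) (rmat z w h h' p))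
    (mm P (rmat z w h h' p) (mm P (lift2 B') (lift1 p A')))"
proof -
  let ?R = "rmat z w h h' p" and ?A = "lift1 p A" and ?A' = "lift1 p A'" and ?B' = "lift2 B'"
  have fP: "finite P" using fin by (simp add: P_def)
  have iA: "inv_on P ?A ?A'" unfolding P_def by (rule inv_on_lift1[OF fin A])
  have 0: "eq_on P (mm P ?B' (mm P ?R ?A)) (mm P (mm P ?A ?R) ?B')"
    unfolding P_def by (rule rtt_conj_second[OF fin R B])
  have "eq_on P (mm P ?A' (mm P (mm P ?B' (mm P ?R ?A)) ?A')) (mm P ?A' (mm P (mm P (mm P ?A ?R) ?B') ?A'))"
    by (intro eq_on_mm[OF eq_on_refl eq_on_mm[OF _ eq_on_refl]] 0)
  moreover have "eq_on P (mm P (mm P (mm P (mm P ?A' ?B') ?R) ?A) ?A') (mm P (mm P ?A' ?B') ?R)"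
    by (rule eq_on_mm_inv(2)[OF fP iA])
  moreover have "eq_on P (mm P ?A' (mm P ?A (mm P ?R (mm P ?B' ?A')))) (mm P ?R (mm P ?B' ?A'))"
    by (rule eq_on_mm_inv(1)[OF fP inv_on_sym[OF iA]])
  ultimately show ?thesis by (simp add: mm_assoc) (meson eq_on_sym eq_on_trans)
qed

text \<open>Because \<open>i \<noteq> b\<close> and \<open>a \<noteq> j\<close>, the exchange part
  of \<open>R\<close> meets only zero entries of \<open>lift1\<close>, and the diagonal part
  contributes \<open>z - w\<close> on both sides. Equal parities of \<open>i\<close> and
  \<open>j\<close> make the sign in \<open>lift1\<close> trivial.\<close>

lemma rtt_commute_inverse:
  assumes fin: "finite K" and R: "rtt z w h h' p K A B" and B: "inv_on K B B'"
    and K: "i \<in> K" "j \<in> K" "a \<in> K" "b \<in> K" "i \<noteq> b" "a \<noteq> j" and p: "p i = p j"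
    and cen: "\<And>x. z * x = x * z" "\<And>x. w * x = x * w"
  shows "(z - w) * (B' a b * A i j - A i j * B' a b) = 0"
proof -
  let ?P = "K \<times> K" and ?R = "rmat z w h h' p" and ?A = "lift1 p A" and ?B' = "lift2 B'"
  have s: "(- 1) ^ (n * (p i + p j)) = (1 :: 'b)" for n by (simp add: p)
  have "mm ?P (lift2 B') (mm ?P ?R ?A) (i, a) (j, b) = (\<Sum>k\<in>K. if k = b then B' a b * ((z - w) * A i j) else 0)"
    unfolding mm_lift2_left[OF fin K(1)]
    by (intro sum.cong refl)
      (use K s in \<open>auto simp: mm_rmat_left[OF fin] lift1_def diag_coeff_def\<close>)
  moreover have "mm ?P (mm ?P ?A ?R) ?B' (i, a) (j, b) = (\<Sum>l\<in>K. if l = a then A i j * (z - w) * B' a b else 0)"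
    unfolding mm_lift2_right[OF fin K(2)]
    by (intro sum.cong refl)
      (use K s in \<open>auto simp: mm_rmat_right[OF fin] lift1_def diag_coeff_def\<close>)
  ultimately have "B' a b * ((z - w) * A i j) = A i j * (z - w) * B' a b"
    using eq_onD[OF rtt_conj_second[OF fin R B], of "(i, a)" "(j, b)"] K fin by simp
  moreover have "A i j * (z - w) = (z - w) * A i j" "B' a b * (z - w) = (z - w) * B' a b"
    using cen[of "A i j"] cen[of "B' a b"] by (simp_all add: algebra_simps)
  ultimately have "(z - w) * (B' a b * A i j) = (z - w) * (A i j * B' a b)"
    by (metis mult.assoc)
  then show ?thesis by (simp add: right_diff_distrib)
qed

text \<open>
  Inverting the RTT relation and restricting to indices of parity $1$ replaces $R(z,w)$ by
  $R(z,w)$ with $q$ inverted, which is $-R_{21}(w,z)$; so the inverse satisfies the original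
  relation, with the variables exchanged.
\<close>

lemma rtt_inverse_odd:
  assumes fin: "finite K" and R: "rtt z w h h' p K A B" and A: "inv_on K A A'" and B: "inv_on K B B'"
    and K': "K' \<subseteq> K" and p: "\<And>i. i \<in> K' \<Longrightarrow> p i = 1"
  shows "rtt w z h h' (\<lambda>_. 0) K' B' A'"
  unfolding rtt_def
proof (intro ballI)
  fix i j k l assume ijkl: "i \<in> K'" "j \<in> K'" "k \<in> K'" "l \<in> K'"
  then have K: "i \<in> K" "j \<in> K" "k \<in> K" "l \<in> K" using K' by auto
  let ?d = "diag_coeff z w h h' p" and ?c = "swap_coeff z w h h' p"
  let ?d' = "diag_coeff w z h h' (\<lambda>_. 0)" and ?c' = "swap_coeff w z h h' (\<lambda>_. 0)"
  \<comment> \<open>On odd indices the diagonal entry \<open>z h' - w h\<close> is minus the even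
    entry with \<open>z\<close> and \<open>w\<close> exchanged. In the exchange part the sign
    \<open>(-1)^(p x * p y)\<close> supplies the minus, and transposing the indices exchanges
    \<open>z\<close> and \<open>w\<close>.\<close>
  have dc: "?d' x y = - ?d y x" "?c' x y = - ?c y x" if "x \<in> K'" "y \<in> K'" for x y
    using that p by (auto simp: diag_coeff_def swap_coeff_def left_diff_distrib)
  have "A' k l * B' i j * ?d l j + A' k j * B' i l * ?c j l = ?d k i * (B' i j * A' k l) + ?c k i * (B' k j * A' i l)"
    using eq_onD[OF rtt_inverse_matrix[OF fin R A B], of "(k, i)" "(l, j)"] K p ijkl
    by (simp add: mm_rmat_left[OF fin] mm_rmat_right[OF fin] mm_lift1_lift2[OF fin] mm_lift2_lift1[OF fin])
  then show "?d' i k * ((- 1) ^ (0 * (0 + 0)) * B' i j * A' k l) + ?c' i k * ((- 1) ^ (0 * (0 + 0)) * B' k j * A' i l) =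
      A' k l * ((- 1) ^ (0 * (0 + 0)) * B' i j) * ?d' j l + A' k j * ((- 1) ^ (0 * (0 + 0)) * B' i l) * ?c' l j"
    using ijkl by (simp add: dc) (simp add: algebra_simps eq_neg_iff_add_eq_0 neg_eq_iff_add_eq_0)
qed

lemma rtt_even:
  assumes "rtt z w h h' p K A B" "K' \<subseteq> K" "\<And>i. i \<in> K' \<Longrightarrow> p i = 0"
  shows "rtt z w h h' (\<lambda>_. 0) K' A B"
  unfolding rtt_def
proof (intro ballI)
  fix i j k l assume ijkl: "i \<in> K'" "j \<in> K'" "k \<in> K'" "l \<in> K'"
  then have K: "i \<in> K" "j \<in> K" "k \<in> K" "l \<in> K" using assms(2) by auto
  have "diag_coeff z w h h' (\<lambda>_. 0) x y = diag_coeff z w h h' p x y"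
    "swap_coeff z w h h' (\<lambda>_. 0) x y = swap_coeff z w h h' p x y" if "x \<in> K'" "y \<in> K'" for x y
    using that assms(3) by (auto simp: diag_coeff_def swap_coeff_def)
  then show "diag_coeff z w h h' (\<lambda>_. 0) i k * ((- 1) ^ (0 * (0 + 0)) * A i j * B k l) +
       swap_coeff z w h h' (\<lambda>_. 0) i k * ((- 1) ^ (0 * (0 + 0)) * A k j * B i l) =
       B k l * ((- 1) ^ (0 * (0 + 0)) * A i j) * diag_coeff z w h h' (\<lambda>_. 0) j l +
       B k j * ((- 1) ^ (0 * (0 + 0)) * A i l) * swap_coeff z w h h' (\<lambda>_. 0) l j"
    using assms(1)[unfolded rtt_def, rule_format, OF K] assms(3) ijkl by simp
qed

section \<open>Scalars and spectral shifts\<close>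

lemma fscal_mult: "fscal (a * b) = fscal a * fscal b"
  by (simp add: fscal_def mult_single)

lemma fscal_central: "fscal c * p = p * fscal c"
proof -
  have "fscal c * (\<Sum>w\<in>A. Poly_Mapping.single w (f w)) = (\<Sum>w\<in>A. Poly_Mapping.single w (f w)) * fscal c"
    for A and f :: "gen word \<Rightarrow> base"
    by (simp add: sum_distrib_left sum_distrib_right fscal_def mult_single mult.commute)
  from this[of "\<lambda>w. Poly_Mapping.lookup p w" "Poly_Mapping.keys p"] show ?thesis
    by (simp flip: sum_singles)
qed

lemma uscal_1 [simp]: "uscal 1 = 1"
  by transfer (simp add: fscal_def single_one two_sided_ideal.zero)

lemma uscal_add: "uscal (a + b) = uscal a + uscal b"
  by transfer (simp add: fscal_def single_add two_sided_ideal.zero)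

lemma uscal_mult: "uscal (a * b) = uscal a * uscal b"
  by transfer (simp add: fscal_mult two_sided_ideal.zero)

lemma uscal_0 [simp]: "uscal 0 = 0"
  using uscal_add[of 0 0] by simp

lemma uscal_central: "uscal c * x = x * uscal c"
  by transfer (simp add: fscal_central two_sided_ideal.zero)

lemma uscal_left_commute: "x * (uscal c * y) = uscal c * (x * y)"
  by (metis mult.assoc uscal_central)

lemma uscal_eq_0_cancel: "c \<noteq> 0 \<Longrightarrow> uscal c * x = 0 \<Longrightarrow> x = 0"
proof -
  assume "c \<noteq> 0" "uscal c * x = 0"
  then have "uscal (inverse c) * (uscal c * x) = 0" by simp
  then show "x = 0" using \<open>c \<noteq> 0\<close> by (simp flip: mult.assoc uscal_mult)
qed

lemma q_nonzero [simp]: "q \<noteq> 0"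
  by (simp add: q_def Zero_fract_def eq_fract)

lemma q_power_neq_1: "n > 0 \<Longrightarrow> q ^ n \<noteq> 1"
proof
  assume "n > 0" "q ^ n = 1"
  have "q ^ m = Fract ([:0, 1:] ^ m) 1" for m
    by (induction m) (simp_all add: q_def One_fract_def)
  then have "([:0, 1:] :: complex poly) ^ n = 1"
    using \<open>q ^ n = 1\<close> by (simp add: One_fract_def eq_fract)
  then have "degree (([:0, 1:] :: complex poly) ^ n) = 0" by simp
  then show False using \<open>n > 0\<close> by (simp add: degree_power_eq)
qed

lemma q_powi_neq_1: "a \<noteq> 0 \<Longrightarrow> q powi a \<noteq> 1"
proof (cases "a \<ge> 0")
  case True
  then show "a \<noteq> 0 \<Longrightarrow> q powi a \<noteq> 1" using q_power_neq_1[of "nat a"] by (simp add: power_int_def)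
next
  case False
  then show "a \<noteq> 0 \<Longrightarrow> q powi a \<noteq> 1" using q_power_neq_1[of "nat (- a)"]
    by (simp add: power_int_def power_inverse)
qed

definition fsc :: "base \<Rightarrow> ('m::len0, 'n::len0) uqgl fps" where
  "fsc c = fps_const (uscal c)"

lemma shift_nth [simp]: "fps_nth (shift s a F) r = uscal (q powi (- eps s * int r * a)) * fps_nth F r"
  by (simp add: shift_def)

lemma shift_mult: "shift s a (F * G) = shift s a F * shift s a G"
proof (rule fps_ext)
  fix n
  have "fps_nth (shift s a F * shift s a G) n =
    (\<Sum>i=0..n. uscal (q powi (- eps s * int n * a)) * (fps_nth F i * fps_nth G (n - i)))"
    unfolding fps_mult_nth
  proof (rule sum.cong[OF refl])
    fix i assume "i \<in> {0..n}"
    then have "- eps s * int n * a = - eps s * int i * a + - eps s * int (n - i) * a"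
      by (simp add: algebra_simps of_nat_diff)
    then have "q powi (- eps s * int n * a) = q powi (- eps s * int i * a) * q powi (- eps s * int (n - i) * a)"
      by (simp only: power_int_add[OF disjI1] q_nonzero not_False_eq_True)
    then show "fps_nth (shift s a F) i * fps_nth (shift s a G) (n - i) =
      uscal (q powi (- eps s * int n * a)) * (fps_nth F i * fps_nth G (n - i))"
      unfolding shift_nth by (simp only: uscal_mult) (simp only: mult.assoc uscal_left_commute[of "fps_nth F i"])
  qed
  then show "fps_nth (shift s a (F * G)) n = fps_nth (shift s a F * shift s a G) n"
    by (simp add: fps_mult_nth sum_distrib_left)
qed

lemma shift_shift: "shift s a (shift s b F) = shift s (a + b) F"
proof (rule fps_ext)
  fix n
  have "q powi (- eps s * int n * (a + b)) = q powi (- eps s * int n * a) * q powi (- eps s * int n * b)"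
    by (simp only: distrib_left power_int_add[OF disjI1] q_nonzero not_False_eq_True)
  then show "fps_nth (shift s a (shift s b F)) n = fps_nth (shift s (a + b) F) n"
    unfolding shift_nth by (simp only: uscal_mult mult.assoc)
qed

lemma shift_0 [simp]: "shift s 0 F = F"
  by (rule fps_ext) simp

lemma shift_power: "(shift s a ^^ n) F = shift s (int n * a) F"
  by (induction n) (simp_all add: shift_shift algebra_simps)

lemma shift_add: "shift s a (F + G) = shift s a F + shift s a G"
  by (rule fps_ext) (simp add: distrib_left)

lemma shift_const: "shift s a (fps_const x) = fps_const x"
  by (rule fps_ext) simp

lemma scalar_ext_shift: "scalar_ext fsc (shift s a :: ('m::len0, 'n::len0) uqgl fps \<Rightarrow> _)"
proof
  fix c and x :: "('m, 'n) uqgl fps"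
  show "fsc c * x = x * fsc c" by (rule fps_ext) (simp add: fsc_def uscal_central)
  show "shift s a (1 :: ('m, 'n) uqgl fps) = 1" using shift_const[of s a 1] by simp
qed (simp_all add: fsc_def uscal_add uscal_mult shift_add shift_mult shift_const)

text \<open>\<open>F\<close> and \<open>G\<close> commute at independent spectral arguments. Unlike
  commutation of the two series, this is stable under shifting either factor.\<close>

definition ccomm :: "'a::ring_1 fps \<Rightarrow> 'a fps \<Rightarrow> bool" where
  "ccomm F G \<longleftrightarrow> (\<forall>r p. fps_nth F r * fps_nth G p = fps_nth G p * fps_nth F r)"

lemma ccomm_sym: "ccomm F G \<Longrightarrow> ccomm G F"
  by (simp add: ccomm_def)

lemma ccomm_commutes: "ccomm F G \<Longrightarrow> F * G = G * F"
proof (rule fps_ext)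
  fix n assume "ccomm F G"
  then have "fps_nth (F * G) n = (\<Sum>i=0..n. fps_nth G (n - i) * fps_nth F i)"
    by (simp add: fps_mult_nth ccomm_def)
  also have "\<dots> = fps_nth (G * F) n"
    unfolding fps_mult_nth
    by (rule sum.reindex_bij_witness[of _ "\<lambda>i. n - i" "\<lambda>i. n - i"]) auto
  finally show "fps_nth (F * G) n = fps_nth (G * F) n" .
qed

lemma ccomm_shift: "ccomm F G \<Longrightarrow> ccomm (shift s a F) G"
  unfolding ccomm_def shift_nth by (metis mult.assoc uscal_left_commute)

text \<open>Freezing one series to its coefficients turns the condition into commutation with
  elements of the ring of series, to which \<open>inv_on_commutes\<close> applies.\<close>

lemma ccomm_iff_const: "ccomm F G \<longleftrightarrow> (\<forall>r. fps_const (fps_nth F r) * G = G * fps_const (fps_nth F r))"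
  by (auto simp: ccomm_def fps_eq_iff)

lemma ccomm_inverse:
  assumes "finite K" "inv_on K A B" "\<And>i j. i \<in> K \<Longrightarrow> j \<in> K \<Longrightarrow> ccomm F (A i j)" "i \<in> K" "j \<in> K"
  shows "ccomm F (B i j)"
  unfolding ccomm_iff_const
  by (intro allI inv_on_commutes[OF assms(1,2) _ assms(4,5)]) (use assms(3) in \<open>auto simp: ccomm_iff_const\<close>)

section \<open>Two spectral parameters\<close>

text \<open>
  A series of series is a series in two commuting variables \<open>u\<close> (inner) and \<open>v\<close> (outer);
  \<open>spec c\<close> is the substitution \<open>v = c u\<close>.
\<close>

definition emb2 :: "'a::ring_1 fps \<Rightarrow> 'a fps fps" where
  "emb2 F = Abs_fps (\<lambda>r. fps_const (fps_nth F r))"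

lemma emb2_nth [simp]: "fps_nth (emb2 F) r = fps_const (fps_nth F r)"
  by (simp add: emb2_def)

lemma emb2_0 [simp]: "emb2 0 = 0"
  by (rule fps_ext) simp

lemma emb2_1 [simp]: "emb2 1 = 1"
  by (rule fps_ext) simp

lemma emb2_add: "emb2 (F + G) = emb2 F + emb2 G"
  by (rule fps_ext) simp

lemma emb2_sum: "emb2 (sum f A) = (\<Sum>x\<in>A. emb2 (f x))"
  by (induction A rule: infinite_finite_induct) (auto simp: emb2_add)

lemma fps_const_sum: "fps_const (sum f A) = (\<Sum>x\<in>A. fps_const (f x))"
  by (induction A rule: infinite_finite_induct) (auto simp flip: fps_const_add)

lemma emb2_mult: "emb2 (F * G) = emb2 F * emb2 G"
  by (rule fps_ext) (simp add: fps_mult_nth fps_const_sum)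

lemma inv_on_emb2:
  fixes A B :: "'i \<Rightarrow> 'i \<Rightarrow> 'a::ring_1 fps"
  assumes "inv_on K A B"
  shows "inv_on K (\<lambda>i j. emb2 (A i j)) (\<lambda>i j. emb2 (B i j))"
proof -
  have "mm K (\<lambda>i j. emb2 (A i j)) (\<lambda>i j. emb2 (B i j)) i j = emb2 (mm K A B i j)"
    for A B :: "'i \<Rightarrow> 'i \<Rightarrow> 'a fps" and i j
    by (simp add: mm_def emb2_sum emb2_mult)
  then show ?thesis using assms by (auto simp: inv_on_def eq_on_def idm_def)
qed

lemma inv_on_fps_const:
  fixes A B :: "'i \<Rightarrow> 'i \<Rightarrow> 'a::ring_1"
  assumes "inv_on K A B"
  shows "inv_on K (\<lambda>i j. fps_const (A i j)) (\<lambda>i j. fps_const (B i j))"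
proof -
  have "mm K (\<lambda>i j. fps_const (A i j)) (\<lambda>i j. fps_const (B i j)) i j = fps_const (mm K A B i j)"
    for A B :: "'i \<Rightarrow> 'i \<Rightarrow> 'a" and i j
    by (simp add: mm_def fps_const_sum)
  then show ?thesis using assms by (auto simp: inv_on_def eq_on_def idm_def)
qed

definition uvar :: "'a::ring_1 fps fps" where "uvar = fps_const fps_X"
definition vvar :: "'a::ring_1 fps fps" where "vvar = fps_X"

lemma uvar_central: "uvar * x = x * uvar"
  by (rule fps_ext) (simp add: uvar_def fps_mult_fps_X_commute)

lemma vvar_central: "vvar * x = x * vvar"
  by (simp add: vvar_def fps_mult_fps_X_commute)

text \<open>The coefficients satisfy \<open>h_{p,r-1} = h_{p-1,r}\<close>, with zero for negative
  indices, so they vanish by induction on the outer index \<open>p\<close>.\<close>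

lemma uv_diff_cancel:
  assumes "(uvar - vvar) * H = 0"
  shows "H = 0"
proof -
  have *: "(if r = 0 then 0 else fps_nth (fps_nth H p) (r - 1)) =
    (if p = 0 then 0 else fps_nth (fps_nth H (p - 1)) r)" for p r
  proof -
    have "fps_nth (fps_nth ((uvar - vvar) * H) p) r = 0" by (simp add: assms)
    then show ?thesis by (simp add: left_diff_distrib uvar_def vvar_def split: if_splits)
  qed
  have "fps_nth (fps_nth H p) r = 0" for p r
  proof (induction p arbitrary: r)
    case 0
    show ?case using *[of "Suc r" 0] by simp
  next
    case (Suc p)
    show ?case using *[of "Suc r" "Suc p"] Suc by simp
  qed
  then show ?thesis by (simp add: fps_eq_iff)
qed

lemma emb_commute_ccomm: "fps_const F * emb2 G = emb2 G * fps_const F \<Longrightarrow> ccomm F G"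
  unfolding ccomm_def
proof (intro allI)
  fix r p assume "fps_const F * emb2 G = emb2 G * fps_const F"
  then have "fps_nth (fps_nth (fps_const F * emb2 G) p) r = fps_nth (fps_nth (emb2 G * fps_const F) p) r" by simp
  then show "fps_nth F r * fps_nth G p = fps_nth G p * fps_nth F r" by simp
qed

definition csc :: "base \<Rightarrow> ('m::len0, 'n::len0) uqgl fps fps" where
  "csc c = fps_const (fsc c)"

definition spec :: "base \<Rightarrow> ('m::len0, 'n::len0) uqgl fps fps \<Rightarrow> ('m, 'n) uqgl fps" where
  "spec c H = Abs_fps (\<lambda>n. \<Sum>b\<le>n. uscal (c ^ b) * fps_nth (fps_nth H b) (n - b))"

lemma spec_nth: "fps_nth (spec c H) n = (\<Sum>b\<le>n. uscal (c ^ b) * fps_nth (fps_nth H b) (n - b))"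
  by (simp add: spec_def)

lemma spec_0 [simp]: "spec c 0 = 0"
  by (rule fps_ext) (simp add: spec_nth)

lemma spec_add: "spec c (F + G) = spec c F + spec c G"
  by (rule fps_ext) (simp add: spec_nth distrib_left sum.distrib)

lemma spec_csc: "spec c (csc a * H) = fsc a * spec c H"
  by (rule fps_ext)
    (simp add: spec_nth csc_def fsc_def sum_distrib_left uscal_left_commute[of "uscal (c ^ _)" a])

lemma spec_uvar: "spec c (uvar * H) = fps_X * spec c H"
proof (rule fps_ext)
  fix n
  show "fps_nth (spec c (uvar * H)) n = fps_nth (fps_X * spec c H) n"
    by (cases n) (auto simp: spec_nth uvar_def Suc_diff_le intro!: sum.cong)
qed

lemma spec_vvar: "spec c (vvar * H) = fsc c * (fps_X * spec c H)"
proof (rule fps_ext)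
  fix n
  show "fps_nth (spec c (vvar * H)) n = fps_nth (fsc c * (fps_X * spec c H)) n"
  proof (cases n)
    case (Suc m)
    have "fps_nth (spec c (vvar * H)) (Suc m) =
      (\<Sum>b\<le>m. uscal (c ^ Suc b) * fps_nth (fps_nth H b) (m - b))"
      unfolding spec_nth by (subst sum.atMost_Suc_shift) (simp add: vvar_def)
    also have "\<dots> = fps_nth (fsc c * (fps_X * spec c H)) (Suc m)"
      by (simp add: spec_nth fsc_def sum_distrib_left uscal_mult mult.assoc)
    finally show ?thesis using Suc by simp
  qed (simp add: spec_nth vvar_def fsc_def)
qed

lemma spec_emb12:
  assumes "\<And>r. c ^ r = q powi (- eps s * int r * a)"
  shows "spec c (fps_const F * emb2 G) = F * shift s a G"
proof (rule fps_ext)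
  fix n
  have "fps_nth (spec c (fps_const F * emb2 G)) n = (\<Sum>b\<le>n. fps_nth F (n - b) * fps_nth (shift s a G) b)"
    by (simp add: spec_nth assms uscal_left_commute)
  also have "\<dots> = (\<Sum>i=0..n. fps_nth F i * fps_nth (shift s a G) (n - i))"
    by (rule sum.reindex_bij_witness[of _ "\<lambda>i. n - i" "\<lambda>i. n - i"]) auto
  finally show "fps_nth (spec c (fps_const F * emb2 G)) n = fps_nth (F * shift s a G) n"
    by (simp only: fps_mult_nth)
qed

lemma spec_emb21:
  assumes "\<And>r. c ^ r = q powi (- eps s * int r * a)"
  shows "spec c (emb2 G * fps_const F) = shift s a G * F"
proof (rule fps_ext)
  fix n
  have "fps_nth (spec c (emb2 G * fps_const F)) n = (\<Sum>b\<le>n. fps_nth (shift s a G) b * fps_nth F (n - b))"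
    by (simp add: spec_nth assms mult.assoc)
  then show "fps_nth (spec c (emb2 G * fps_const F)) n = fps_nth (shift s a G * F) n"
    by (simp only: fps_mult_nth atLeast0AtMost)
qed

text \<open>The series are in \<open>u = z^{-1}\<close>, \<open>v = w^{-1}\<close> for
  \<open>Pos\<close> and in \<open>u = z\<close>, \<open>v = w\<close> for \<open>Neg\<close>. As
  \<open>R(z,w)\<close> is homogeneous of degree one, for \<open>Pos\<close> it is multiplied by
  \<open>uv\<close>, which turns \<open>z\<close> into \<open>v\<close> and \<open>w\<close> into
  \<open>u\<close>.\<close>

definition zvar :: "sign \<Rightarrow> 'a::ring_1 fps fps" where
  "zvar s = (case s of Pos \<Rightarrow> vvar | Neg \<Rightarrow> uvar)"

definition wvar :: "sign \<Rightarrow> 'a::ring_1 fps fps" where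
  "wvar s = (case s of Pos \<Rightarrow> uvar | Neg \<Rightarrow> vvar)"

lemma zvar_central: "zvar s * x = x * zvar s" and wvar_central: "wvar s * x = x * wvar s"
  by (cases s; simp add: zvar_def wvar_def uvar_central vvar_central)+

lemma zw_diff_cancel: "(zvar s - wvar s) * H = 0 \<Longrightarrow> H = 0" "(wvar s - zvar s) * H = 0 \<Longrightarrow> H = 0"
proof -
  have "(uvar - vvar) * H = 0" if "(vvar - uvar) * H = 0"
    using that by (simp add: algebra_simps)
  then show "(zvar s - wvar s) * H = 0 \<Longrightarrow> H = 0" "(wvar s - zvar s) * H = 0 \<Longrightarrow> H = 0"
    by (cases s; auto simp: zvar_def wvar_def intro: uv_diff_cancel)+
qed

definition sx :: "base \<Rightarrow> ('m::len0, 'n::len0) uqgl fps \<Rightarrow> ('m, 'n) uqgl fps" where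
  "sx k S = fsc k * (fps_X * S)"

lemma fsc_central: "fsc c * x = x * fsc c"
  by (rule fps_ext) (simp add: fsc_def uscal_central)

lemma fsc_mult: "fsc (a * b) = fsc a * fsc b"
  by (simp add: fsc_def uscal_mult)

lemma fsc_add: "fsc (a + b) = fsc a + fsc b"
  by (simp add: fsc_def uscal_add)

lemma fsc_0 [simp]: "fsc 0 = 0"
  by (simp add: fsc_def)

lemma fsc_1 [simp]: "fsc 1 = 1"
  by (simp add: fsc_def)

lemma fsc_left_commute: "x * (fsc c * y) = fsc c * (x * y)"
  by (metis mult.assoc fsc_central)

lemma csc_central: "csc c * x = x * csc c"
  by (rule fps_ext) (simp add: csc_def fsc_central)

lemma sx_fsc: "sx k (fsc l * S) = sx (k * l) S"
  by (simp add: sx_def fsc_mult mult.assoc fsc_left_commute[of fps_X])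

lemma sx_add: "sx (k + l) S = sx k S + sx l S" "sx k (S + T) = sx k S + sx k T"
  by (simp_all add: sx_def fsc_add algebra_simps)

lemma sx_0 [simp]: "sx 0 S = 0" "sx k 0 = 0"
  by (simp_all add: sx_def)

lemma sx_minus: "sx (- k) S = - sx k S"
  using sx_add(1)[of k "- k" S] by (simp add: eq_neg_iff_add_eq_0 add.commute)

lemma sx_cancel: "k \<noteq> 0 \<Longrightarrow> sx k S = sx k T \<Longrightarrow> S = T"
proof (rule fps_ext)
  fix n assume k: "k \<noteq> 0" and "sx k S = sx k T"
  then have "fps_nth (sx k S) (Suc n) = fps_nth (sx k T) (Suc n)" by simp
  then have "uscal k * (fps_nth S n - fps_nth T n) = 0" by (simp add: sx_def fsc_def right_diff_distrib)
  then show "fps_nth S n = fps_nth T n" using uscal_eq_0_cancel[OF k] by fastforce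
qed

text \<open>
  At \<open>w = q\<^sup>2 z\<close> the entries of $R(z,w)$ at $E_{ii} \otimes E_{ii}$ vanish, and all others are
  multiples of \<open>1 - q\<^sup>2\<close>.
\<close>

lemma rtt_spec:
  fixes A B :: "nat \<Rightarrow> nat \<Rightarrow> ('m::len0, 'n::len0) uqgl fps fps"
  assumes R: "rtt z w (csc q) (csc (inverse q)) (\<lambda>_. 0) K A B"
    and AB: "\<And>i j k l. spec c (A i j * B k l) = a i j * b k l" "\<And>i j k l. spec c (B k l * A i j) = b k l * a i j"
    and z: "\<And>H. spec c (z * H) = sx \<zeta> (spec c H)" and w: "\<And>H. spec c (w * H) = sx (\<zeta> * q\<^sup>2) (spec c H)"
    and cen: "\<And>x. z * x = x * z" "\<And>x. w * x = x * w"
    and "\<zeta> \<noteq> 0" and K: "i \<in> K" "j \<in> K" "k \<in> K" "l \<in> K"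
  shows "(if i = k then 0 else a i j * b k l + fsc (asc q i k / asc q k i) * (a k j * b i l)) =
    (if j = l then 0 else b k l * a i j + fsc (asc q l j / asc q j l) * (b k j * a i l))"
proof -
  let ?d = "diag_coeff z w (csc q) (csc (inverse q)) (\<lambda>_. 0)"
  let ?c = "swap_coeff z w (csc q) (csc (inverse q)) (\<lambda>_. 0)"
  let ?D = "\<zeta> * (1 - q\<^sup>2)"
  have "q\<^sup>2 \<noteq> 1" by (rule q_power_neq_1) simp
  then have D: "?D \<noteq> 0" using \<open>\<zeta> \<noteq> 0\<close> by simp
  have spec_minus: "spec c (- H) = - spec c H" for H :: "('m, 'n) uqgl fps fps"
    using spec_add[of c H "- H"] by (simp add: eq_neg_iff_add_eq_0 add.commute)
  have spec_diff: "spec c (H - G) = spec c H - spec c G" for G H :: "('m, 'n) uqgl fps fps"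
    using spec_add[of c H "- G"] by (simp add: spec_minus)
  have d: "spec c (?d i k * H) = (if i = k then 0 else sx ?D (spec c H))" for i k :: nat and H
  proof (cases "i = k")
    case True
    have "spec c (?d i k * H) = spec c (z * (csc q * H)) - spec c (w * (csc (inverse q) * H))"
      using True by (simp add: diag_coeff_def left_diff_distrib mult.assoc spec_diff)
    also have "\<dots> = sx (\<zeta> * q) (spec c H) - sx (\<zeta> * q\<^sup>2 * inverse q) (spec c H)"
      by (simp only: z w spec_csc sx_fsc)
    also have "\<zeta> * q\<^sup>2 * inverse q = \<zeta> * q" by (simp add: power2_eq_square)
    finally show ?thesis using True by simp
  next
    case False
    have "?D = \<zeta> + - (\<zeta> * q\<^sup>2)" by (simp add: algebra_simps)
    then have "sx ?D (spec c H) = sx \<zeta> (spec c H) - sx (\<zeta> * q\<^sup>2) (spec c H)"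
      by (simp only: sx_add sx_minus) simp
    then show ?thesis using False by (simp add: diag_coeff_def left_diff_distrib spec_diff z w)
  qed
  have cc: "spec c (?c i k * H) = (if i = k then 0 else sx ?D (fsc (asc q i k / asc q k i) * spec c H))"
    for i k :: nat and H
  proof -
    have 1: "?c i k * H = (if i < k then z else w) * (csc q * H) - (if i < k then z else w) * (csc (inverse q) * H)"
      if "i \<noteq> k"
    proof -
      have "csc e * x * H = x * (csc e * H)" for e x
        by (metis csc_central mult.assoc)
      then show ?thesis using that by (simp add: swap_coeff_def left_diff_distrib)
    qed
    show ?thesis
    proof (cases i k rule: linorder_cases)
      case less
      have "sx ?D (fsc (asc q i k / asc q k i) * spec c H) = sx (?D * (asc q i k / asc q k i)) (spec c H)"
        by (simp add: sx_fsc)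
      \<comment> \<open>Here the ratio of weights is \<open>- 1/q\<close> and
        \<open>(1 - q^2)(- 1/q) = q - 1/q\<close>. In the case \<open>greater\<close> the ratio is
        \<open>- q\<close>, and the extra \<open>q^2\<close> comes from \<open>w\<close> replacing
        \<open>z\<close>.\<close>
      also have "?D * (asc q i k / asc q k i) = \<zeta> * q + - (\<zeta> * inverse q)"
        using less by (simp add: asc_def field_simps power2_eq_square)
      finally show ?thesis using less
        by (simp only: 1 spec_diff z spec_csc sx_fsc sx_add sx_minus) (simp add: 1 spec_diff z spec_csc sx_fsc)
    next
      case greater
      have "sx ?D (fsc (asc q i k / asc q k i) * spec c H) = sx (?D * (asc q i k / asc q k i)) (spec c H)"
        by (simp add: sx_fsc)
      also have "?D * (asc q i k / asc q k i) = \<zeta> * q\<^sup>2 * q + - (\<zeta> * q\<^sup>2 * inverse q)"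
        using greater by (simp add: asc_def field_simps power2_eq_square)
      finally show ?thesis using greater
        by (simp only: sx_add sx_minus) (simp add: 1 spec_diff w spec_csc sx_fsc)
    qed (simp add: swap_coeff_def)
  qed
  \<comment> \<open>The entries of \<open>R\<close> stand on the right in one side of the relation;
    being central they are moved to the left, where the rules for \<open>spec\<close> apply.\<close>
  have com: "x * ?d i k = ?d i k * x" "x * ?c i k = ?c i k * x" for x and i k :: nat
  proof -
    have 1: "x * (y * csc e) = y * csc e * x" if "\<And>x. y * x = x * y" for y e
      by (metis that csc_central mult.assoc)
    show "x * ?d i k = ?d i k * x"
    proof (cases "i = k")
      case True
      have "x * (z * csc e) = z * csc e * x" "x * (w * csc e) = w * csc e * x" for e
        by (rule 1, rule cen)+
      then show ?thesis using True by (simp add: diag_coeff_def left_diff_distrib right_diff_distrib)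
    qed (simp add: diag_coeff_def left_diff_distrib right_diff_distrib cen)
    have 3: "x * (csc e * y) = csc e * y * x" if "\<And>x. y * x = x * y" for y e
      by (metis that csc_central mult.assoc)
    have 2: "x * ((csc q - csc (inverse q)) * y) = (csc q - csc (inverse q)) * y * x" if "\<And>x. y * x = x * y" for y
      unfolding left_diff_distrib right_diff_distrib 3[OF that] ..
    show "x * ?c i k = ?c i k * x"
      by (auto simp: swap_coeff_def 2 cen)
  qed
  have "?d i k * (A i j * B k l) + ?c i k * (A k j * B i l) = ?d j l * (B k l * A i j) + ?c l j * (B k j * A i l)"
    using R[unfolded rtt_def, rule_format, OF K] by (simp add: com)
  then have "spec c (?d i k * (A i j * B k l)) + spec c (?c i k * (A k j * B i l)) =
      spec c (?d j l * (B k l * A i j)) + spec c (?c l j * (B k j * A i l))"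
    by (simp flip: spec_add)
  then have "sx ?D (if i = k then 0 else a i j * b k l + fsc (asc q i k / asc q k i) * (a k j * b i l)) =
    sx ?D (if j = l then 0 else b k l * a i j + fsc (asc q l j / asc q j l) * (b k j * a i l))"
    unfolding d cc AB by (auto simp: sx_add split: if_splits)
  then show ?thesis by (rule sx_cancel[OF D])
qed

text \<open>Exactly what equality of row and column determinants consumes, apart from invertibility
  of blocks. It is shared by the even block of \<open>L\<close> and the odd block of its inverse,
  for which the spectral parameters occur in opposite order.\<close>

definition rmatrix :: "sign \<Rightarrow> ('m::len0, 'n::len0) uqgl fps mat \<Rightarrow> nat set \<Rightarrow> bool" where
  "rmatrix s Y K \<longleftrightarrow> scalar_ext.fused fsc (shift s (- 2)) (asc q) Y K \<and>
     (\<forall>I N i j k l. I \<subseteq> K \<longrightarrow> inv_on I Y N \<longrightarrow> i \<in> I \<longrightarrow> j \<in> I \<longrightarrow> k \<in> I \<longrightarrow> l \<in> I \<longrightarrow> i \<noteq> l \<longrightarrow> j \<noteq> k \<longrightarrow>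
        ccomm (Y i j) (N k l))"

lemma rtt_subset: "rtt z w h h' p K A B \<Longrightarrow> K' \<subseteq> K \<Longrightarrow> rtt z w h h' p K' A B"
  unfolding rtt_def by (meson subsetD)

text \<open>Each substitution \<open>v = c u\<close> makes the second spectral parameter
  \<open>q^2\<close> times the first, where the first is \<open>z\<close> in one case and
  \<open>w\<close> in the other. \<open>\<zeta>\<close> is what the first parameter becomes:
  \<open>c\<close> if it is \<open>v\<close>, and 1 if it is \<open>u\<close>.\<close>

lemma spec_zw:
  shows "\<exists>\<zeta>. \<zeta> \<noteq> 0 \<and> (\<forall>H :: ('m::len0, 'n::len0) uqgl fps fps. spec (q powi (- 2 * eps s)) (zvar s * H) = sx \<zeta> (spec (q powi (- 2 * eps s)) H) \<and>
    spec (q powi (- 2 * eps s)) (wvar s * H) = sx (\<zeta> * q\<^sup>2) (spec (q powi (- 2 * eps s)) H))"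
    and "\<exists>\<zeta>. \<zeta> \<noteq> 0 \<and> (\<forall>H :: ('m, 'n) uqgl fps fps. spec (q powi (2 * eps s)) (wvar s * H) = sx \<zeta> (spec (q powi (2 * eps s)) H) \<and>
    spec (q powi (2 * eps s)) (zvar s * H) = sx (\<zeta> * q\<^sup>2) (spec (q powi (2 * eps s)) H))"
proof -
  have u: "spec c (uvar * H) = sx 1 (spec c H)" and v: "spec c (vvar * H) = sx c (spec c H)"
    for c and H :: "('m, 'n) uqgl fps fps"
    by (simp_all add: spec_uvar spec_vvar sx_def)
  have q2: "q powi (- 2) * q\<^sup>2 = 1" "q powi 2 = q\<^sup>2"
    by (simp_all add: power_int_minus power_int_def flip: power_mult_distrib)
  show "\<exists>\<zeta>. \<zeta> \<noteq> 0 \<and> (\<forall>H :: ('m, 'n) uqgl fps fps. spec (q powi (- 2 * eps s)) (zvar s * H) = sx \<zeta> (spec (q powi (- 2 * eps s)) H) \<and>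
    spec (q powi (- 2 * eps s)) (wvar s * H) = sx (\<zeta> * q\<^sup>2) (spec (q powi (- 2 * eps s)) H))"
  proof (cases s)
    case Pos
    then show ?thesis using q2 by (intro exI[of _ "q powi (- 2)"]) (simp add: zvar_def wvar_def u v)
  next
    case Neg
    then show ?thesis using q2 by (intro exI[of _ 1]) (simp add: zvar_def wvar_def u v)
  qed
  show "\<exists>\<zeta>. \<zeta> \<noteq> 0 \<and> (\<forall>H :: ('m, 'n) uqgl fps fps. spec (q powi (2 * eps s)) (wvar s * H) = sx \<zeta> (spec (q powi (2 * eps s)) H) \<and>
    spec (q powi (2 * eps s)) (zvar s * H) = sx (\<zeta> * q\<^sup>2) (spec (q powi (2 * eps s)) H))"
  proof (cases s)
    case Pos
    then show ?thesis using q2 by (intro exI[of _ 1]) (simp add: zvar_def wvar_def u v)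
  next
    case Neg
    then show ?thesis using q2 by (intro exI[of _ "q powi (- 2)"]) (simp add: zvar_def wvar_def u v)
  qed
qed

lemma powi_pow: "(q powi (a * b)) ^ r = q powi (int r * a * b)"
proof -
  have "(q powi (a * b)) ^ r = (q powi (a * b)) powi int r" by simp
  also have "\<dots> = q powi (a * b * int r)" by (rule power_int_mult[symmetric])
  finally show ?thesis by (simp add: mult_ac)
qed

lemma rtt_rmatrix:
  fixes Y :: "('m::len0, 'n::len0) uqgl fps mat"
  assumes R: "rtt (zvar s) (wvar s) (csc q) (csc (inverse q)) (\<lambda>_. 0) K (\<lambda>i j. fps_const (Y i j)) (\<lambda>i j. emb2 (Y i j))"
    and fin: "finite K"
  shows "rmatrix s Y K"
  unfolding rmatrix_def
proof (intro conjI allI impI)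
  interpret scalar_ext fsc "shift s (- 2)" by (rule scalar_ext_shift)
  let ?c = "q powi (- 2 * eps s)"
  obtain \<zeta> where z: "\<zeta> \<noteq> 0"
    and zw: "\<And>H :: ('m, 'n) uqgl fps fps. spec ?c (zvar s * H) = sx \<zeta> (spec ?c H)"
      "\<And>H :: ('m, 'n) uqgl fps fps. spec ?c (wvar s * H) = sx (\<zeta> * q\<^sup>2) (spec ?c H)"
    using spec_zw(1)[of s] by metis
  have cr: "?c ^ r = q powi (- eps s * int r * 2)" for r
    unfolding powi_pow by (rule arg_cong[of _ _ "\<lambda>x. q powi x"]) simp
  show "fused (asc q) Y K"
    unfolding fused_def
  proof (intro ballI)
    fix i j k l assume K: "i \<in> K" "j \<in> K" "k \<in> K" "l \<in> K"
    have "(if i = k then 0 else Y i j * shift s 2 (Y k l) + fsc (asc q i k / asc q k i) * (Y k j * shift s 2 (Y i l))) =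
      (if j = l then 0 else shift s 2 (Y k l) * Y i j + fsc (asc q l j / asc q j l) * (shift s 2 (Y k j) * Y i l))"
      by (rule rtt_spec[OF R spec_emb12[OF cr] spec_emb21[OF cr] zw zvar_central wvar_central z K])
    \<comment> \<open>The substitution left the second series shifted by 2; shifting everything back
      puts \<open>\<theta>\<close> on the first one.\<close>
    from arg_cong[OF this, of "shift s (- 2)"]
    show "(if i = k then 0 else shift s (- 2) (Y i j) * Y k l + scl (asc q i k / asc q k i) (shift s (- 2) (Y k j) * Y i l)) =
      (if j = l then 0 else Y k l * shift s (- 2) (Y i j) + scl (asc q l j / asc q j l) (Y k j * shift s (- 2) (Y i l)))"
      by (simp add: theta_add theta_mult shift_shift scl_def if_distrib cong: if_cong)
  qed
next
  fix I N i j k l assume I: "I \<subseteq> K" and N: "inv_on I Y N" and ijkl: "i \<in> I" "j \<in> I" "k \<in> I" "l \<in> I" "i \<noteq> l" "j \<noteq> k"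
  have "(zvar s - wvar s) * (emb2 (N k l) * fps_const (Y i j) - fps_const (Y i j) * emb2 (N k l)) = 0"
    by (rule rtt_commute_inverse[OF _ rtt_subset[OF R I] inv_on_emb2[OF N]])
      (use ijkl fin I in \<open>auto intro: zvar_central wvar_central finite_subset\<close>)
  then show "ccomm (Y i j) (N k l)"
    by (intro emb_commute_ccomm) (auto dest: zw_diff_cancel)
qed

text \<open>Now the series in \<open>v\<close> comes first in the relation. The substitution puts it
  at the argument multiplied by \<open>q^{-2}\<close>, so the fused relation appears without a
  further shift.\<close>

lemma rtt_rmatrix_swapped:
  fixes Y :: "('m::len0, 'n::len0) uqgl fps mat"
  assumes R: "rtt (wvar s) (zvar s) (csc q) (csc (inverse q)) (\<lambda>_. 0) K (\<lambda>i j. emb2 (Y i j)) (\<lambda>i j. fps_const (Y i j))"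
    and fin: "finite K"
  shows "rmatrix s Y K"
  unfolding rmatrix_def
proof (intro conjI allI impI)
  interpret scalar_ext fsc "shift s (- 2)" by (rule scalar_ext_shift)
  let ?c = "q powi (2 * eps s)"
  obtain \<zeta> where z: "\<zeta> \<noteq> 0"
    and zw: "\<And>H :: ('m, 'n) uqgl fps fps. spec ?c (wvar s * H) = sx \<zeta> (spec ?c H)"
      "\<And>H :: ('m, 'n) uqgl fps fps. spec ?c (zvar s * H) = sx (\<zeta> * q\<^sup>2) (spec ?c H)"
    using spec_zw(2)[of s] by metis
  have cr: "?c ^ r = q powi (- eps s * int r * - 2)" for r
    unfolding powi_pow by (rule arg_cong[of _ _ "\<lambda>x. q powi x"]) simp
  show "fused (asc q) Y K"
    unfolding fused_def
  proof (intro ballI)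
    fix i j k l assume K: "i \<in> K" "j \<in> K" "k \<in> K" "l \<in> K"
    have "(if i = k then 0 else shift s (- 2) (Y i j) * Y k l + fsc (asc q i k / asc q k i) * (shift s (- 2) (Y k j) * Y i l)) =
      (if j = l then 0 else Y k l * shift s (- 2) (Y i j) + fsc (asc q l j / asc q j l) * (Y k j * shift s (- 2) (Y i l)))"
      by (rule rtt_spec[OF R spec_emb21[OF cr] spec_emb12[OF cr] zw wvar_central zvar_central z K])
    then show "(if i = k then 0 else shift s (- 2) (Y i j) * Y k l + scl (asc q i k / asc q k i) (shift s (- 2) (Y k j) * Y i l)) =
      (if j = l then 0 else Y k l * shift s (- 2) (Y i j) + scl (asc q l j / asc q j l) (Y k j * shift s (- 2) (Y i l)))"
      by (simp only: scl_def)
  qed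
next
  fix I N i j k l assume I: "I \<subseteq> K" and N: "inv_on I Y N" and ijkl: "i \<in> I" "j \<in> I" "k \<in> I" "l \<in> I" "i \<noteq> l" "j \<noteq> k"
  have "(wvar s - zvar s) * (fps_const (N k l) * emb2 (Y i j) - emb2 (Y i j) * fps_const (N k l)) = 0"
    by (rule rtt_commute_inverse[OF _ rtt_subset[OF R I] inv_on_fps_const[OF N]])
      (use ijkl fin I in \<open>auto intro: zvar_central wvar_central finite_subset\<close>)
  then show "ccomm (Y i j) (N k l)"
    by (intro ccomm_sym[OF emb_commute_ccomm]) (auto dest: zw_diff_cancel)
qed

lemma asc_nonzero: "i \<noteq> j \<Longrightarrow> asc q i j \<noteq> 0"
  by (simp add: asc_def)

lemma rmatrix_cdet_eq_rdet:
  fixes Y :: "('m::len0, 'n::len0) uqgl fps mat"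
  assumes Y: "rmatrix s Y K" and inv: "\<And>I. I \<subseteq> K \<Longrightarrow> \<exists>N. inv_on I Y N" and ks: "distinct ks" "set ks \<subseteq> K"
  shows "scalar_ext.cdet fsc (shift s (- 2)) (\<lambda>s c. asc q c s) Y ks =
    scalar_ext.rdet fsc (shift s (- 2)) (asc q) Y ks"
proof -
  interpret scalar_ext fsc "shift s (- 2) :: ('m, 'n) uqgl fps \<Rightarrow> _" by (rule scalar_ext_shift)
  show ?thesis
  proof (rule cdet_eq_rdet[OF _ asc_nonzero inv _ ks])
    show "fused (asc q) Y K" using Y by (simp add: rmatrix_def)
    fix I N i j k l m
    assume "I \<subseteq> K" "inv_on I Y N" "i \<in> I" "j \<in> I" "k \<in> I" "l \<in> I" "i \<noteq> l" "j \<noteq> k"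
    then have "ccomm (Y i j) (N k l)" using Y unfolding rmatrix_def by blast
    then show "(shift s (- 2) ^^ m) (Y i j) * N k l = N k l * (shift s (- 2) ^^ m) (Y i j)"
      unfolding shift_power by (intro ccomm_commutes ccomm_shift)
  qed
qed

section \<open>The defining relations\<close>

text \<open>Comparing coefficients in \<open>f(k u) = f(u) r(u)\<close> with \<open>r_0 = 1\<close>
  gives \<open>(k^n - 1) f_n = \<Sum>i<n. f_i r_{n-i}\<close>, solved here recursively from
  \<open>f_0 = 1\<close>.\<close>

fun fcoef :: "base \<Rightarrow> base fps \<Rightarrow> nat \<Rightarrow> base" where
  "fcoef k r n = (if n = 0 then 1 else (\<Sum>i<n. fcoef k r i * fps_nth r (n - i)) / (k ^ n - 1))"

declare fcoef.simps [simp del]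

lemma ex1_functional_equation:
  fixes r :: "base fps"
  assumes "fps_nth r 0 = 1" and k: "\<And>n. n > 0 \<Longrightarrow> k ^ n \<noteq> 1"
  shows "\<exists>!f. fps_nth f 0 = 1 \<and> fps_compose f (fps_const k * fps_X) = f * r"
proof -
  have eq: "fps_compose f (fps_const k * fps_X) = f * r \<longleftrightarrow>
    (\<forall>n>0. fps_nth f n = (\<Sum>i<n. fps_nth f i * fps_nth r (n - i)) / (k ^ n - 1))" if "fps_nth f 0 = 1" for f
  proof -
    have "k ^ n * fps_nth f n = (\<Sum>i\<le>n. fps_nth f i * fps_nth r (n - i)) \<longleftrightarrow>
      (n > 0 \<longrightarrow> fps_nth f n = (\<Sum>i<n. fps_nth f i * fps_nth r (n - i)) / (k ^ n - 1))" for n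
    proof (cases "n = 0")
      case False
      then have "k ^ n - 1 \<noteq> 0" using k[of n] by simp
      moreover have "(\<Sum>i\<le>n. fps_nth f i * fps_nth r (n - i)) =
          (\<Sum>i<n. fps_nth f i * fps_nth r (n - i)) + fps_nth f n"
        using assms(1) by (simp add: lessThan_Suc_atMost[symmetric])
      ultimately show ?thesis using False by (simp add: field_simps)
    qed (use that assms in simp)
    then show ?thesis
      by (simp add: fps_compose_linear fps_eq_iff fps_mult_nth atLeast0AtMost)
  qed
  show ?thesis
  proof (rule ex1I[of _ "Abs_fps (fcoef k r)"])
    have 1: "fps_nth (Abs_fps (fcoef k r)) 0 = 1" by (simp add: fcoef.simps)
    have "fcoef k r n = (\<Sum>i<n. fcoef k r i * fps_nth r (n - i)) / (k ^ n - 1)" if "n > 0" for n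
      using that by (subst fcoef.simps) simp
    then show "fps_nth (Abs_fps (fcoef k r)) 0 = 1 \<and>
      fps_compose (Abs_fps (fcoef k r)) (fps_const k * fps_X) = Abs_fps (fcoef k r) * r"
      using 1 eq[OF 1] by simp
    fix f assume f: "fps_nth f 0 = 1 \<and> fps_compose f (fps_const k * fps_X) = f * r"
    have "fps_nth f n = fcoef k r n" for n
    proof (induction n rule: less_induct)
      case (less n)
      show ?case
      proof (cases "n = 0")
        case False
        then have "fps_nth f n = (\<Sum>i<n. fps_nth f i * fps_nth r (n - i)) / (k ^ n - 1)"
          using f eq[of f] by blast
        also have "\<dots> = fcoef k r n"
          using less False by (subst fcoef.simps) simp
        finally show ?thesis .
      qed (use f in \<open>simp add: fcoef.simps\<close>)
    qed
    then show "f = Abs_fps (fcoef k r)" by (simp add: fps_eq_iff)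
  qed
qed

lemma xvar_X: "xvar * fls_X = 1"
  by (rule fls_eqI) (simp add: fls_X_inv_times_conv_shift(1))

text \<open>The description in \<open>fseries\<close> has to be shown to denote something. In the
  variable \<open>u\<close> its equation is \<open>f(k u) = f r\<close> with
  \<open>k = q^{-d}\<close>; since \<open>M \<noteq> N\<close> gives \<open>d \<noteq> 0\<close>, no
  positive power of \<open>k\<close> is 1.\<close>

lemma fseries_0:
  assumes "M \<noteq> N"
  shows "fps_nth (fseries M N) 0 = 1"
proof -
  define d where "d = 2 * int N - 2 * int M"
  define a b c k where "a = q powi (- 2)" and "b = q powi (d + 2)" and "c = q powi d" and "k = q powi (- d)"
  define n m where "n = (fps_X - fps_const a) * (fps_X - fps_const b)"
    and "m = (fps_X - 1) * (fps_X - fps_const c)"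
  define r where "r = n * inverse m"
  \<comment> \<open>The constant terms of \<open>n\<close> and \<open>m\<close> are
    \<open>a b\<close> and \<open>c\<close>, so this gives \<open>r_0 = 1\<close>.\<close>
  have "a * b = c" by (simp add: a_def b_def c_def flip: power_int_add)
  moreover have c0: "c \<noteq> 0" by (simp add: c_def)
  ultimately have r0: "fps_nth r 0 = 1"
    by (simp add: r_def n_def m_def)
  have m0: "fps_nth m 0 \<noteq> 0" using c0 by (simp add: m_def)
  have rm: "r * m = n" using m0 by (simp add: r_def mult.assoc inverse_mult_eq_1)
  have x: "1 - xvar * fls_const e = xvar * fps_to_fls (fps_X - fps_const e)" for e :: base
    by (simp add: right_diff_distrib xvar_X)
  have x1: "1 - xvar = xvar * fps_to_fls (fps_X - 1)"
    by (simp add: right_diff_distrib xvar_X)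
  have "((1 - xvar * qpow (- 2)) * (1 - xvar * qpow (d + 2))) / ((1 - xvar) * (1 - xvar * qpow d)) =
     (xvar * xvar * fps_to_fls n) / (xvar * xvar * fps_to_fls m)"
    unfolding a_def[symmetric] b_def[symmetric] c_def[symmetric] x x1 n_def m_def fls_times_fps_to_fls
    by (simp only: mult_ac)
  also have "\<dots> = fps_to_fls n / fps_to_fls m" by simp
  also have "\<dots> = fps_to_fls r"
  proof -
    have "m \<noteq> 0" using m0 by auto
    then show ?thesis by (simp add: divide_eq_eq rm flip: fls_times_fps_to_fls)
  qed
  finally have ratio: "((1 - xvar * qpow (- 2)) * (1 - xvar * qpow (d + 2))) / ((1 - xvar) * (1 - xvar * qpow d)) =
    fps_to_fls r" .
  have fs: "fseries M N = (THE f. fps_nth f 0 = 1 \<and> fps_compose f (fps_const k * fps_X) = f * r)"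
    unfolding fseries_def Let_def d_def[symmetric] ratio k_def[symmetric]
    by (simp flip: fls_times_fps_to_fls)
  have "\<exists>!f. fps_nth f 0 = 1 \<and> fps_compose f (fps_const k * fps_X) = f * r"
  proof (rule ex1_functional_equation[OF r0])
    fix n :: nat assume "n > 0"
    moreover have "k ^ n = q powi (- d * int n)"
      unfolding power_int_mult k_def by simp
    ultimately show "k ^ n \<noteq> 1" using assms by (simp only:) (rule q_powi_neq_1, simp add: d_def)
  qed
  from theI'[OF this] show ?thesis unfolding fs by blast
qed

text \<open>As \<open>xq - q^{-1} = x (q - q^{-1} u)\<close>, the scalar factor of \<open>R\<close>
  is \<open>u\<close> times this series, whose constant term is nonzero when
  \<open>M \<noteq> N\<close>.\<close>

definition gseries :: "nat \<Rightarrow> nat \<Rightarrow> base fps" where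
  "gseries M N = fseries M N * inverse (fps_const q - fps_const (inverse q) * fps_X)"

lemma gseries_0: "M \<noteq> N \<Longrightarrow> fps_nth (gseries M N) 0 \<noteq> 0"
  by (simp add: gseries_def fseries_0)

text \<open>\<open>rz\<close> and \<open>rw\<close> are the coefficients in
  \<open>R(z,w) = z rz + w rw\<close>.\<close>

definition rz :: "nat \<Rightarrow> base tens" where
  "rz M i j k l =
     (if i = j \<and> k = l then if i = k then qsub M i else 1
      else if k = j \<and> l = i then if i < j then qsub M j - inverse (qsub M j) else 0 else 0)"

definition rw :: "nat \<Rightarrow> base tens" where
  "rw M i j k l =
     (if i = j \<and> k = l then if i = k then - inverse (qsub M i) else - 1
      else if k = j \<and> l = i then if i < j then 0 else qsub M j - inverse (qsub M j) else 0)"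

lemma Rmat_rz_rw: "Rmat M xvar 1 i j k l = xvar * fls_const (rz M i j k l) + fls_const (rw M i j k l)"
proof -
  have m: "fls_const (- c) = - fls_const c" for c :: base by (rule fls_eqI) simp
  show ?thesis
  proof (cases "i = j \<and> k = l")
    case True
    then show ?thesis by (cases "i = k") (simp_all add: Rmat_def rz_def rw_def m)
  next
    case False
    then show ?thesis
      unfolding Rmat_def rz_def rw_def if_not_P[OF False]
      by (cases "k = j \<and> l = i"; cases "i < j") (simp_all, auto)
  qed
qed

text \<open>With \<open>g\<close> the series \<open>gseries\<close>,
  \<open>u g (x rz + rw) = g rz + u g rw\<close>.\<close>

lemma Rcoeff_eq:
  "Rcoeff M N e i j k l = rz M i j k l * fps_nth (gseries M N) e +
     rw M i j k l * (if e = 0 then 0 else fps_nth (gseries M N) (e - 1))"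
proof -
  define D where "D = fps_const q - fps_const (inverse q) * fps_X"
  define A B where "A = rz M i j k l" and "B = rw M i j k l"
  have D0: "fps_nth D 0 \<noteq> 0" by (simp add: D_def)
  then have D1: "D \<noteq> 0" by auto
  have "fls_const c = xvar * fps_to_fls (fps_const c * fps_X)" for c
    by (simp add: fls_times_fps_to_fls mult.left_commute[of xvar] xvar_X)
  then have x: "xvar * fls_const a + fls_const c = xvar * fps_to_fls (fps_const a + fps_const c * fps_X)" for a c
    by (simp add: distrib_left)
  have den: "xvar * qpow 1 - qpow (- 1) = xvar * fps_to_fls D"
  proof -
    have m: "fls_const (- c) = - fls_const c" for c :: base by (rule fls_eqI) simp
    show ?thesis using x[of q "- inverse q"] by (simp add: D_def power_int_minus m del: fps_const_neg flip: fps_const_neg)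
  qed
  have "(xvar * fls_const A + fls_const B) / (xvar * qpow 1 - qpow (- 1)) =
    fps_to_fls (fps_const A + fps_const B * fps_X) / fps_to_fls D"
    unfolding x den by simp
  also have "\<dots> = fps_to_fls ((fps_const A + fps_const B * fps_X) * inverse D)"
    using D0 D1 by (simp add: divide_eq_eq mult.assoc inverse_mult_eq_1 del: fps_to_fls_plus flip: fls_times_fps_to_fls)
  finally have "Rseries M N i j k l = fps_to_fls (fseries M N * ((fps_const A + fps_const B * fps_X) * inverse D))"
    unfolding Rseries_def Rmat_rz_rw A_def[symmetric] B_def[symmetric] by (simp only: fls_times_fps_to_fls)
  also have "fseries M N * ((fps_const A + fps_const B * fps_X) * inverse D) =
    fps_const A * gseries M N + fps_const B * (fps_X * gseries M N)"
    by (simp add: gseries_def D_def algebra_simps)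
  finally show ?thesis by (simp add: Rcoeff_def A_def B_def)
qed

section \<open>Passage to the quotient algebra and removal of the scalar factor\<close>

lemma abs_uqgl_hom:
  "abs_uqgl (x + y) = (abs_uqgl x + abs_uqgl y :: ('m::len0, 'n::len0) uqgl)"
  "abs_uqgl (x - y) = (abs_uqgl x - abs_uqgl y :: ('m::len0, 'n::len0) uqgl)"
  "abs_uqgl (x * y) = (abs_uqgl x * abs_uqgl y :: ('m::len0, 'n::len0) uqgl)"
  "abs_uqgl (- x) = (- abs_uqgl x :: ('m::len0, 'n::len0) uqgl)"
  "abs_uqgl 0 = (0 :: ('m::len0, 'n::len0) uqgl)" "abs_uqgl 1 = (1 :: ('m::len0, 'n::len0) uqgl)"
  by (simp_all add: plus_uqgl.abs_eq minus_uqgl.abs_eq times_uqgl.abs_eq uminus_uqgl.abs_eq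
    zero_uqgl.abs_eq one_uqgl.abs_eq)

lemma abs_uqgl_sum: "abs_uqgl (sum f A) = (\<Sum>x\<in>A. abs_uqgl (f x) :: ('m::len0, 'n::len0) uqgl)"
  by (induction A rule: infinite_finite_induct) (simp_all add: abs_uqgl_hom)

lemma abs_uqgl_power: "abs_uqgl (x ^ n) = (abs_uqgl x ^ n :: ('m::len0, 'n::len0) uqgl)"
  by (induction n) (simp_all add: abs_uqgl_hom)

lemma abs_uqgl_relator:
  assumes "x \<in> relators LENGTH('m) LENGTH('n)"
  shows "abs_uqgl x = (0 :: ('m::len0, 'n::len0) uqgl)"
proof -
  have "1 * x * 1 - 0 \<in> two_sided_ideal (relators LENGTH('m) LENGTH('n))"
    using two_sided_ideal.gen[OF assms, of 1 1] by simp
  then show ?thesis by (simp add: zero_uqgl.abs_eq uqgl.abs_eq_iff)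
qed

lemma abs_uqgl_tmult:
  "abs_uqgl (tmult M N A B i j k l) =
   (tmult M N (\<lambda>i j k l. abs_uqgl (A i j k l)) (\<lambda>i j k l. abs_uqgl (B i j k l)) i j k l :: ('m::len0, 'n::len0) uqgl)"
  by (simp add: tmult_def abs_uqgl_hom abs_uqgl_sum abs_uqgl_power)

definition lcoeff :: "sign \<Rightarrow> nat \<Rightarrow> nat \<Rightarrow> nat \<Rightarrow> ('m::len0, 'n::len0) uqgl" where
  "lcoeff s r i j = ugen (LGen s i j r)"

definition tens1 :: "(nat \<Rightarrow> nat \<Rightarrow> 'a::ring_1) \<Rightarrow> 'a tens" where
  "tens1 A i j k l = (if k = l then A i j else 0)"

definition tens2 :: "(nat \<Rightarrow> nat \<Rightarrow> 'a::ring_1) \<Rightarrow> 'a tens" where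
  "tens2 A i j k l = (if i = j then A k l else 0)"

text \<open>A coefficient of \<open>T L_1 L_2 - L_2 L_1 T\<close> for an arbitrary constant matrix
  \<open>T\<close>; linearity in \<open>T\<close> separates the contributions of \<open>rz\<close>
  and \<open>rw\<close>.\<close>

definition rll_part :: "base tens \<Rightarrow> sign \<Rightarrow> nat \<Rightarrow> nat \<Rightarrow> ('m::len0, 'n::len0) uqgl tens" where
  "rll_part T s r p i j k l =
     tmult LENGTH('m) LENGTH('n) (tmult LENGTH('m) LENGTH('n) (\<lambda>i j k l. uscal (T i j k l)) (tens1 (lcoeff s r)))
       (tens2 (lcoeff s p)) i j k l
     - tmult LENGTH('m) LENGTH('n) (tmult LENGTH('m) LENGTH('n) (tens2 (lcoeff s p)) (tens1 (lcoeff s r)))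
       (\<lambda>i j k l. uscal (T i j k l)) i j k l"

lemma tmult_lin:
  fixes A :: "('m::len0, 'n::len0) uqgl tens"
  shows "tmult M N (\<lambda>i j k l. uscal a * A i j k l + uscal b * B i j k l) C i j k l =
    uscal a * tmult M N A C i j k l + uscal b * tmult M N B C i j k l"
  "tmult M N C (\<lambda>i j k l. uscal a * A i j k l + uscal b * B i j k l) i j k l =
    uscal a * tmult M N C A i j k l + uscal b * tmult M N C B i j k l"
proof -
  have s: "(- 1) ^ n * (uscal a * x) = uscal a * ((- 1) ^ n * x)" for n a and x :: "('m, 'n) uqgl"
    by (rule uscal_left_commute)
  show "tmult M N (\<lambda>i j k l. uscal a * A i j k l + uscal b * B i j k l) C i j k l =
    uscal a * tmult M N A C i j k l + uscal b * tmult M N B C i j k l"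
    unfolding tmult_def sum_distrib_left sum.distrib[symmetric]
    by (intro sum.cong refl) (simp only: distrib_left distrib_right s mult.assoc)
  have s2: "(- 1) ^ n * c * (uscal a * x) = uscal a * ((- 1) ^ n * c * x)" for n a and c x :: "('m, 'n) uqgl"
    by (rule uscal_left_commute)
  show "tmult M N C (\<lambda>i j k l. uscal a * A i j k l + uscal b * B i j k l) i j k l =
    uscal a * tmult M N C A i j k l + uscal b * tmult M N C B i j k l"
    unfolding tmult_def sum_distrib_left sum.distrib[symmetric]
    by (intro sum.cong refl) (simp only: distrib_left s2)
qed

lemma rll_part_lin:
  "rll_part (\<lambda>i j k l. a * T i j k l + b * T' i j k l) s r p i j k l =
   uscal a * rll_part T s r p i j k l + uscal b * (rll_part T' s r p i j k l :: ('m::len0, 'n::len0) uqgl)"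
proof -
  have t: "tmult LENGTH('m) LENGTH('n) (\<lambda>i j k l. uscal (a * T i j k l + b * T' i j k l)) (tens1 (lcoeff s r)) =
    (\<lambda>i j k l. uscal a * tmult LENGTH('m) LENGTH('n) (\<lambda>i j k l. uscal (T i j k l)) (tens1 (lcoeff s r)) i j k l +
     uscal b * (tmult LENGTH('m) LENGTH('n) (\<lambda>i j k l. uscal (T' i j k l)) (tens1 (lcoeff s r)) i j k l :: ('m, 'n) uqgl))"
    by (intro ext) (simp only: uscal_add uscal_mult tmult_lin)
  show ?thesis
    unfolding rll_part_def t by (simp only: uscal_add uscal_mult tmult_lin) (simp add: algebra_simps)
qed

lemma abs_rll_term:
  "abs_uqgl (tmult LENGTH('m) LENGTH('n) (tmult LENGTH('m) LENGTH('n) (Rterm LENGTH('m) LENGTH('n) 1 e) (L1 s r)) (L2 s p) i j k l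
      - tmult LENGTH('m) LENGTH('n) (tmult LENGTH('m) LENGTH('n) (L2 s p) (L1 s r)) (Rterm LENGTH('m) LENGTH('n) 1 e) i j k l) =
   (rll_part (Rcoeff LENGTH('m) LENGTH('n) e) s r p i j k l :: ('m::len0, 'n::len0) uqgl)"
proof -
  have 1: "(\<lambda>i j k l. abs_uqgl (L1 s r i j k l) :: ('m, 'n) uqgl) = tens1 (lcoeff s r)"
    "(\<lambda>i j k l. abs_uqgl (L2 s p i j k l) :: ('m, 'n) uqgl) = tens2 (lcoeff s p)"
    "(\<lambda>i j k l. abs_uqgl (Rterm LENGTH('m) LENGTH('n) 1 e i j k l) :: ('m, 'n) uqgl) =
      (\<lambda>i j k l. uscal (Rcoeff LENGTH('m) LENGTH('n) e i j k l))"
    by (intro ext; simp add: L1_def L2_def tens1_def tens2_def lcoeff_def ugen.abs_eq abs_uqgl_hom Rterm_def uscal.abs_eq)+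
  show ?thesis
    by (simp only: abs_uqgl_hom abs_uqgl_tmult 1 rll_part_def)
qed

text \<open>The coefficient of \<open>z\<^sup>-\<^sup>a w\<^sup>-\<^sup>b\<close>; it vanishes unless \<open>a\<close> and \<open>b\<close> have the sign of the series.\<close>

definition rll_int :: "base tens \<Rightarrow> sign \<Rightarrow> int \<Rightarrow> int \<Rightarrow> ('m::len0, 'n::len0) uqgl tens" where
  "rll_int T s a b i j k l =
     (if eps s * a \<ge> 0 \<and> eps s * b \<ge> 0 then rll_part T s (nat (eps s * a)) (nat (eps s * b)) i j k l else 0)"

text \<open>In the relator, \<open>e\<close> determines \<open>r\<close> and \<open>p\<close>. The
  sign conditions bound \<open>e\<close> by \<open>a\<close> for \<open>Pos\<close> and by
  \<open>- b\<close> for \<open>Neg\<close>, so the range up to \<open>E\<close> misses nothing, and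
  the additional terms are zero by the definition of \<open>rll_int\<close>.\<close>

lemma rll_int_sum:
  assumes "i \<in> {1..LENGTH('m) + LENGTH('n)}" "j \<in> {1..LENGTH('m) + LENGTH('n)}"
    "k \<in> {1..LENGTH('m) + LENGTH('n)}" "l \<in> {1..LENGTH('m) + LENGTH('n)}"
    and E: "E = nat (\<bar>a\<bar> + \<bar>b\<bar>)"
  shows "(\<Sum>e\<le>E. rll_int (Rcoeff LENGTH('m) LENGTH('n) e) s (a - int e) (b + int e) i j k l) =
    (0 :: ('m::len0, 'n::len0) uqgl)"
proof -
  let ?S = "{(e, r, p). int e + eps s * int r = a \<and> eps s * int p - int e = b}"
  let ?C = "{e. e \<le> E \<and> eps s * (a - int e) \<ge> 0 \<and> eps s * (b + int e) \<ge> 0}"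
  have "(0 :: ('m, 'n) uqgl) = abs_uqgl (rll LENGTH('m) LENGTH('n) s s 1 1 a b i j k l)"
    by (rule abs_uqgl_relator[symmetric]) (use assms in \<open>auto intro: relators.rll_same\<close>)
  also have "\<dots> = (\<Sum>(e, r, p)\<in>?S. rll_part (Rcoeff LENGTH('m) LENGTH('n) e) s r p i j k l)"
    unfolding rll_def abs_uqgl_sum by (intro sum.cong refl) (auto simp only: abs_rll_term split: prod.splits)
  also have "\<dots> = (\<Sum>e\<in>?C. rll_part (Rcoeff LENGTH('m) LENGTH('n) e) s
      (nat (eps s * (a - int e))) (nat (eps s * (b + int e))) i j k l)"
    by (rule sum.reindex_bij_witness[of _ "\<lambda>e. (e, nat (eps s * (a - int e)), nat (eps s * (b + int e)))" fst])
      (use E in \<open>cases s; auto\<close>)+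
  also have "\<dots> = (\<Sum>e\<in>?C. rll_int (Rcoeff LENGTH('m) LENGTH('n) e) s (a - int e) (b + int e) i j k l)"
    by (intro sum.cong refl) (simp add: rll_int_def)
  also have "\<dots> = (\<Sum>e\<le>E. rll_int (Rcoeff LENGTH('m) LENGTH('n) e) s (a - int e) (b + int e) i j k l)"
    by (rule sum.mono_neutral_left) (auto simp: rll_int_def)
  finally show ?thesis ..
qed

text \<open>
  The scalar factor \<open>f(x)/(xq - q\<^sup>-\<^sup>1)\<close> of $R$ is \<open>x\<^sup>-\<^sup>1\<close> times an invertible power series in
  \<open>x\<^sup>-\<^sup>1\<close>, so by induction on the degree it can be removed from the relation.
\<close>

lemma rll_polynomial:
  assumes ne: "LENGTH('m) \<noteq> LENGTH('n)"
    and ijkl: "i \<in> {1..LENGTH('m) + LENGTH('n)}" "j \<in> {1..LENGTH('m) + LENGTH('n)}"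
    "k \<in> {1..LENGTH('m) + LENGTH('n)}" "l \<in> {1..LENGTH('m) + LENGTH('n)}"
  shows "rll_int (rz LENGTH('m)) s a b i j k l + rll_int (rw LENGTH('m)) s (a - 1) (b + 1) i j k l =
    (0 :: ('m::len0, 'n::len0) uqgl)"
proof -
  let ?M = "LENGTH('m)" and ?N = "LENGTH('n)"
  let ?g = "fps_nth (gseries ?M ?N)"
  define Q :: "int \<Rightarrow> int \<Rightarrow> ('m, 'n) uqgl" where
    "Q a b = rll_int (rz ?M) s a b i j k l + rll_int (rw ?M) s (a - 1) (b + 1) i j k l" for a b
  have R: "rll_int (Rcoeff ?M ?N e) s a b i j k l = uscal (?g e) * rll_int (rz ?M) s a b i j k l +
      uscal (if e = 0 then 0 else ?g (e - 1)) * (rll_int (rw ?M) s a b i j k l :: ('m, 'n) uqgl)" for e a b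
  proof -
    have "Rcoeff ?M ?N e = (\<lambda>i j k l. ?g e * rz ?M i j k l + (if e = 0 then 0 else ?g (e - 1)) * rw ?M i j k l)"
      by (intro ext) (simp add: Rcoeff_eq mult.commute)
    then show ?thesis by (simp add: rll_int_def rll_part_lin)
  qed
  have sumQ: "(\<Sum>e\<le>nat (\<bar>a\<bar> + \<bar>b\<bar>). uscal (?g e) * Q (a - int e) (b + int e)) = 0" for a b
  proof -
    let ?E = "nat (\<bar>a\<bar> + \<bar>b\<bar>)"
    let ?w = "\<lambda>e. rll_int (rw ?M) s (a - 1 - int e) (b + 1 + int e) i j k l :: ('m, 'n) uqgl"
    \<comment> \<open>The term that the index shift by one would lose at the upper end: there one of
      the two exponents has the wrong sign.\<close>
    have top: "?w ?E = 0" by (cases s) (auto simp: rll_int_def)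
    have "(\<Sum>e\<le>?E. uscal (if e = 0 then 0 else ?g (e - 1)) * (rll_int (rw ?M) s (a - int e) (b + int e) i j k l :: ('m, 'n) uqgl)) =
      (\<Sum>e\<le>?E. uscal (?g e) * ?w e)"
    proof (cases ?E)
      case 0
      then show ?thesis using top by simp
    next
      case (Suc E')
      have "(\<Sum>e\<le>?E. uscal (if e = 0 then 0 else ?g (e - 1)) * (rll_int (rw ?M) s (a - int e) (b + int e) i j k l :: ('m, 'n) uqgl)) =
        (\<Sum>e\<le>E'. uscal (?g e) * ?w e)"
        unfolding Suc by (subst sum.atMost_Suc_shift) (simp add: algebra_simps)
      also have "\<dots> = (\<Sum>e\<le>?E. uscal (?g e) * ?w e)"
        using top unfolding Suc by simp
      finally show ?thesis .
    qed
    then show ?thesis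
      using rll_int_sum[OF ijkl refl, where s = s and a = a and b = b]
      unfolding R sum.distrib by (simp add: Q_def distrib_left sum.distrib algebra_simps)
  qed
  \<comment> \<open>\<open>Q\<close> vanishes when this measure is negative, and the terms with
    \<open>e > 0\<close> have smaller measure. So only \<open>e = 0\<close> survives in
    \<open>sumQ\<close>, with the invertible scalar \<open>?g 0\<close>.\<close>
  have "Q a b = 0" if "(if s = Pos then a else - b) < int n" for a b n
    using that
  proof (induction n arbitrary: a b)
    case 0
    then show ?case by (cases s) (auto simp: Q_def rll_int_def)
  next
    case (Suc n)
    have "(\<Sum>e\<le>nat (\<bar>a\<bar> + \<bar>b\<bar>). uscal (?g e) * Q (a - int e) (b + int e)) = uscal (?g 0) * Q a b"
    proof -
      have "uscal (?g e) * Q (a - int e) (b + int e) = 0" if "e > 0" for e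
        using Suc.IH[of "a - int e" "b + int e"] Suc.prems that by (cases s) auto
      then have "(\<Sum>e\<le>nat (\<bar>a\<bar> + \<bar>b\<bar>). uscal (?g e) * Q (a - int e) (b + int e)) =
        (\<Sum>e\<in>{0}. uscal (?g e) * Q (a - int e) (b + int e))"
        by (intro sum.mono_neutral_right) auto
      then show ?thesis by simp
    qed
    then have "uscal (?g 0) * Q a b = 0" by (simp only: sumQ)
    then show ?case by (rule uscal_eq_0_cancel[OF gseries_0[OF ne]])
  qed
  from this[of a b "Suc (nat (if s = Pos then a else - b))"] show ?thesis by (simp add: Q_def)
qed

section \<open>Removing the signs of the graded tensor product\<close>

definition tw :: "(nat \<Rightarrow> nat) \<Rightarrow> (nat \<Rightarrow> nat \<Rightarrow> 'a::ring_1) \<Rightarrow> nat \<Rightarrow> nat \<Rightarrow> 'a" where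
  "tw p A i j = (- 1) ^ ((p i + 1) * p j) * A i j"

definition tw4 :: "(nat \<Rightarrow> nat) \<Rightarrow> 'a::ring_1 tens \<Rightarrow> nat \<times> nat \<Rightarrow> nat \<times> nat \<Rightarrow> 'a" where
  "tw4 p T x y = (- 1) ^ ((p (snd x) + p (snd y)) * p (fst y) +
     (p (fst x) + p (snd x) + 1) * (p (fst y) + p (snd y))) * T (fst x) (fst y) (snd x) (snd y)"

lemma sign_mult:
  "even (a + b + c + d) \<Longrightarrow> (- 1) ^ a * ((- 1) ^ b * x * y) = ((- 1) ^ c * x) * ((- 1) ^ d * (y :: 'a::ring_1))"
  by (cases "even a"; cases "even b"; cases "even c"; cases "even d") auto

text \<open>Modulo 2, the exponent of the graded product is the coboundary of the exponent in
  \<open>tw4\<close>, which \<open>ev\<close> checks over all parities. Hence the twist turns graded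
  products into ordinary products of matrices indexed by pairs.\<close>

lemma tw4_tmult:
  "tw4 (bar M) (tmult M N A B) x y = mm ({1..M + N} \<times> {1..M + N}) (tw4 (bar M) A) (tw4 (bar M) B) x y"
proof (cases x, cases y)
  fix i k j l assume x: "x = (i, k)" and y: "y = (j, l)"
  let ?p = "bar M"
  have ev: "even ((?p k + ?p l) * ?p j + (?p i + ?p k + 1) * (?p j + ?p l) +
     ((?p i + ?p u + ?p k + ?p v) * (?p u + ?p j + ?p v + ?p l) + (?p k + ?p v) * (?p u + ?p j)) +
     ((?p k + ?p v) * ?p u + (?p i + ?p k + 1) * (?p u + ?p v)) +
     ((?p v + ?p l) * ?p j + (?p u + ?p v + 1) * (?p j + ?p l)))" for u v
    by (cases "even (?p i)"; cases "even (?p j)"; cases "even (?p k)"; cases "even (?p l)";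
        cases "even (?p u)"; cases "even (?p v)") simp_all
  show ?thesis
    unfolding x y mm_pairs tw4_def tmult_def sum_distrib_left fst_conv snd_conv
    by (intro sum.cong refl sign_mult ev)
qed

lemma sign_eq: "even (a + b) \<Longrightarrow> (- 1) ^ a * x = (- 1) ^ b * (x :: 'a::ring_1)"
  by (cases "even a"; cases "even b") auto

lemma sign_eq2: "even (a + b + c) \<Longrightarrow> (- 1) ^ a * x = (- 1) ^ b * ((- 1) ^ c * (x :: 'a::ring_1))"
  by (cases "even a"; cases "even b"; cases "even c") auto

lemma tw4_tens1: "tw4 p (tens1 A) = lift1 p (tw p A)"
proof (intro ext)
  fix x y :: "nat \<times> nat"
  let ?k = "p (snd y)" and ?i = "p (fst x)" and ?j = "p (fst y)"
  have "even ((?k + ?k) * ?j + (?i + ?k + 1) * (?j + ?k) + ?k * (?i + ?j) + (?i + 1) * ?j)"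
    by (cases "even ?i"; cases "even ?j"; cases "even ?k") simp_all
  from sign_eq2[OF this, of "A (fst x) (fst y)"] show "tw4 p (tens1 A) x y = lift1 p (tw p A) x y"
    by (simp only: tw4_def tens1_def lift1_def tw_def) simp
qed

lemma tw4_tens2: "tw4 p (tens2 A) = lift2 (tw p A)"
proof (intro ext)
  fix x y :: "nat \<times> nat"
  let ?k = "p (snd x)" and ?l = "p (snd y)" and ?j = "p (fst y)"
  have "even ((?k + ?l) * ?j + (?j + ?k + 1) * (?j + ?l) + ((?k + 1) * ?l))"
    by (cases "even ?l"; cases "even ?j"; cases "even ?k") simp_all
  from sign_eq[OF this, of "A (snd x) (snd y)"] show "tw4 p (tens2 A) x y = lift2 (tw p A) x y"
    by (simp only: tw4_def tens2_def lift2_def tw_def) simp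
qed

lemma uscal_minus: "uscal (- a) = - uscal a"
  using uscal_add[of a "- a"] by (simp add: eq_neg_iff_add_eq_0 add.commute)

lemma uscal_sign: "uscal ((- 1) ^ n * a) = (- 1) ^ n * uscal a"
  by (cases "even n") (simp_all add: uscal_minus)

lemma csc_add: "csc (a + b) = csc a + csc b"
  by (simp add: csc_def fsc_add)

lemma csc_0 [simp]: "csc 0 = 0" and csc_1 [simp]: "csc 1 = 1"
  by (simp_all add: csc_def)

lemma csc_minus: "csc (- a) = - csc a"
  using csc_add[of a "- a"] by (simp add: eq_neg_iff_add_eq_0 add.commute)

lemma csc_diff: "csc (a - b) = csc a - csc b"
  using csc_add[of a "- b"] by (simp add: csc_minus)

lemma csc_sign: "csc ((- 1) ^ n * a) = (- 1) ^ n * csc a"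
  by (cases "even n") (simp_all add: csc_minus)

lemma rmat_rz_rw:
  assumes cen: "\<And>x. z * x = x * z" "\<And>x. w * x = x * (w :: ('m::len0, 'n::len0) uqgl fps fps)"
  shows "rmat z w (csc q) (csc (inverse q)) (bar M) x y =
    z * csc (tw4 (bar M) (rz M) x y) + w * csc (tw4 (bar M) (rw M) x y)"
proof (cases x, cases y)
  fix i k j l assume x: "x = (i, k)" and y: "y = (j, l)"
  let ?p = "bar M"
  consider (diag) "i = j" "k = l" | (swap) "i \<noteq> k" "j = k" "l = i" | (off) "\<not> (i = j \<and> k = l)" "\<not> (k = j \<and> l = i)"
    by blast
  then show ?thesis
  proof cases
    case diag
    have "even ((?p k + ?p k) * ?p i + (?p i + ?p k + 1) * (?p i + ?p k) + 0)" by simp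
    from sign_eq[OF this] have t: "tw4 ?p T (i, k) (i, k) = T i i k k" for T :: "base tens"
      unfolding tw4_def by simp
    show ?thesis
      unfolding x y diag[symmetric] t
      by (auto simp: rmat_def diag_coeff_def rz_def rw_def csc_minus qsub_def bar_def power_int_minus)
  next
    case swap
    have "even ((?p k + ?p i) * ?p k + (?p i + ?p k + 1) * (?p k + ?p i) + ?p i * ?p k + ?p k)"
      by (cases "even (?p i)"; cases "even (?p k)") simp_all
    from sign_eq2[OF this] have t: "tw4 ?p T (i, k) (k, i) = (- 1) ^ (?p i * ?p k) * ((- 1) ^ ?p k * T i k k i)" for T :: "base tens"
      unfolding tw4_def fst_conv snd_conv .
    \<comment> \<open>For odd \<open>k\<close> one has \<open>qsub M k = inverse q\<close>; the sign
      left by the twist undoes this, so \<open>q - inverse q\<close> appears for every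
      parity.\<close>
    have qs: "(- 1) ^ ?p k * (qsub M k - inverse (qsub M k)) = q - inverse q"
      by (simp add: qsub_def bar_def power_int_minus)
    have r: "(- 1) ^ ?p k * rz M i k k i = (if i < k then q - inverse q else 0)"
      "(- 1) ^ ?p k * rw M i k k i = (if i < k then 0 else q - inverse q)"
      using swap qs by (auto simp: rz_def rw_def)
    have e: "(- 1) ^ n * (csc q - csc (inverse q)) * z = z * csc ((- 1) ^ n * (q - inverse q))"
      "(- 1) ^ n * (csc q - csc (inverse q)) * w = w * csc ((- 1) ^ n * (q - inverse q))" for n
      unfolding csc_sign csc_diff by (rule cen[symmetric])+
    have R: "rmat z w (csc q) (csc (inverse q)) ?p (i, k) (k, i) = swap_coeff z w (csc q) (csc (inverse q)) ?p i k"
      using \<open>i \<noteq> k\<close> by (simp add: rmat_def)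
    show ?thesis
      unfolding x y swap(2,3) t r R swap_coeff_def if_not_P[OF \<open>i \<noteq> k\<close>]
      by (cases "i < k") (simp_all only: if_True if_False e mult_zero_right csc_0 add_0 add_0_right)
  next
    case off
    have "rz M i j k l = 0" "rw M i j k l = 0" 
      unfolding rz_def rw_def if_not_P[OF off(1)] if_not_P[OF off(2)] by (rule refl)+
    moreover have "rmat z w (csc q) (csc (inverse q)) ?p (i, k) (j, l) = 0"
    proof -
      have n: "(i, k) \<noteq> (j, l)" "(j, l) \<noteq> (k, i)" using off by blast+
      show ?thesis unfolding rmat_def fst_conv snd_conv if_not_P[OF n(1)] if_not_P[OF n(2)] ..
    qed
    ultimately show ?thesis unfolding x y by (simp add: tw4_def)
  qed
qed

definition Ltw :: "sign \<Rightarrow> ('m::len0, 'n::len0) uqgl fps mat" where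
  "Ltw s = tw (bar LENGTH('m)) (Lmat s)"

lemma sign_nth: "fps_nth ((- 1) ^ n * F) r = (- 1) ^ n * fps_nth F (r :: nat)" for F :: "'a::ring_1 fps"
  by (cases "even n") simp_all

lemma Ltw_nth: "fps_nth (Ltw s i j :: ('m::len0, 'n::len0) uqgl fps) r = tw (bar LENGTH('m)) (lcoeff s r) i j"
  by (simp add: Ltw_def tw_def Lmat_def lcoeff_def sign_nth)

lemma sign_const: "(- 1) ^ n * fps_const x = fps_const ((- 1) ^ n * (x :: 'a::ring_1))"
  by (cases "even n") simp_all

lemma lift1_const: "lift1 p (\<lambda>i j. fps_const (F i j)) x y = fps_const (lift1 p F x y)"
  by (simp add: lift1_def sign_const)

lemma lift2_emb2: "lift2 (\<lambda>i j. emb2 (F i j)) x y = emb2 (lift2 F x y)"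
  by (simp add: lift2_def)

lemma lift_nth: "fps_nth (lift1 p F x y) r = lift1 p (\<lambda>i j. fps_nth (F i j) r) x y"
  "fps_nth (lift2 F x y) r = lift2 (\<lambda>i j. fps_nth (F i j) r) x y"
  by (simp_all add: lift1_def lift2_def sign_nth)

lemma rll_part_twisted:
  fixes s :: sign and x y :: "nat \<times> nat"
  defines "p \<equiv> bar LENGTH('m)" and "P \<equiv> {1..LENGTH('m) + LENGTH('n)} \<times> {1..LENGTH('m) + LENGTH('n)}"
  shows "tw4 p (rll_part T s r t :: ('m::len0, 'n::len0) uqgl tens) x y =
    fps_nth (fps_nth (mm P (\<lambda>x y. csc (tw4 p T x y)) (mm P (lift1 p (\<lambda>i j. fps_const (Ltw s i j))) (lift2 (\<lambda>i j. emb2 (Ltw s i j)))) x y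
      - mm P (mm P (lift2 (\<lambda>i j. emb2 (Ltw s i j))) (lift1 p (\<lambda>i j. fps_const (Ltw s i j)))) (\<lambda>x y. csc (tw4 p T x y)) x y) t) r"
proof -
  let ?M = "LENGTH('m)" and ?N = "LENGTH('n)"
  let ?A = "lift1 p (tw p (lcoeff s r)) :: _ \<Rightarrow> _ \<Rightarrow> ('m, 'n) uqgl" and ?B = "lift2 (tw p (lcoeff s t)) :: _ \<Rightarrow> _ \<Rightarrow> ('m, 'n) uqgl"
  let ?T = "\<lambda>x y. uscal (tw4 p T x y)"
  have tT: "tw4 p (\<lambda>i j k l. uscal (T i j k l)) = ?T"
    by (intro ext) (simp add: tw4_def uscal_sign)
  have tt: "tw4 p (tmult ?M ?N A B) = mm P (tw4 p A) (tw4 p B)" for A B :: "('m, 'n) uqgl tens"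
    unfolding p_def P_def by (intro ext tw4_tmult)
  have d: "tw4 p (rll_part T s r t :: ('m, 'n) uqgl tens) x y =
     tw4 p (tmult ?M ?N (tmult ?M ?N (\<lambda>i j k l. uscal (T i j k l)) (tens1 (lcoeff s r))) (tens2 (lcoeff s t))) x y
     - tw4 p (tmult ?M ?N (tmult ?M ?N (tens2 (lcoeff s t)) (tens1 (lcoeff s r))) (\<lambda>i j k l. uscal (T i j k l))) x y"
    by (simp add: tw4_def rll_part_def right_diff_distrib)
  have A: "fps_nth (lift1 p (Ltw s) x y) r = ?A x y" "fps_nth (lift2 (Ltw s) x y) t = ?B x y" for x y
    by (simp_all add: lift_nth Ltw_nth p_def)
  have "tw4 p (rll_part T s r t :: ('m, 'n) uqgl tens) x y = mm P ?T (mm P ?A ?B) x y - mm P (mm P ?B ?A) ?T x y"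
    unfolding d tt tT tw4_tens1 tw4_tens2 by (simp only: mm_assoc)
  also have "mm P ?T (mm P ?A ?B) x y = fps_nth (fps_nth (mm P (\<lambda>x y. csc (tw4 p T x y))
     (mm P (lift1 p (\<lambda>i j. fps_const (Ltw s i j))) (lift2 (\<lambda>i j. emb2 (Ltw s i j)))) x y) t) r"
    by (simp add: mm_def fps_sum_nth csc_def fsc_def lift1_const lift2_emb2 A)
  also have "mm P (mm P ?B ?A) ?T x y = fps_nth (fps_nth (mm P (mm P (lift2 (\<lambda>i j. emb2 (Ltw s i j)))
     (lift1 p (\<lambda>i j. fps_const (Ltw s i j)))) (\<lambda>x y. csc (tw4 p T x y)) x y) t) r"
    by (simp add: mm_def fps_sum_nth csc_def fsc_def lift1_const lift2_emb2 A)
  finally show ?thesis by simp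
qed

theorem rtt_Ltw:
  assumes ne: "LENGTH('m) \<noteq> LENGTH('n)"
  shows "rtt (zvar s) (wvar s) (csc q) (csc (inverse q)) (bar LENGTH('m)) {1..LENGTH('m) + LENGTH('n)}
    (\<lambda>i j. fps_const (Ltw s i j :: ('m::len0, 'n::len0) uqgl fps)) (\<lambda>i j. emb2 (Ltw s i j))"
proof -
  define K where "K = {1..LENGTH('m) + LENGTH('n)}"
  define P where "P = K \<times> K"
  define p where "p = bar LENGTH('m)"
  let ?A = "lift1 p (\<lambda>i j. fps_const (Ltw s i j :: ('m, 'n) uqgl fps))" and ?B = "lift2 (\<lambda>i j. emb2 (Ltw s i j :: ('m, 'n) uqgl fps))"
  let ?R = "rmat (zvar s) (wvar s) (csc q) (csc (inverse q)) p :: nat \<times> nat \<Rightarrow> _ \<Rightarrow> ('m, 'n) uqgl fps fps"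
  define C where "C T x y = mm P (\<lambda>x y. csc (tw4 p T x y)) (mm P ?A ?B) x y - mm P (mm P ?B ?A) (\<lambda>x y. csc (tw4 p T x y)) x y"
    for T x y
  have nthC: "fps_nth (fps_nth (C T x y) t) r = tw4 p (rll_part T s r t) x y" for T x y r t
    unfolding C_def p_def P_def K_def by (rule rll_part_twisted[symmetric])
  have z: "mm P ?R X x y = zvar s * mm P (\<lambda>x y. csc (tw4 p (rz LENGTH('m)) x y)) X x y +
      wvar s * mm P (\<lambda>x y. csc (tw4 p (rw LENGTH('m)) x y)) X x y" for X x y
    unfolding mm_def p_def rmat_rz_rw[OF zvar_central wvar_central]
    by (simp only: distrib_right sum.distrib sum_distrib_left mult.assoc)
  have z': "mm P X ?R x y = zvar s * mm P X (\<lambda>x y. csc (tw4 p (rz LENGTH('m)) x y)) x y +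
      wvar s * mm P X (\<lambda>x y. csc (tw4 p (rw LENGTH('m)) x y)) x y" for X x y
  proof -
    have c: "a * (zvar s * b) = zvar s * (a * b)" "a * (wvar s * b) = wvar s * (a * b)" for a b :: "('m, 'n) uqgl fps fps"
      by (metis mult.assoc zvar_central) (metis mult.assoc wvar_central)
    show ?thesis
      unfolding mm_def p_def rmat_rz_rw[OF zvar_central wvar_central]
      by (simp only: distrib_left sum.distrib sum_distrib_left c)
  qed
  have main: "zvar s * C (rz LENGTH('m)) (i, k) (j, l) + wvar s * C (rw LENGTH('m)) (i, k) (j, l) = 0"
    if "i \<in> K" "j \<in> K" "k \<in> K" "l \<in> K" for i j k l
  proof (rule fps_ext, rule fps_ext)
    fix t r
    let ?e = "(- 1) ^ ((p k + p l) * p j + (p i + p k + 1) * (p j + p l)) :: ('m, 'n) uqgl"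
    have Q: "?e * rll_int (rz LENGTH('m)) s a b i j k l + ?e * rll_int (rw LENGTH('m)) s (a - 1) (b + 1) i j k l = 0" for a b
      using rll_polynomial[OF ne, where s = s and a = a and b = b, of i j k l] that
      unfolding K_def by (simp flip: distrib_left)
    show "fps_nth (fps_nth (zvar s * C (rz LENGTH('m)) (i, k) (j, l) + wvar s * C (rw LENGTH('m)) (i, k) (j, l)) t) r =
      fps_nth (fps_nth 0 t) r"
    proof (cases s)
      case Pos
      \<comment> \<open>For \<open>Pos\<close>, multiplication by \<open>zvar = v\<close> and
        \<open>wvar = u\<close> reads off the \<open>rz\<close> part at \<open>(r, t - 1)\<close>
        and the \<open>rw\<close> part at \<open>(r - 1, t)\<close>. For \<open>Neg\<close> the
        positions are exchanged and the exponents negated. The coefficients \<open>t = 0\<close> or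
        \<open>r = 0\<close> match the zero branch of \<open>rll_int\<close>.\<close>
      show ?thesis using Q[of "int r" "int t - 1"] Pos
        by (cases t; cases r)
          (simp_all add: zvar_def wvar_def uvar_def vvar_def nthC tw4_def rll_int_def nat_add_distrib)
    next
      case Neg
      show ?thesis using Q[of "1 - int r" "- int t"] Neg
        by (cases t; cases r)
          (simp_all add: zvar_def wvar_def uvar_def vvar_def nthC tw4_def rll_int_def nat_add_distrib)
    qed
  qed
  have "eq_on P (mm P ?R (mm P ?A ?B)) (mm P (mm P ?B ?A) ?R)"
    unfolding eq_on_def
  proof (intro ballI)
    fix x y assume "x \<in> P" "y \<in> P"
    then obtain i k j l where "x = (i, k)" "y = (j, l)" "i \<in> K" "j \<in> K" "k \<in> K" "l \<in> K"
      unfolding P_def by blast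
    then show "mm P ?R (mm P ?A ?B) x y = mm P (mm P ?B ?A) ?R x y"
      using main[of i j k l] unfolding z z' C_def by (simp add: algebra_simps)
  qed
  then show ?thesis
    unfolding p_def[symmetric] K_def[symmetric]
    by (subst rtt_matrix) (simp_all add: K_def P_def)
qed

section \<open>Inverses of blocks\<close>

lemma fps_unit:
  fixes F :: "'a::ring_1 fps"
  assumes "y * fps_nth F 0 = 1" "fps_nth F 0 * y = 1"
  shows "\<exists>G. F * G = 1 \<and> G * F = 1"
  using fps_right_inverse[OF assms(2)] fps_left_inverse'[OF assms] by blast

text \<open>Indices are adjoined in increasing order. Triangularity of the constant terms keeps the
  constant term of the Schur complement at the new index equal to the diagonal one, a unit; a series
  with unit constant term is invertible, and \<open>inv_on_extend\<close> applies.\<close>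

lemma inv_on_triangular:
  fixes A :: "nat \<Rightarrow> nat \<Rightarrow> 'a::ring_1 fps"
  assumes "finite K"
    and diag: "\<And>i. i \<in> K \<Longrightarrow> \<exists>y. y * fps_nth (A i i) 0 = 1 \<and> fps_nth (A i i) 0 * y = 1"
    and tri: "(\<forall>i\<in>K. \<forall>j\<in>K. i < j \<longrightarrow> fps_nth (A j i) 0 = 0) \<or> (\<forall>i\<in>K. \<forall>j\<in>K. i < j \<longrightarrow> fps_nth (A i j) 0 = 0)"
  shows "\<exists>N. inv_on K A N"
  using assms
proof (induction K rule: finite_linorder_max_induct)
  case empty
  then show ?case by (auto simp: inv_on_def eq_on_def)
next
  case (insert b K)
  have "\<exists>N. inv_on K A N" by (rule insert.IH) (use insert.prems in blast)+
  then obtain N where N: "inv_on K A N" ..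
  let ?S = "schur K A N"
  have "fps_nth (mm K A (mm K N A) b b) 0 = (\<Sum>u\<in>K. \<Sum>v\<in>K. fps_nth (A b u) 0 * (fps_nth (N u v) 0 * fps_nth (A v b) 0))"
    by (simp add: mm_def fps_sum_nth sum_distrib_left)
  \<comment> \<open>All \<open>u\<close> and \<open>v\<close> are below \<open>b\<close>, so either
    every \<open>A b u\<close> or every \<open>A v b\<close> has zero constant term.\<close>
  also have "\<dots> = 0"
    using insert.prems(2) insert.hyps(2) by (intro sum.neutral ballI) auto
  finally have "fps_nth (?S b b) 0 = fps_nth (A b b) 0" by (simp add: schur_def)
  then obtain G where G: "?S b b * G = 1" "G * ?S b b = 1"
    using insert.prems(1)[of b] fps_unit[of _ "?S b b"] by auto
  have "inv_on {b} ?S (\<lambda>_ _. G)"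
    using G by (auto simp: inv_on_def eq_on_def mm_def idm_def)
  then have "\<exists>B. inv_on (K \<union> {b}) A B"
    by (intro inv_on_extend[OF _ _ _ N]) (use insert.hyps in auto)
  then show ?case by simp
qed

lemma lcoeff_tri:
  assumes "i \<in> {1..LENGTH('m) + LENGTH('n)}" "j \<in> {1..LENGTH('m) + LENGTH('n)}" "i < j"
  shows "lcoeff Pos 0 j i = (0 :: ('m::len0, 'n::len0) uqgl)" "lcoeff Neg 0 i j = (0 :: ('m::len0, 'n::len0) uqgl)"
  unfolding lcoeff_def ugen.abs_eq
  by (rule abs_uqgl_relator, use assms in \<open>auto intro: relators.tri_pos relators.tri_neg\<close>)+

lemma lcoeff_diag:
  assumes "i \<in> {1..LENGTH('m) + LENGTH('n)}"
  shows "lcoeff Neg 0 i i * lcoeff Pos 0 i i = (1 :: ('m::len0, 'n::len0) uqgl)"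
    "lcoeff Pos 0 i i * lcoeff Neg 0 i i = (1 :: ('m::len0, 'n::len0) uqgl)"
proof -
  have "abs_uqgl (fgen (LGen Neg i i 0) * fgen (LGen Pos i i 0) - 1) = (0 :: ('m, 'n) uqgl)"
    "abs_uqgl (fgen (LGen Pos i i 0) * fgen (LGen Neg i i 0) - 1) = (0 :: ('m, 'n) uqgl)"
    by (rule abs_uqgl_relator, use assms in \<open>auto intro: relators.diag1 relators.diag2\<close>)+
  then show "lcoeff Neg 0 i i * lcoeff Pos 0 i i = (1 :: ('m::len0, 'n::len0) uqgl)"
    "lcoeff Pos 0 i i * lcoeff Neg 0 i i = (1 :: ('m::len0, 'n::len0) uqgl)"
    by (simp_all add: lcoeff_def ugen.abs_eq abs_uqgl_hom)
qed

lemma Ltw_invertible: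
  assumes "I \<subseteq> {1..LENGTH('m) + LENGTH('n)}"
  shows "\<exists>N. inv_on I (Ltw s :: ('m::len0, 'n::len0) uqgl fps mat) N"
proof (rule inv_on_triangular)
  show "finite I" using assms by (rule finite_subset) simp
  show "\<exists>y. y * fps_nth (Ltw s i i :: ('m, 'n) uqgl fps) 0 = 1 \<and> fps_nth (Ltw s i i) 0 * y = 1" if "i \<in> I" for i
  proof -
    have "(- 1) ^ ((bar LENGTH('m) i + 1) * bar LENGTH('m) i) = (1 :: ('m, 'n) uqgl)"
      by (simp add: bar_def)
    then have "fps_nth (Ltw s i i :: ('m, 'n) uqgl fps) 0 = lcoeff s 0 i i"
      unfolding Ltw_nth tw_def by simp
    then show ?thesis using lcoeff_diag[where 'm = 'm and 'n = 'n, of i] that assms by (cases s) (auto intro!: exI)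
  qed
  show "(\<forall>i\<in>I. \<forall>j\<in>I. i < j \<longrightarrow> fps_nth (Ltw s j i :: ('m, 'n) uqgl fps) 0 = 0) \<or>
    (\<forall>i\<in>I. \<forall>j\<in>I. i < j \<longrightarrow> fps_nth (Ltw s i j :: ('m, 'n) uqgl fps) 0 = 0)"
  proof -
    have "lcoeff Pos 0 j i = (0 :: ('m, 'n) uqgl)" "lcoeff Neg 0 i j = (0 :: ('m, 'n) uqgl)"
      if "i \<in> I" "j \<in> I" "i < j" for i j
      using lcoeff_tri[where 'm = 'm and 'n = 'n, OF subsetD[OF assms that(1)] subsetD[OF assms that(2)] that(3)] .
    then show ?thesis by (cases s) (simp_all add: Ltw_nth tw_def)
  qed
qed

lemma mm_mshift: "mm K (mshift s c A) (mshift s c B) i j = shift s c (mm K A B i j)"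
proof -
  interpret scalar_ext fsc "shift s c" by (rule scalar_ext_shift)
  show ?thesis by (simp add: mm_def mshift_def theta_sum theta_mult)
qed

lemma inv_on_mshift: "inv_on K A B \<Longrightarrow> inv_on K (mshift s c A) (mshift s c B)"
proof -
  interpret scalar_ext fsc "shift s c" by (rule scalar_ext_shift)
  assume "inv_on K A B"
  then show ?thesis
    unfolding inv_on_def eq_on_def mm_mshift by (auto simp: idm_def)
qed

lemma mshift_mshift: "mshift s a (mshift s b A) = mshift s (a + b) A"
  by (intro ext) (simp add: mshift_def shift_shift)

lemma mshift_0 [simp]: "mshift s 0 A = A"
  by (intro ext) (simp add: mshift_def)

lemma mshift_tw: "mshift s c (tw p A) = tw p (mshift s c A)"
proof (intro ext)
  fix i j
  have "shift s c (- F) = - shift s c F" for F :: "('a, 'b) uqgl fps"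
    by (rule fps_ext) simp
  then show "mshift s c (tw p A) i j = tw p (mshift s c A) i j"
    by (simp add: mshift_def tw_def minus_one_power_iff)
qed

lemma rmatrix_mshift:
  assumes "rmatrix s Y K"
  shows "rmatrix s (mshift s c Y) K"
  unfolding rmatrix_def
proof (intro conjI allI impI)
  interpret scalar_ext fsc "shift s (- 2)" by (rule scalar_ext_shift)
  interpret c: scalar_ext fsc "shift s c" by (rule scalar_ext_shift)
  have cc: "shift s c (shift s (- 2) F) = shift s (- 2) (shift s c F)" for F :: "('a, 'b) uqgl fps"
    by (simp add: shift_shift add.commute)
  show "fused (asc q) (mshift s c Y) K"
    unfolding fused_def
  proof (intro ballI)
    fix i j k l assume K: "i \<in> K" "j \<in> K" "k \<in> K" "l \<in> K"
    have fY: "fused (asc q) Y K" using assms by (simp add: rmatrix_def)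
    have "shift s c (if i = k then 0 else shift s (- 2) (Y i j) * Y k l + scl (asc q i k / asc q k i) (shift s (- 2) (Y k j) * Y i l)) =
      shift s c (if j = l then 0 else Y k l * shift s (- 2) (Y i j) + scl (asc q l j / asc q j l) (Y k j * shift s (- 2) (Y i l)))"
      by (rule arg_cong[OF fusedD[OF fY K]])
    then show "(if i = k then 0 else shift s (- 2) (mshift s c Y i j) * mshift s c Y k l +
        scl (asc q i k / asc q k i) (shift s (- 2) (mshift s c Y k j) * mshift s c Y i l)) =
      (if j = l then 0 else mshift s c Y k l * shift s (- 2) (mshift s c Y i j) +
        scl (asc q l j / asc q j l) (mshift s c Y k j * shift s (- 2) (mshift s c Y i l)))"
      by (simp add: if_distrib[of "shift s c"] mshift_def scl_def c.theta_add c.theta_mult cc cong: if_cong)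
  qed
  fix I N i j k l assume I: "I \<subseteq> K" "inv_on I (mshift s c Y) N" "i \<in> I" "j \<in> I" "k \<in> I" "l \<in> I" "i \<noteq> l" "j \<noteq> k"
  have "inv_on I Y (mshift s (- c) N)"
    using inv_on_mshift[OF I(2), of s "- c"] by (simp add: mshift_mshift)
  then have "ccomm (Y i j) (mshift s (- c) N k l)"
    using assms I unfolding rmatrix_def by blast
  then have "ccomm (shift s c (mshift s (- c) N k l)) (shift s c (Y i j))"
    by (intro ccomm_shift ccomm_sym[OF ccomm_shift])
  then show "ccomm (mshift s c Y i j) (N k l)"
    by (auto simp: mshift_def shift_shift intro: ccomm_sym)
qed

section \<open>Super inverses as ordinary inverses\<close>

lemma tw_tw: "tw p (tw p A) = A"
  by (intro ext) (simp add: tw_def minus_one_power_iff)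

lemma tw_cong_parity: "p i = p j \<Longrightarrow> tw p A i j = A i j"
  by (simp add: tw_def minus_one_power_iff)

lemma tw_smult: "tw p (smult p k A B) i j = mm {1..k} (tw p A) (tw p B) i j"
proof -
  have ev: "even ((p i + 1) * p j + (p i + p u) * (p u + p j) + (p i + 1) * p u + (p u + 1) * p j)" for u
    by (cases "even (p i)"; cases "even (p j)"; cases "even (p u)") simp_all
  show ?thesis
    unfolding tw_def smult_def mm_def sum_distrib_left by (intro sum.cong refl sign_mult ev)
qed

lemma sinverse_of_iff: "sinverse_of p k A B \<longleftrightarrow> inv_on {1..k} (tw p A) (tw p B)"
proof -
  have tw_eq: "tw p C i j = (if i = j then 1 else 0) \<longleftrightarrow> C i j = (if i = j then 1 else 0)" for C :: "'a mat" and i j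
    by (cases "i = j") (auto simp: tw_def minus_one_power_iff)
  show ?thesis
    unfolding sinverse_of_def inv_on_def eq_on_def tw_smult[symmetric] idm_def tw_eq by blast
qed

text \<open>The twist is an involution that fixes the identity matrix, so it carries ordinary
  inverses to super inverses. Uniqueness on the block together with the zero entries outside it pins
  down the description in \<open>sinv\<close>.\<close>

lemma sinv_eq:
  assumes "inv_on {1..k} (tw p A) B" "i \<in> {1..k}" "j \<in> {1..k}"
  shows "sinv p k A i j = tw p B i j"
proof -
  define C where "C i j = (if i \<in> {1..k} \<and> j \<in> {1..k} then tw p B i j else 0)" for i j
  have twC: "eq_on {1..k} (tw p C) B"
    by (auto simp: eq_on_def C_def tw_def minus_one_power_iff)
  have C: "sinverse_of p k A C"
    unfolding sinverse_of_iff by (rule inv_on_cong[OF assms(1) eq_on_refl eq_on_sym[OF twC]])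
  have DC: "D = C" if D: "sinverse_of p k A D" and D0: "\<forall>i j. i \<notin> {1..k} \<or> j \<notin> {1..k} \<longrightarrow> D i j = 0" for D
  proof (intro ext)
    fix i j
    have "eq_on {1..k} (tw p D) B"
      by (rule inv_on_unique[OF _ D[unfolded sinverse_of_iff] assms(1)]) simp
    then have "tw p (tw p D) i j = tw p B i j" if "i \<in> {1..k}" "j \<in> {1..k}"
      using that unfolding eq_on_def by (subst (1 2) tw_def) simp
    then show "D i j = C i j" using D0 by (cases "i \<in> {1..k} \<and> j \<in> {1..k}") (auto simp: C_def tw_tw)
  qed
  have "sinv p k A = C"
    unfolding sinv_def
  proof (rule the_equality)
    show "sinverse_of p k A C \<and> (\<forall>i j. i \<notin> {1..k} \<or> j \<notin> {1..k} \<longrightarrow> C i j = 0)"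
      using C unfolding C_def by simp
  qed (use DC in blast)
  then show ?thesis using assms by (simp add: C_def)
qed

lemma inv_on_relabel:
  assumes f: "inj_on f K" and A: "inv_on (f ` K) A B"
  shows "inv_on K (\<lambda>a b. A (f a) (f b)) (\<lambda>a b. B (f a) (f b))"
proof -
  have m: "mm K (\<lambda>a b. A (f a) (f b)) (\<lambda>a b. B (f a) (f b)) i j = mm (f ` K) A B (f i) (f j)" for A B i j
    using f by (simp add: mm_def sum.reindex)
  show ?thesis
    unfolding inv_on_def eq_on_def m
    using inv_onD[OF A] f by (auto simp: idm_def inj_on_eq_iff)
qed

lemma sinv_relabel:
  assumes f: "inj_on f {1..k}" and p: "\<And>a. a \<in> {1..k} \<Longrightarrow> p' a = p (f a)"
    and A: "\<And>a b. a \<in> {1..k} \<Longrightarrow> b \<in> {1..k} \<Longrightarrow> A' a b = A (f a) (f b)"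
    and B: "inv_on (f ` {1..k}) (tw p A) B" and ab: "a \<in> {1..k}" "b \<in> {1..k}"
  shows "sinv p' k A' a b = tw p B (f a) (f b)"
proof -
  have "inv_on {1..k} (tw p' A') (\<lambda>a b. B (f a) (f b))"
    by (rule inv_on_cong[OF inv_on_relabel[OF f B] _ eq_on_refl]) (auto simp: eq_on_def tw_def p A)
  from sinv_eq[OF this ab] show ?thesis using ab by (simp add: tw_def p)
qed

section \<open>Increasing enumerations\<close>

lemma elt_bij: "finite S \<Longrightarrow> bij_betw (elt S) {1..card S} S"
proof -
  assume fin: "finite S"
  let ?l = "sorted_list_of_set S"
  have "bij_betw (\<lambda>i. ?l ! i) {..<length ?l} (set ?l)" by (rule bij_betw_nth) auto
  moreover have "bij_betw (\<lambda>a. a - 1) {1..card S} {..<length ?l}"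
    using fin by (intro bij_betw_byWitness[where f' = Suc]) auto
  ultimately have "bij_betw ((\<lambda>i. ?l ! i) \<circ> (\<lambda>a. a - 1)) {1..card S} (set ?l)"
    by (intro bij_betw_trans)
  then show ?thesis using fin by (simp add: elt_def[abs_def] o_def)
qed

lemma elt_less:
  assumes "finite S" "1 \<le> a" "a < b" "b \<le> card S"
  shows "elt S a < elt S b"
proof -
  have "sorted_wrt (<) (sorted_list_of_set S)" using assms by simp
  from sorted_wrt_nth_less[OF this, of "a - 1" "b - 1"] assms show ?thesis
    by (auto simp: elt_def)
qed

lemma elt_image: "finite S \<Longrightarrow> elt S ` {1..card S} = S"
  using elt_bij by (simp add: bij_betw_def)

lemma elt_mem: "finite S \<Longrightarrow> a \<in> {1..card S} \<Longrightarrow> elt S a \<in> S"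
  using elt_image by blast

lemma elt_append:
  assumes fin: "finite S" "finite T" and ST: "\<And>x y. x \<in> S \<Longrightarrow> y \<in> T \<Longrightarrow> x < y"
  shows "a \<in> {1..card S} \<Longrightarrow> elt (S \<union> T) a = elt S a"
    and "a \<in> {1..card T} \<Longrightarrow> elt (S \<union> T) (card S + a) = elt T a"
proof -
  have "sorted_list_of_set (S \<union> T) = sorted_list_of_set S @ sorted_list_of_set T"
  proof (rule strict_sorted_equal)
    show "sorted_wrt (<) (sorted_list_of_set S @ sorted_list_of_set T)"
      using fin ST by (auto simp: sorted_wrt_append)
  qed (use fin in auto)
  then show "a \<in> {1..card S} \<Longrightarrow> elt (S \<union> T) a = elt S a"
    and "a \<in> {1..card T} \<Longrightarrow> elt (S \<union> T) (card S + a) = elt T a"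
    using fin by (auto simp: elt_def nth_append)
qed

lemma elt_interval: "a \<in> {1..n} \<Longrightarrow> elt {1..n} a = a"
proof -
  assume "a \<in> {1..n}"
  moreover have "sorted_list_of_set {1..n} = [1..<n + 1]"
    by (simp add: atLeastLessThanSuc_atLeastAtMost[symmetric] del: upt_Suc)
  ultimately show ?thesis by (auto simp: elt_def simp del: upt_Suc)
qed

section \<open>Berezinians as products of determinants\<close>

lemma inj_on_of_less_iff:
  fixes f :: "'x::linorder \<Rightarrow> 'y::linorder"
  assumes "(\<forall>a\<in>A. \<forall>b\<in>A. f a < f b \<longleftrightarrow> a < b) \<or> (\<forall>a\<in>A. \<forall>b\<in>A. f a < f b \<longleftrightarrow> b < a)"
  shows "inj_on f A"
proof (rule inj_onI)
  fix a b assume "a \<in> A" "b \<in> A" "f a = f b"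
  then show "a = b" using assms by (cases a b rule: linorder_cases) (metis less_irrefl)+
qed

context scalar_ext
begin

lemma theta_power_rdet: "(\<theta> ^^ n) (rdet e X rs) = rdet e (\<lambda>i j. (\<theta> ^^ n) (X i j)) rs"
proof -
  have "(\<theta> ^^ n) (wedge e X rs S) = wedge e (\<lambda>i j. (\<theta> ^^ n) (X i j)) rs S" for S
    by (induction rs arbitrary: S) (simp_all add: theta_power_sum scl_simps theta_power_mult flip: funpow_swap1)
  then show ?thesis by (simp add: rdet_def scl_simps)
qed

lemma relabel_inc:
  assumes f: "\<forall>a\<in>{1..n}. \<forall>b\<in>{1..n}. f a < f b \<longleftrightarrow> a < b"
  shows "rdet (asc t) (\<lambda>k l. X (f k) (f l)) [1..<n + 1] = rdet (asc t) X (map f [1..<n + 1])"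
    and "cdet (\<lambda>s c. asc t c s) (\<lambda>k l. X (f k) (f l)) (rev [1..<n + 1]) =
      cdet (\<lambda>s c. asc t c s) X (map f (rev [1..<n + 1]))"
proof -
  have inj: "inj_on f (set [1..<n + 1])" "inj_on f (set (rev [1..<n + 1]))"
    by (rule inj_on_of_less_iff, use f in auto)+
  show "rdet (asc t) (\<lambda>k l. X (f k) (f l)) [1..<n + 1] = rdet (asc t) X (map f [1..<n + 1])"
    unfolding rdet_map[OF inj(1)] by (rule rdet_cong) (use f in \<open>auto simp: asc_def\<close>)
  show "cdet (\<lambda>s c. asc t c s) (\<lambda>k l. X (f k) (f l)) (rev [1..<n + 1]) =
      cdet (\<lambda>s c. asc t c s) X (map f (rev [1..<n + 1]))"
    unfolding cdet_map[OF inj(2)] by (rule cdet_cong) (use f in \<open>auto simp: asc_def\<close>)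
qed

text \<open>Reversing the order of the indices inverts the parameter, up to a common factor.\<close>

lemma relabel_dec:
  assumes f: "\<forall>a\<in>{1..n}. \<forall>b\<in>{1..n}. f a < f b \<longleftrightarrow> b < a" and t: "t \<noteq> 0"
  shows "rdet (asc (inverse t)) (\<lambda>k l. X (f k) (f l)) [1..<n + 1] = rdet (asc t) X (map f [1..<n + 1])"
    and "cdet (\<lambda>s c. asc (inverse t) c s) (\<lambda>k l. X (f k) (f l)) (rev [1..<n + 1]) =
      cdet (\<lambda>s c. asc t c s) X (map f (rev [1..<n + 1]))"
proof -
  have inj: "inj_on f (set [1..<n + 1])" "inj_on f (set (rev [1..<n + 1]))"
    by (rule inj_on_of_less_iff, use f in auto)+
  show "rdet (asc (inverse t)) (\<lambda>k l. X (f k) (f l)) [1..<n + 1] = rdet (asc t) X (map f [1..<n + 1])"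
    unfolding rdet_map[OF inj(1)]
    by (rule rdet_scaled[where g = "- t"]) (use f t in \<open>auto simp: asc_def\<close>)
  show "cdet (\<lambda>s c. asc (inverse t) c s) (\<lambda>k l. X (f k) (f l)) (rev [1..<n + 1]) =
      cdet (\<lambda>s c. asc t c s) X (map f (rev [1..<n + 1]))"
    unfolding cdet_map[OF inj(2)]
    by (rule cdet_scaled[where g = "- t"]) (use f t in \<open>auto simp: asc_def\<close>)
qed

end

abbreviation (input) RD :: "sign \<Rightarrow> ('m::len0, 'n::len0) uqgl fps mat \<Rightarrow> nat list \<Rightarrow> ('m, 'n) uqgl fps" where
  "RD s \<equiv> scalar_ext.rdet fsc (shift s (- 2)) (asc q)"

abbreviation (input) CD :: "sign \<Rightarrow> ('m::len0, 'n::len0) uqgl fps mat \<Rightarrow> nat list \<Rightarrow> ('m, 'n) uqgl fps" where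
  "CD s \<equiv> scalar_ext.cdet fsc (shift s (- 2)) (\<lambda>x y. asc q y x)"

text \<open>Both sums are based at \<open>z q^(2m-2)\<close>: in the column product the argument
  rises to this value at the rightmost factor, and in the row product it falls from it starting at
  the leftmost. These are the shift patterns of \<open>cdet\<close> and \<open>rdet\<close> with
  \<open>\<theta>\<close> the shift by \<open>q^{-2}\<close>.\<close>

lemma berezinian_eq:
  fixes A :: "('m::len0, 'n::len0) uqgl fps mat"
  assumes W: "\<And>c k l. k \<in> {1..n} \<Longrightarrow> l \<in> {1..n} \<Longrightarrow>
    sinv p (m + n) (mshift s c A) (m + k) (m + l) = shift s c (W (m + k) (m + l))"
  shows "berezinian t s p m n A =
    scalar_ext.cdet fsc (shift s (- 2)) (\<lambda>x y. asc t y x) (mshift s (2 * int m - 2) A) (rev [1..<m + 1]) *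
    scalar_ext.rdet fsc (shift s (- 2)) (asc t) (\<lambda>k l. shift s (2 * int m - 2) (W (m + k) (m + l))) [1..<n + 1]"
proof -
  interpret scalar_ext fsc "shift s (- 2) :: ('m, 'n) uqgl fps \<Rightarrow> _" by (rule scalar_ext_shift)
  have 1: "(\<Sum>\<sigma> | \<sigma> permutes {1..m}. fps_const (uscal ((- t) powi (- int (inversions m \<sigma>)))) *
        prod_list (map (\<lambda>j. mshift s (2 * int j - 2) A (\<sigma> j) j) [1..<m + 1])) =
     cdet (\<lambda>x y. asc t y x) (mshift s (2 * int m - 2) A) (rev [1..<m + 1])"
    unfolding fsc_def[symmetric]
  proof (rule cdet_asc)
    fix k l assume "k \<in> {1..m}"
    then have "int (m - k) * - 2 + (2 * int m - 2) = 2 * int k - 2" by (simp add: of_nat_diff)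
    then show "mshift s (2 * int k - 2) A l k = (shift s (- 2) ^^ (m - k)) (mshift s (2 * int m - 2) A l k)"
      by (simp only: shift_power mshift_def shift_shift)
  qed
  let ?X = "\<lambda>k l. shift s (2 * int m - 2) (W (m + k) (m + l))"
  \<comment> \<open>\<open>rdet_asc\<close> asks for entries at every \<open>l\<close>, while
    \<open>W\<close> describes the inverse only on \<open>{1..n}\<close>; outside, \<open>?B\<close>
    is padded with the required value. Permutations never reach the padding.\<close>
  let ?B = "\<lambda>k l. if l \<in> {1..n} then sinv p (m + n) (mshift s (2 * int m - 2 * int k) A) (m + k) (m + l)
    else (shift s (- 2) ^^ (k - 1)) (?X k l)"
  have "(\<Sum>\<tau> | \<tau> permutes {1..n}. fsc ((- t) powi (- int (inversions n \<tau>))) *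
        prod_list (map (\<lambda>k. sinv p (m + n) (mshift s (2 * int m - 2 * int k) A) (m + k) (m + \<tau> k)) [1..<n + 1])) =
     (\<Sum>\<tau> | \<tau> permutes {1..n}. fsc ((- t) powi (- int (inversions n \<tau>))) *
        prod_list (map (\<lambda>k. ?B k (\<tau> k)) [1..<n + 1]))"
  proof (rule sum.cong[OF refl], clarify)
    fix \<tau> assume "\<tau> permutes {1..n}"
    then have t: "\<tau> k \<in> {1..n}" if "k \<in> {1..n}" for k using that by (simp only: permutes_in_image)
    have "map (\<lambda>k. sinv p (m + n) (mshift s (2 * int m - 2 * int k) A) (m + k) (m + \<tau> k)) [1..<n + 1] =
      map (\<lambda>k. ?B k (\<tau> k)) [1..<n + 1]"
    proof (rule map_cong[OF refl])
      fix k assume "k \<in> set [1..<n + 1]"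
      then have "\<tau> k \<in> {1..n}" by (intro t) auto
      then show "sinv p (m + n) (mshift s (2 * int m - 2 * int k) A) (m + k) (m + \<tau> k) = ?B k (\<tau> k)"
        by (simp only: if_True)
    qed
    then show "fsc ((- t) powi (- int (inversions n \<tau>))) *
        prod_list (map (\<lambda>k. sinv p (m + n) (mshift s (2 * int m - 2 * int k) A) (m + k) (m + \<tau> k)) [1..<n + 1]) =
      fsc ((- t) powi (- int (inversions n \<tau>))) * prod_list (map (\<lambda>k. ?B k (\<tau> k)) [1..<n + 1])"
      by (simp only:)
  qed
  also have "\<dots> = rdet (asc t) ?X [1..<n + 1]"
  proof (rule rdet_asc)
    fix k l assume k: "k \<in> {1..n}"
    then have "int (k - 1) * - 2 + (2 * int m - 2) = 2 * int m - 2 * int k" by (simp add: of_nat_diff)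
    then have "(shift s (- 2) ^^ (k - 1)) (?X k l) = shift s (2 * int m - 2 * int k) (W (m + k) (m + l))"
      by (simp only: shift_power shift_shift)
    then show "?B k l = (shift s (- 2) ^^ (k - 1)) (?X k l)"
      using W[OF k, of l] by (cases "l \<in> {1..n}") (simp_all only: if_True if_False)
  qed
  finally show ?thesis
    unfolding berezinian_def 1 by (simp only: fsc_def)
qed

lemma ccomm_shift2: "ccomm F G \<Longrightarrow> ccomm (shift s a F) (shift s b G)"
  by (meson ccomm_shift ccomm_sym)

lemma RD_commute:
  fixes S T :: "('m::len0, 'n::len0) uqgl fps mat"
  assumes "\<And>a b i j. a \<in> set as \<Longrightarrow> b \<in> set as \<Longrightarrow> i \<in> set bs \<Longrightarrow> j \<in> set bs \<Longrightarrow> ccomm (S a b) (T i j)"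
  shows "RD s S as * RD s T bs = RD s T bs * RD s S as"
proof -
  interpret scalar_ext fsc "shift s (- 2) :: ('m, 'n) uqgl fps \<Rightarrow> _" by (rule scalar_ext_shift)
  have "RD s T bs * (shift s (- 2) ^^ m) (S a b) = (shift s (- 2) ^^ m) (S a b) * RD s T bs"
    if "a \<in> set as" "b \<in> set as" for a b m
  proof -
    have "(shift s (- 2) ^^ m) (S a b) * (shift s (- 2) ^^ 0) (RD s T bs) =
        (shift s (- 2) ^^ 0) (RD s T bs) * (shift s (- 2) ^^ m) (S a b)"
      by (rule rdet_commutes, unfold shift_power)
        (use assms that in \<open>auto intro!: ccomm_commutes ccomm_shift2\<close>)
    then show ?thesis by simp
  qed
  from rdet_commutes[OF this, of as, where n = 0] show ?thesis by simp
qed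

lemma schur_mshift: "schur I (mshift s c A) (mshift s c N) = mshift s c (schur I A N)"
proof (intro ext)
  fix i j
  interpret scalar_ext fsc "shift s c" by (rule scalar_ext_shift)
  have minus: "shift s c (F - G) = shift s c F - shift s c G" for F G :: "('a, 'b) uqgl fps"
    using theta_add[of "F - G" G] by (simp add: algebra_simps)
  have "mm I (mshift s c N) (mshift s c A) = mshift s c (mm I N A)"
    by (intro ext) (simp add: mm_mshift mshift_def)
  then show "schur I (mshift s c A) (mshift s c N) i j = mshift s c (schur I A N) i j"
    by (simp add: schur_def mm_mshift) (simp add: mshift_def minus schur_def)
qed

lemma rmatrix_fused: "rmatrix s Y K \<Longrightarrow> scalar_ext.fused fsc (shift s (- 2)) (asc q) Y K"
  by (simp add: rmatrix_def)

lemma RD_perm: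
  assumes "rmatrix s Y K" "distinct ks" "set ks \<subseteq> K" "distinct ks'" "set ks' = set ks"
  shows "RD s Y ks = RD s Y ks'"
proof -
  interpret scalar_ext fsc "shift s (- 2) :: ('a, 'b) uqgl fps \<Rightarrow> _" by (rule scalar_ext_shift)
  show ?thesis
    by (rule rdet_perm[OF fused_manin[OF rmatrix_fused[OF assms(1)]]]) (use assms asc_nonzero in auto)
qed

lemma RD_schur:
  assumes Y: "rmatrix s Y K" and "set ks \<subseteq> K" "set js \<union> set is = set ks" "distinct ks" "distinct (js @ is)"
    and N: "inv_on (set is) Y N"
  shows "RD s Y ks = RD s (schur (set is) Y N) js * RD s (mshift s (- 2 * int (length js)) Y) is"
proof -
  interpret scalar_ext fsc "shift s (- 2) :: ('a, 'b) uqgl fps \<Rightarrow> _" by (rule scalar_ext_shift)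
  have "fused (asc q) Y (set ks)"
    using rmatrix_fused[OF Y] assms(2) unfolding fused_def by blast
  then have "manin (asc q) Y (set ks)" by (rule fused_manin) (rule asc_nonzero)
  then have "RD s Y ks = RD s (schur (set is) Y N) js * (shift s (- 2) ^^ length js) (RD s Y is)"
    by (rule rdet_schur_inv) (use assms asc_nonzero in auto)
  then show ?thesis
    by (simp only: theta_power_rdet) (simp add: shift_power mshift_def[abs_def] mult.commute)
qed

section \<open>The even block of \<open>L\<close> and the odd block of its inverse\<close>

lemma rmatrix_even:
  assumes "LENGTH('m) \<noteq> LENGTH('n)"
  shows "rmatrix s (Ltw s :: ('m::len0, 'n::len0) uqgl fps mat) {1..LENGTH('m)}"
  by (rule rtt_rmatrix[OF rtt_even[OF rtt_Ltw[OF assms]]]) (auto simp: bar_def)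

lemma rmatrix_odd:
  assumes "LENGTH('m) \<noteq> LENGTH('n)"
    and X: "inv_on {1..LENGTH('m) + LENGTH('n)} (Ltw s :: ('m::len0, 'n::len0) uqgl fps mat) X"
  shows "rmatrix s X {LENGTH('m) + 1..LENGTH('m) + LENGTH('n)}"
  by (rule rtt_rmatrix_swapped[OF rtt_inverse_odd[OF _ rtt_Ltw[OF assms(1)] inv_on_fps_const[OF X] inv_on_emb2[OF X]]])
    (auto simp: bar_def)

text \<open>An even index never equals an odd one, so the index conditions of
  \<open>rtt_commute_inverse\<close> hold throughout the two blocks.\<close>

lemma ccomm_even_odd:
  assumes "LENGTH('m) \<noteq> LENGTH('n)"
    and X: "inv_on {1..LENGTH('m) + LENGTH('n)} (Ltw s :: ('m::len0, 'n::len0) uqgl fps mat) X"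
    and "i \<in> {1..LENGTH('m)}" "j \<in> {1..LENGTH('m)}"
    and "a \<in> {LENGTH('m) + 1..LENGTH('m) + LENGTH('n)}" "b \<in> {LENGTH('m) + 1..LENGTH('m) + LENGTH('n)}"
  shows "ccomm (Ltw s i j) (X a b)"
proof -
  have "(zvar s - wvar s) * (emb2 (X a b) * fps_const (Ltw s i j) - fps_const (Ltw s i j) * emb2 (X a b)) = 0"
    by (rule rtt_commute_inverse[OF _ rtt_Ltw[OF assms(1)] inv_on_emb2[OF X]])
      (use assms(3-6) in \<open>auto simp: bar_def intro: zvar_central wvar_central\<close>)
  then show ?thesis by (intro emb_commute_ccomm) (auto dest: zw_diff_cancel)
qed

lemma inverse_block:
  assumes X: "inv_on {1..LENGTH('m) + LENGTH('n)} (Ltw s :: ('m::len0, 'n::len0) uqgl fps mat) X"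
    and I: "I \<subseteq> {1..LENGTH('m) + LENGTH('n)}" and N: "inv_on I (Ltw s) N"
  shows "inv_on ({1..LENGTH('m) + LENGTH('n)} - I) X (schur I (Ltw s) N)"
proof -
  have "I \<union> ({1..LENGTH('m) + LENGTH('n)} - I) = {1..LENGTH('m) + LENGTH('n)}" using I by auto
  then show ?thesis
    using inv_on_schur[of I "{1..LENGTH('m) + LENGTH('n)} - I" "Ltw s" X N] I X N
    by (auto intro: inv_on_sym finite_subset)
qed

lemma CD_even:
  assumes "LENGTH('m) \<noteq> LENGTH('n)" "distinct ks" "set ks \<subseteq> {1..LENGTH('m)}"
  shows "CD s (mshift s c (Ltw s :: ('m::len0, 'n::len0) uqgl fps mat)) ks = RD s (mshift s c (Ltw s)) ks"
proof (rule rmatrix_cdet_eq_rdet[OF rmatrix_mshift[OF rmatrix_even[OF assms(1)]] _ assms(2,3)])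
  fix I assume "I \<subseteq> {1..LENGTH('m)}"
  then have "I \<subseteq> {1..LENGTH('m) + LENGTH('n)}" by auto
  then show "\<exists>N. inv_on I (mshift s c (Ltw s :: ('m, 'n) uqgl fps mat)) N"
    using Ltw_invertible inv_on_mshift by blast
qed

lemma CD_odd:
  assumes "LENGTH('m) \<noteq> LENGTH('n)"
    and X: "inv_on {1..LENGTH('m) + LENGTH('n)} (Ltw s :: ('m::len0, 'n::len0) uqgl fps mat) X"
    and ks: "distinct ks" "set ks \<subseteq> {LENGTH('m) + 1..LENGTH('m) + LENGTH('n)}"
  shows "CD s (mshift s c X) ks = RD s (mshift s c X) ks"
proof (rule rmatrix_cdet_eq_rdet[OF rmatrix_mshift[OF rmatrix_odd[OF assms(1) X]] _ ks])
  fix C assume "C \<subseteq> {LENGTH('m) + 1..LENGTH('m) + LENGTH('n)}"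
  \<comment> \<open>The block of \<open>X\<close> on \<open>C\<close> is inverted by the Schur
    complement of \<open>L\<close> with respect to the block on the indices outside
    \<open>C\<close>.\<close>
  then have C: "{1..LENGTH('m) + LENGTH('n)} - ({1..LENGTH('m) + LENGTH('n)} - C) = C" by auto
  obtain N where N: "inv_on ({1..LENGTH('m) + LENGTH('n)} - C) (Ltw s :: ('m, 'n) uqgl fps mat) N"
    using Ltw_invertible[of "{1..LENGTH('m) + LENGTH('n)} - C"] by auto
  show "\<exists>N. inv_on C (mshift s c X) N"
    using inverse_block[OF X _ N] inv_on_mshift unfolding C by blast
qed

lemma mshift_Lmat_even:
  fixes s :: sign
  assumes "bar LENGTH('m) i = bar LENGTH('m) j"
  shows "mshift s c (Lmat s) i j = mshift s c (Ltw s :: ('m::len0, 'n::len0) uqgl fps mat) i j"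
  by (simp add: mshift_def Ltw_def tw_cong_parity[of "bar LENGTH('m)" i j, OF assms])

lemma tw_mshift_Lmat: "tw (bar LENGTH('m)) (mshift s c (Lmat s)) = mshift s c (Ltw s :: ('m::len0, 'n::len0) uqgl fps mat)"
  by (simp add: Ltw_def mshift_tw)

lemma sinv_Lmat:
  fixes s :: sign
  defines "M \<equiv> LENGTH('m)" and "N \<equiv> LENGTH('n)"
  assumes X: "inv_on {1..M + N} (Ltw s :: ('m::len0, 'n::len0) uqgl fps mat) X"
    and ab: "a \<in> {1..M + N}" "b \<in> {1..M + N}"
  shows "sinv (bar M) (M + N) (mshift s c (Lmat s)) a b = tw (bar M) (mshift s c X) a b"
  by (rule sinv_eq[OF _ ab]) (use inv_on_mshift[OF X] in \<open>simp add: M_def tw_mshift_Lmat\<close>)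

lemma berezinian_Lmat:
  fixes s :: sign
  defines "M \<equiv> LENGTH('m)" and "N \<equiv> LENGTH('n)"
  assumes X: "inv_on {1..M + N} (Ltw s :: ('m::len0, 'n::len0) uqgl fps mat) X"
  shows "berezinian q s (bar M) M N (Lmat s) =
    CD s (mshift s (2 * int M - 2) (Ltw s)) (rev [1..<M + 1]) *
    RD s (mshift s (2 * int M - 2) X) (map ((+) M) [1..<N + 1])"
proof -
  interpret scalar_ext fsc "shift s (- 2) :: ('m, 'n) uqgl fps \<Rightarrow> _" by (rule scalar_ext_shift)
  have "berezinian q s (bar M) M N (Lmat s) =
    CD s (mshift s (2 * int M - 2) (Lmat s)) (rev [1..<M + 1]) *
    RD s (\<lambda>k l. shift s (2 * int M - 2) (tw (bar M) X (M + k) (M + l))) [1..<N + 1]"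
  proof (rule berezinian_eq)
    fix c k l assume "k \<in> {1..N}" "l \<in> {1..N}"
    then have "sinv (bar M) (M + N) (mshift s c (Lmat s)) (M + k) (M + l) = tw (bar M) (mshift s c X) (M + k) (M + l)"
      using sinv_Lmat[OF X[unfolded M_def N_def], of "M + k" "M + l" c] by (simp add: M_def N_def)
    then show "sinv (bar M) (M + N) (mshift s c (Lmat s)) (M + k) (M + l) = shift s c (tw (bar M) X (M + k) (M + l))"
      by (simp add: mshift_tw[symmetric]) (simp add: mshift_def)
  qed
  also have "CD s (mshift s (2 * int M - 2) (Lmat s)) (rev [1..<M + 1]) =
    CD s (mshift s (2 * int M - 2) (Ltw s :: ('m, 'n) uqgl fps mat)) (rev [1..<M + 1])"
    by (rule cdet_cong) (auto simp: M_def bar_def intro!: mshift_Lmat_even)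
  also have "RD s (\<lambda>k l. shift s (2 * int M - 2) (tw (bar M) X (M + k) (M + l))) [1..<N + 1] =
    RD s (\<lambda>k l. mshift s (2 * int M - 2) X (M + k) (M + l)) [1..<N + 1]"
  proof (rule rdet_cong)
    fix k l assume "k \<in> set [1..<N + 1]" "l \<in> set [1..<N + 1]"
    then have "bar M (M + k) = bar M (M + l)" by (auto simp: bar_def)
    then show "shift s (2 * int M - 2) (tw (bar M) X (M + k) (M + l)) = mshift s (2 * int M - 2) X (M + k) (M + l)"
      by (simp add: tw_cong_parity mshift_def)
  qed auto
  also have "\<dots> = RD s (mshift s (2 * int M - 2) X) (map ((+) M) [1..<N + 1])"
    by (rule relabel_inc) auto
  finally show ?thesis .
qed

lemma less_iff_of_mono:
  fixes f :: "nat \<Rightarrow> nat"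
  assumes "\<And>a b. a \<in> A \<Longrightarrow> b \<in> A \<Longrightarrow> a < b \<Longrightarrow> f a < f b"
  shows "\<forall>a\<in>A. \<forall>b\<in>A. f a < f b \<longleftrightarrow> a < b"
  using assms by (metis less_asym linorder_neqE_nat)

lemma less_iff_of_antimono:
  fixes f :: "nat \<Rightarrow> nat"
  assumes "\<And>a b. a \<in> A \<Longrightarrow> b \<in> A \<Longrightarrow> a < b \<Longrightarrow> f b < f a"
  shows "\<forall>a\<in>A. \<forall>b\<in>A. f a < f b \<longleftrightarrow> b < a"
  using assms by (metis less_asym linorder_neqE_nat)

lemma elt_less_iff: "finite S \<Longrightarrow> \<forall>a\<in>{1..card S}. \<forall>b\<in>{1..card S}. elt S a < elt S b \<longleftrightarrow> a < b"
  by (rule less_iff_of_mono) (auto intro: elt_less)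

lemma rev_elt_less_iff:
  "finite S \<Longrightarrow> \<forall>a\<in>{1..card S}. \<forall>b\<in>{1..card S}. elt S (card S + 1 - a) < elt S (card S + 1 - b) \<longleftrightarrow> b < a"
  by (rule less_iff_of_antimono) (auto intro!: elt_less)

lemma rev_elt_mem: "finite S \<Longrightarrow> a \<in> {1..card S} \<Longrightarrow> elt S (card S + 1 - a) \<in> S"
  by (rule elt_mem) auto

lemma rev_elt_image: "finite S \<Longrightarrow> (\<lambda>a. elt S (card S + 1 - a)) ` {1..card S} = S"
proof -
  assume fin: "finite S"
  have "(\<lambda>a. card S + 1 - a) ` {1..card S} = {1..card S}"
    by (rule bij_betw_imp_surj_on[OF bij_betw_byWitness[where f' = "\<lambda>a. card S + 1 - a"]]) auto
  then show ?thesis using elt_image[OF fin] by (metis image_image)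
qed

text \<open>\<open>f\<close> is decreasing, because \<open>revmat\<close> reverses the order of the complement.\<close>

lemma sinv_complement:
  fixes s :: sign and d :: int
  defines "M \<equiv> LENGTH('m)" and "N \<equiv> LENGTH('n)"
  assumes X: "inv_on {1..M + N} (Ltw s :: ('m::len0, 'n::len0) uqgl fps mat) X"
    and I: "I \<subseteq> {1..M + N}" and NI: "inv_on I (Ltw s) NI"
  defines "T \<equiv> {1..M + N} - I"
  defines "f \<equiv> \<lambda>a. elt T (card T + 1 - a)"
  defines "A \<equiv> revmat (card T) (submat T (sinv (bar M) (M + N) (mshift s d (Lmat s))))"
  shows "a \<in> {1..card T} \<Longrightarrow> b \<in> {1..card T} \<Longrightarrow> mshift s c A a b = tw (bar M) (mshift s (c + d) X) (f a) (f b)"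
    and "a \<in> {1..card T} \<Longrightarrow> b \<in> {1..card T} \<Longrightarrow> sinv (revpar (card T) (subpar T (bar M))) (card T) (mshift s c A) a b =
      shift s c (tw (bar M) (mshift s d (schur I (Ltw s) NI)) (f a) (f b))"
proof -
  have fin: "finite T" by (simp add: T_def)
  have fT: "f a \<in> {1..M + N}" if "a \<in> {1..card T}" for a
    using rev_elt_mem[OF fin that] by (auto simp: f_def T_def)
  have mA: "mshift s c A a b = tw (bar M) (mshift s (c + d) X) (f a) (f b)"
    if "a \<in> {1..card T}" "b \<in> {1..card T}" for a b
  proof -
    have "A a b = tw (bar M) (mshift s d X) (f a) (f b)"
      using sinv_Lmat[OF X[unfolded M_def N_def], of "f a" "f b" d] fT that
      by (simp add: A_def revmat_def submat_def f_def M_def N_def)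
    then have "mshift s c A a b = mshift s c (tw (bar M) (mshift s d X)) (f a) (f b)"
      by (simp add: mshift_def)
    then show ?thesis by (simp only: mshift_tw mshift_mshift)
  qed
  then show "a \<in> {1..card T} \<Longrightarrow> b \<in> {1..card T} \<Longrightarrow> mshift s c A a b = tw (bar M) (mshift s (c + d) X) (f a) (f b)" .
  assume ab: "a \<in> {1..card T}" "b \<in> {1..card T}"
  have im: "f ` {1..card T} = T" using rev_elt_image[OF fin] by (simp add: f_def)
  have "sinv (revpar (card T) (subpar T (bar M))) (card T) (mshift s c A) a b =
    tw (bar M) (mshift s (c + d) (schur I (Ltw s) NI)) (f a) (f b)"
  proof (rule sinv_relabel[where f = f and p = "bar M" and A = "tw (bar M) (mshift s (c + d) X)", OF _ _ mA _ ab])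
    show "inj_on f {1..card T}"
      by (rule inj_on_of_less_iff) (use rev_elt_less_iff[OF fin] in \<open>simp add: f_def\<close>)
    show "revpar (card T) (subpar T (bar M)) a = bar M (f a)" for a
      by (simp add: revpar_def subpar_def f_def)
    show "inv_on (f ` {1..card T}) (tw (bar M) (tw (bar M) (mshift s (c + d) X))) (mshift s (c + d) (schur I (Ltw s) NI))"
      unfolding im tw_tw
      using inv_on_mshift[OF inverse_block[OF X[unfolded M_def N_def] I[unfolded M_def N_def] NI]]
      by (simp add: T_def M_def N_def)
  qed
  also have "\<dots> = mshift s c (tw (bar M) (mshift s d (schur I (Ltw s) NI))) (f a) (f b)"
    by (simp only: mshift_tw mshift_mshift)
  finally show "sinv (revpar (card T) (subpar T (bar M))) (card T) (mshift s c A) a b =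
      shift s c (tw (bar M) (mshift s d (schur I (Ltw s) NI)) (f a) (f b))"
    by (simp add: mshift_def)
qed

lemma map_upt_inj:
  assumes "inj_on g {1..n}"
  shows "distinct (map g [1..<n + 1])" "set (map g [1..<n + 1]) = g ` {1..n}"
    "distinct (map g (rev [1..<n + 1]))" "set (map g (rev [1..<n + 1])) = g ` {1..n}"
proof -
  have s: "set [1..<n + 1] = {1..n}" by auto
  show "distinct (map g [1..<n + 1])" "distinct (map g (rev [1..<n + 1]))"
    unfolding distinct_map set_rev s distinct_rev using assms by simp_all
  show "set (map g [1..<n + 1]) = g ` {1..n}" "set (map g (rev [1..<n + 1])) = g ` {1..n}"
    unfolding set_map set_rev s by (rule refl)+
qed

lemma submat_Lmat_sinv:
  fixes s :: sign
  assumes I: "finite I" and N: "inv_on I (Ltw s :: ('m::len0, 'n::len0) uqgl fps mat) N"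
    and ab: "a \<in> {1..card I}" "b \<in> {1..card I}"
  shows "sinv (subpar I (bar LENGTH('m))) (card I) (mshift s c (submat I (Lmat s))) a b =
    tw (bar LENGTH('m)) (mshift s c N) (elt I a) (elt I b)"
proof (rule sinv_relabel[where f = "elt I" and p = "bar LENGTH('m)" and A = "mshift s c (Lmat s)", OF _ _ _ _ ab])
  show "inj_on (elt I) {1..card I}" using elt_bij[OF I] by (simp add: bij_betw_def)
  show "inv_on (elt I ` {1..card I}) (tw (bar LENGTH('m)) (mshift s c (Lmat s))) (mshift s c N)"
    unfolding elt_image[OF I] tw_mshift_Lmat by (rule inv_on_mshift[OF N])
qed (simp_all add: subpar_def submat_def mshift_def)

text \<open>The complement of \<open>I\<close> consists of the even indices \<open>J\<close> and all
  odd ones, and reversal puts the odd ones first. So the second Berezinian is the determinant of the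
  odd block of \<open>X\<close> times that of the Schur complement on \<open>J\<close>. Expanding
  the even determinant of \<open>L\<close> along \<open>I\<close> gives the same three factors, and
  it remains to commute the Schur factor to the end.\<close>

lemma theorem4p3_even:
  fixes s :: sign
  defines "M \<equiv> LENGTH('m)" and "N \<equiv> LENGTH('n)"
  assumes ne: "M \<noteq> N" and I: "I \<subseteq> {1..M}"
  defines "k \<equiv> card I" and "T \<equiv> {1..M + N} - I"
  defines "A \<equiv> revmat (M + N - k) (submat T (sinv (bar M) (M + N) (mshift s (2 * int M - 2 * int N) (Lmat s)))) ::
    ('m::len0, 'n::len0) uqgl fps mat"
  shows "berezinian q s (bar M) M N (Lmat s :: ('m, 'n) uqgl fps mat) =
    berezinian q s (subpar I (bar M)) k 0 (submat I (Lmat s)) *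
    berezinian (inverse q) s (revpar (M + N - k) (subpar T (bar M))) N (M - k) A"
proof -
  interpret scalar_ext fsc "shift s (- 2) :: ('m, 'n) uqgl fps \<Rightarrow> _" by (rule scalar_ext_shift)
  let ?p = "bar M" and ?L = "Ltw s :: ('m, 'n) uqgl fps mat" and ?c = "2 * int M - 2"
  have ne': "LENGTH('m) \<noteq> LENGTH('n)" using ne by (simp add: M_def N_def)
  have IU: "I \<subseteq> {1..M + N}" using I by auto
  have finI: "finite I" and finT: "finite T" using I by (auto simp: T_def intro: finite_subset)
  define J where "J = {1..M} - I"
  define r where "r = M - k"
  have kM: "k \<le> M" using card_mono[OF _ I] by (simp add: k_def)
  have finJ: "finite J" and cJ: "card J = r"
    using I finI by (auto simp: J_def r_def k_def card_Diff_subset)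
  have TJ: "T = J \<union> {M + 1..M + N}" using I by (auto simp: T_def J_def)
  have cT: "card T = N + r" and cT': "card T = M + N - k"
    using IU finI kM by (auto simp: T_def card_Diff_subset k_def r_def)
  obtain X where X: "inv_on {1..M + N} ?L X"
    using Ltw_invertible[where 'm = 'm and 'n = 'n, of "{1..M + N}" s] by (auto simp: M_def N_def)
  note X' = X[unfolded M_def N_def]
  obtain NI where NI: "inv_on I ?L NI"
    using Ltw_invertible[where 'm = 'm and 'n = 'n, of I s] IU by (auto simp: M_def N_def)
  obtain ZE where ZE: "inv_on {1..M} ?L ZE"
    using Ltw_invertible[where 'm = 'm and 'n = 'n, of "{1..M}" s] by (auto simp: M_def N_def)
  let ?S = "schur I ?L NI"
  define f where "f a = elt T (card T + 1 - a)" for a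
  have f_less: "\<forall>a\<in>{1..card T}. \<forall>b\<in>{1..card T}. f a < f b \<longleftrightarrow> b < a"
    using rev_elt_less_iff[OF finT] by (simp add: f_def)
  have lt: "x < y" if "x \<in> J" "y \<in> {M + 1..M + N}" for x y using that by (auto simp: J_def)
  have fO: "f a \<in> {M + 1..M + N}" if "a \<in> {1..N}" for a
  proof -
    have "card T + 1 - a = card J + (N + 1 - a)" using that by (simp add: cT cJ)
    then have "f a = elt T (card J + (N + 1 - a))" by (simp only: f_def)
    also have "\<dots> = elt {M + 1..M + N} (N + 1 - a)"
      unfolding TJ by (rule elt_append(2)[OF finJ _ lt]) (use that in auto)
    also have "\<dots> \<in> {M + 1..M + N}" by (rule elt_mem) (use that in auto)
    finally show ?thesis .
  qed
  have fJ: "f (N + b) \<in> J" if "b \<in> {1..r}" for b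
  proof -
    have "f (N + b) = elt T (r + 1 - b)" using that by (simp add: f_def cT)
    also have "\<dots> = elt J (r + 1 - b)"
      unfolding TJ by (rule elt_append(1)[OF finJ _ lt]) (use that cJ in auto)
    also have "\<dots> \<in> J" by (rule elt_mem[OF finJ]) (use that cJ in auto)
    finally show ?thesis .
  qed
  have f_inj: "inj_on f {1..card T}" by (rule inj_on_of_less_iff) (use f_less in blast)
  define EL where "EL = rev [1..<M + 1]"
  define OL where "OL = map ((+) M) [1..<N + 1]"
  define IL where "IL = map (elt I) (rev [1..<k + 1])"
  define ZL where "ZL = map f (rev [1..<N + 1])"
  define JL where "JL = map (\<lambda>b. f (N + b)) [1..<r + 1]"
  have EL: "distinct EL" "set EL = {1..M}" by (auto simp: EL_def)
  have OL: "distinct OL" "set OL = {M + 1..M + N}"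
  proof -
    show "distinct OL" by (simp add: OL_def distinct_map)
    have "set [1..<N + 1] = {1..N}" by auto
    then have "set OL = (+) M ` {1..N}" by (simp only: OL_def set_map)
    then show "set OL = {M + 1..M + N}" by (simp add: add.commute)
  qed
  have IL: "distinct IL" "set IL = I"
    using elt_bij[OF finI] map_upt_inj(3,4)[of "elt I" k] unfolding IL_def bij_betw_def k_def by simp_all
  have ZL: "distinct ZL" "set ZL = {M + 1..M + N}"
  proof -
    have i: "inj_on f {1..N}" by (rule inj_on_subset[OF f_inj]) (simp add: cT)
    show "distinct ZL" unfolding ZL_def by (rule map_upt_inj[OF i])
    have "card (f ` {1..N}) = card {M + 1..M + N}" using card_image[OF i] by simp
    then have "f ` {1..N} = {M + 1..M + N}" using fO by (intro card_subset_eq) auto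
    then show "set ZL = {M + 1..M + N}" unfolding ZL_def map_upt_inj(4)[OF i] .
  qed
  have JL: "distinct JL" "set JL = J" "length JL = r"
  proof -
    have i: "inj_on (\<lambda>b. f (N + b)) {1..r}"
    proof (rule inj_onI)
      fix x y assume xy: "x \<in> {1..r}" "y \<in> {1..r}" and eq: "f (N + x) = f (N + y)"
      have "N + x = N + y" by (rule inj_onD[OF f_inj eq]) (use xy in \<open>simp_all add: cT\<close>)
      then show "x = y" by simp
    qed
    show "distinct JL" unfolding JL_def by (rule map_upt_inj[OF i])
    have "card ((\<lambda>b. f (N + b)) ` {1..r}) = card J" using card_image[OF i] by (simp add: cJ)
    then have "(\<lambda>b. f (N + b)) ` {1..r} = J" using fJ finJ by (intro card_subset_eq) auto
    then show "set JL = J" unfolding JL_def map_upt_inj(2)[OF i] .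
    show "length JL = r" by (simp add: JL_def)
  qed
  let ?Y = "mshift s ?c ?L" and ?Z = "mshift s ?c X" and ?YI = "mshift s (2 * int k - 2) ?L" and ?SY = "mshift s ?c ?S"
  have lhs: "berezinian q s ?p M N (Lmat s :: ('m, 'n) uqgl fps mat) = CD s ?Y EL * RD s ?Z OL"
    using berezinian_Lmat[OF X'] by (simp add: M_def N_def EL_def OL_def)
  have fac1: "berezinian q s (subpar I ?p) k 0 (submat I (Lmat s) :: ('m, 'n) uqgl fps mat) = CD s ?YI IL"
  proof -
    have "berezinian q s (subpar I ?p) k 0 (submat I (Lmat s) :: ('m, 'n) uqgl fps mat) =
      CD s (mshift s (2 * int k - 2) (submat I (Lmat s))) (rev [1..<k + 1])"
      by (subst berezinian_eq[where W = "\<lambda>_ _. 0"]) simp_all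
    also have "\<dots> = CD s (\<lambda>a b. ?YI (elt I a) (elt I b)) (rev [1..<k + 1])"
    proof (rule cdet_cong)
      fix a b assume "a \<in> set (rev [1..<k + 1])" "b \<in> set (rev [1..<k + 1])"
      then have "elt I a \<in> I" "elt I b \<in> I" by (auto simp: k_def intro!: elt_mem[OF finI])
      then have "bar LENGTH('m) (elt I a) = bar LENGTH('m) (elt I b)" using I by (auto simp: bar_def M_def)
      from mshift_Lmat_even[OF this, of s "2 * int k - 2"]
      show "mshift s (2 * int k - 2) (submat I (Lmat s)) a b = ?YI (elt I a) (elt I b)"
        by (simp add: mshift_def submat_def)
    qed auto
    also have "\<dots> = CD s ?YI IL"
      unfolding IL_def by (rule relabel_inc) (use elt_less_iff[OF finI] in \<open>simp add: k_def\<close>)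
    finally show ?thesis .
  qed
  \<comment> \<open>The base shift of a Berezinian with \<open>N\<close> first indices is
    \<open>2N - 2\<close>; adding \<open>?d\<close> gives \<open>2M - 2\<close>, the base shift of
    the left side.\<close>
  let ?d = "2 * int M - 2 * int N"
  have par: "?p (f a) = ?p (f b)" if "a \<in> {1..N}" "b \<in> {1..N}" for a b
    using fO[OF that(1)] fO[OF that(2)] by (simp add: bar_def)
  have par': "?p (f (N + a)) = ?p (f (N + b))" if "a \<in> {1..r}" "b \<in> {1..r}" for a b
    using fJ[OF that(1)] fJ[OF that(2)] by (simp add: bar_def J_def)
  note A' = A_def[folded cT']
  have mA: "mshift s c A a b = tw ?p (mshift s (c + ?d) X) (f a) (f b)"
    if "a \<in> {1..N + r}" "b \<in> {1..N + r}" for a b c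
    using sinv_complement(1)[OF X' IU[unfolded M_def N_def] NI, of a b c ?d] that[folded cT]
    by (simp add: A' f_def T_def M_def N_def)
  have sA: "sinv (revpar (N + r) (subpar T ?p)) (N + r) (mshift s c A) a b =
      shift s c (tw ?p (mshift s ?d ?S) (f a) (f b))"
    if "a \<in> {1..N + r}" "b \<in> {1..N + r}" for a b c
    unfolding cT[symmetric]
    using sinv_complement(2)[OF X' IU[unfolded M_def N_def] NI, of a b c ?d] that[folded cT]
    by (simp add: A' f_def T_def M_def N_def)
  have fac2: "berezinian (inverse q) s (revpar (M + N - k) (subpar T ?p)) N (M - k) A = CD s ?Z ZL * RD s ?SY JL"
  proof -
    have "berezinian (inverse q) s (revpar (N + r) (subpar T ?p)) N r A =
      cdet (\<lambda>x y. asc (inverse q) y x) (mshift s (2 * int N - 2) A) (rev [1..<N + 1]) *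
      rdet (asc (inverse q)) (\<lambda>a b. shift s (2 * int N - 2) (tw ?p (mshift s ?d ?S) (f (N + a)) (f (N + b)))) [1..<r + 1]"
      by (rule berezinian_eq[where W = "\<lambda>a b. tw ?p (mshift s ?d ?S) (f a) (f b)"], rule sA) auto
    also have "cdet (\<lambda>x y. asc (inverse q) y x) (mshift s (2 * int N - 2) A) (rev [1..<N + 1]) =
      cdet (\<lambda>x y. asc (inverse q) y x) (\<lambda>a b. ?Z (f a) (f b)) (rev [1..<N + 1])"
    proof (rule cdet_cong)
      fix a b assume "a \<in> set (rev [1..<N + 1])" "b \<in> set (rev [1..<N + 1])"
      then have ab: "a \<in> {1..N}" "b \<in> {1..N}" by auto
      then show "mshift s (2 * int N - 2) A a b = ?Z (f a) (f b)"
        by (subst mA) (auto simp: tw_cong_parity[of ?p "f a" "f b", OF par[OF ab]] algebra_simps)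
    qed auto
    also have "\<dots> = CD s ?Z ZL"
      unfolding ZL_def by (rule relabel_dec) (use f_less cT in auto)
    also have "rdet (asc (inverse q)) (\<lambda>a b. shift s (2 * int N - 2) (tw ?p (mshift s ?d ?S) (f (N + a)) (f (N + b)))) [1..<r + 1] =
      rdet (asc (inverse q)) (\<lambda>a b. ?SY (f (N + a)) (f (N + b))) [1..<r + 1]"
    proof (rule rdet_cong)
      fix a b assume "a \<in> set [1..<r + 1]" "b \<in> set [1..<r + 1]"
      then have ab: "a \<in> {1..r}" "b \<in> {1..r}" by auto
      show "shift s (2 * int N - 2) (tw ?p (mshift s ?d ?S) (f (N + a)) (f (N + b))) = ?SY (f (N + a)) (f (N + b))"
        by (simp add: tw_cong_parity[of ?p "f (N + a)" "f (N + b)", OF par'[OF ab]] mshift_def shift_shift)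
    qed auto
    also have "\<dots> = RD s ?SY JL"
      unfolding JL_def by (rule relabel_dec) (use f_less cT in auto)
    finally show ?thesis by (simp only: cT'[symmetric] cT r_def[symmetric])
  qed
  have inv: "inv_on I ?Y (mshift s ?c NI)" by (rule inv_on_mshift[OF NI])
  have rE: "rmatrix s ?Y {1..M}" unfolding M_def by (intro rmatrix_mshift rmatrix_even ne')
  have rO: "rmatrix s ?Z {M + 1..M + N}" unfolding M_def N_def by (intro rmatrix_mshift rmatrix_odd[OF ne' X'])
  have "CD s ?Y EL = RD s ?Y EL"
    by (rule CD_even[OF ne']) (use EL in \<open>simp_all add: M_def\<close>)
  also have "\<dots> = RD s (schur (set IL) ?Y (mshift s ?c NI)) JL * RD s (mshift s (- 2 * int (length JL)) ?Y) IL"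
    by (rule RD_schur[OF rE]) (use EL IL JL I inv in \<open>auto simp: J_def\<close>)
  also have "schur (set IL) ?Y (mshift s ?c NI) = ?SY" by (simp add: IL schur_mshift)
  also have "mshift s (- 2 * int (length JL)) ?Y = ?YI"
  proof -
    \<comment> \<open>The \<open>r = M - k\<close> rows of \<open>J\<close> precede those of
      \<open>I\<close>; their shifts lower \<open>2M - 2\<close> to the base shift
      \<open>2k - 2\<close> of a Berezinian of size \<open>k\<close>.\<close>
    have "- 2 * int r + ?c = 2 * int k - 2" using kM by (simp add: r_def of_nat_diff)
    then show ?thesis by (simp only: mshift_mshift JL(3))
  qed
  also have YI: "RD s ?YI IL = CD s ?YI IL"
    by (rule CD_even[OF ne', symmetric]) (use IL I in \<open>simp_all add: M_def\<close>)
  finally have 1: "CD s ?Y EL = RD s ?SY JL * CD s ?YI IL" .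
  have 2: "RD s ?Z OL = CD s ?Z ZL"
  proof -
    have "RD s ?Z OL = RD s ?Z ZL" by (rule RD_perm[OF rO]) (use OL ZL in auto)
    also have "\<dots> = CD s ?Z ZL"
      by (rule CD_odd[OF ne' X', symmetric]) (use ZL in \<open>simp_all add: M_def N_def\<close>)
    finally show ?thesis .
  qed
  \<comment> \<open>Within the even block, \<open>?S\<close> is inverse to the \<open>J\<close>
    block of \<open>ZE\<close>, so whatever commutes with those entries of \<open>ZE\<close>
    commutes with \<open>?S\<close>.\<close>
  have invS: "inv_on J ZE ?S"
  proof -
    have "I \<union> J = {1..M}" using I by (auto simp: J_def)
    then have "inv_on J ?S ZE" using ZE by (intro inv_on_schur[OF finI finJ _ _ NI]) (auto simp: J_def)
    then show ?thesis by (rule inv_on_sym)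
  qed
  have comI: "ccomm (?S a b) (?L i j)" if "a \<in> J" "b \<in> J" "i \<in> I" "j \<in> I" for a b i j
  proof (rule ccomm_sym, rule ccomm_inverse[OF finJ invS _ that(1,2)])
    fix a b assume ab: "a \<in> J" "b \<in> J"
    have E: "i \<in> {1..M}" "j \<in> {1..M}" "a \<in> {1..M}" "b \<in> {1..M}" "i \<noteq> b" "j \<noteq> a"
      using that ab I by (auto simp: J_def)
    show "ccomm (?L i j) (ZE a b)"
      using rmatrix_even[OF ne', of s] ZE E unfolding rmatrix_def M_def by blast
  qed
  \<comment> \<open>Commutation is passed on twice: from the even block of \<open>L\<close> to its
    inverse \<open>ZE\<close>, and from the \<open>J\<close> block of \<open>ZE\<close> to
    \<open>?S\<close>.\<close>
  have comO: "ccomm (?S i j) (X a b)" if "i \<in> J" "j \<in> J" "a \<in> {M + 1..M + N}" "b \<in> {M + 1..M + N}" for a b i j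
  proof (rule ccomm_sym, rule ccomm_inverse[OF finJ invS _ that(1,2)])
    fix i j assume ij: "i \<in> J" "j \<in> J"
    show "ccomm (X a b) (ZE i j)"
    proof (rule ccomm_inverse[OF _ ZE])
      fix i j assume "i \<in> {1..M}" "j \<in> {1..M}"
      then show "ccomm (X a b) (?L i j)"
        using that by (intro ccomm_sym[OF ccomm_even_odd[OF ne' X']]) (simp_all add: M_def N_def)
    qed (use ij in \<open>auto simp: J_def\<close>)
  qed
  have c1: "RD s ?SY JL * RD s ?YI IL = RD s ?YI IL * RD s ?SY JL"
    by (rule RD_commute) (use comI IL JL in \<open>auto simp: mshift_def intro: ccomm_shift2\<close>)
  have c2: "RD s ?SY JL * RD s ?Z OL = RD s ?Z OL * RD s ?SY JL"
    by (rule RD_commute) (use comO OL JL in \<open>auto simp: mshift_def intro: ccomm_shift2\<close>)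
  show ?thesis
    unfolding lhs fac1 fac2 1 2 c1[unfolded YI] mult.assoc c2[unfolded 2] ..
qed

text \<open>The even determinant is common to both sides. The odd determinant of \<open>X\<close> is
  expanded along the complement \<open>T\<close>; its Schur complement is the inverse of the block
  of \<open>L\<close> on \<open>I\<close>, which gives the odd factor of the first Berezinian. The
  factors already come in the required order.\<close>

lemma theorem4p3_odd:
  fixes s :: sign
  defines "M \<equiv> LENGTH('m)" and "N \<equiv> LENGTH('n)"
  assumes ne: "M \<noteq> N" and MI: "{1..M} \<subseteq> I" and IU: "I \<subseteq> {1..M + N}"
  defines "k \<equiv> card I" and "T \<equiv> {1..M + N} - I"
  defines "A \<equiv> revmat (M + N - k) (submat T (sinv (bar M) (M + N) (mshift s (2 * int M - 2 * int N) (Lmat s)))) ::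
    ('m::len0, 'n::len0) uqgl fps mat"
  shows "berezinian q s (bar M) M N (Lmat s :: ('m, 'n) uqgl fps mat) =
    berezinian q s (subpar I (bar M)) M (k - M) (submat I (Lmat s)) *
    berezinian (inverse q) s (revpar (M + N - k) (subpar T (bar M))) (M + N - k) 0 A"
proof -
  interpret scalar_ext fsc "shift s (- 2) :: ('m, 'n) uqgl fps \<Rightarrow> _" by (rule scalar_ext_shift)
  let ?p = "bar M" and ?L = "Ltw s :: ('m, 'n) uqgl fps mat" and ?c = "2 * int M - 2"
  have ne': "LENGTH('m) \<noteq> LENGTH('n)" using ne by (simp add: M_def N_def)
  have finI: "finite I" and finT: "finite T" using IU by (auto simp: T_def intro: finite_subset)
  define K where "K = I - {1..M}"
  define r where "r = k - M"
  have kM: "M \<le> k" using card_mono[OF finI MI] by (simp add: k_def)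
  have kN: "k \<le> M + N" using card_mono[OF _ IU] by (simp add: k_def)
  have finK: "finite K" and cK: "card K = r"
    using MI finI by (auto simp: K_def r_def k_def card_Diff_subset)
  have IK: "I = {1..M} \<union> K" using MI by (auto simp: K_def)
  have KO: "K \<subseteq> {M + 1..M + N}" using IU by (auto simp: K_def)
  have TO: "T \<subseteq> {M + 1..M + N}" 
  proof
    fix x assume x: "x \<in> T"
    then have "x \<notin> {1..M}" using MI by (auto simp only: T_def)
    then show "x \<in> {M + 1..M + N}" using x by (auto simp: T_def)
  qed
  have cT: "card T = M + N - k"
    using IU finI by (auto simp: T_def card_Diff_subset k_def)
  obtain X where X: "inv_on {1..M + N} ?L X"
    using Ltw_invertible[where 'm = 'm and 'n = 'n, of "{1..M + N}" s] by (auto simp: M_def N_def)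
  note X' = X[unfolded M_def N_def]
  obtain NI where NI: "inv_on I ?L NI"
    using Ltw_invertible[where 'm = 'm and 'n = 'n, of I s] IU by (auto simp: M_def N_def)
  let ?S = "schur I ?L NI"
  have XT: "inv_on T X ?S"
    using inverse_block[OF X' IU[unfolded M_def N_def] NI] by (simp add: T_def M_def N_def)
  define f where "f a = elt T (card T + 1 - a)" for a
  have f_less: "\<forall>a\<in>{1..card T}. \<forall>b\<in>{1..card T}. f a < f b \<longleftrightarrow> b < a"
    using rev_elt_less_iff[OF finT] by (simp add: f_def)
  have fT: "f a \<in> T" if "a \<in> {1..card T}" for a
    using rev_elt_mem[OF finT that] by (simp add: f_def)
  have f_inj: "inj_on f {1..card T}" by (rule inj_on_of_less_iff) (use f_less in blast)
  have lt: "x < y" if "x \<in> {1..M}" "y \<in> K" for x y using that(1) subsetD[OF KO that(2)] by simp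
  have eE: "elt I a = a" if "a \<in> {1..M}" for a
    unfolding IK using elt_append(1)[OF _ finK lt, of "{1..M}" a] elt_interval[OF that] that by auto
  have eK: "elt I (M + b) = elt K b" if "b \<in> {1..r}" for b
    unfolding IK using elt_append(2)[OF _ finK lt, of "{1..M}" b] that by (auto simp: cK)
  define EL where "EL = rev [1..<M + 1]"
  define OL where "OL = map ((+) M) [1..<N + 1]"
  define KL where "KL = map (\<lambda>b. elt I (M + b)) [1..<r + 1]"
  define TL where "TL = map f (rev [1..<card T + 1])"
  have OL: "distinct OL" "set OL = {M + 1..M + N}"
  proof -
    show "distinct OL" by (simp add: OL_def distinct_map)
    have "set [1..<N + 1] = {1..N}" by auto
    then have "set OL = (+) M ` {1..N}" by (simp only: OL_def set_map)
    then show "set OL = {M + 1..M + N}" by (simp add: add.commute)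
  qed
  have KL: "distinct KL" "set KL = K" "length KL = r"
  proof -
    have "KL = map (elt K) [1..<card K + 1]" unfolding KL_def cK by (rule map_cong[OF refl], rule eK) auto
    then show "distinct KL" "set KL = K"
      using elt_bij[OF finK] map_upt_inj[of "elt K" "card K"] unfolding bij_betw_def by simp_all
    show "length KL = r" by (simp add: KL_def)
  qed
  have TL: "distinct TL" "set TL = T"
    using map_upt_inj(3,4)[OF f_inj] rev_elt_image[OF finT] unfolding TL_def f_def by simp_all
  let ?Y = "mshift s ?c ?L" and ?Z = "mshift s ?c X" and ?NY = "mshift s ?c NI"
  let ?XT = "mshift s (- 2 * int r + ?c) X"
  have lhs: "berezinian q s ?p M N (Lmat s :: ('m, 'n) uqgl fps mat) = CD s ?Y EL * RD s ?Z OL"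
    using berezinian_Lmat[OF X'] by (simp add: M_def N_def EL_def OL_def)
  have fac1: "berezinian q s (subpar I ?p) M (k - M) (submat I (Lmat s) :: ('m, 'n) uqgl fps mat) = CD s ?Y EL * RD s ?NY KL"
  proof -
    have Mr: "M + r = card I" using kM by (simp add: r_def k_def)
    have "berezinian q s (subpar I ?p) M r (submat I (Lmat s) :: ('m, 'n) uqgl fps mat) =
      CD s (mshift s ?c (submat I (Lmat s))) (rev [1..<M + 1]) *
      RD s (\<lambda>a b. shift s ?c (tw ?p NI (elt I (M + a)) (elt I (M + b)))) [1..<r + 1]"
    proof (rule berezinian_eq[where W = "\<lambda>a b. tw ?p NI (elt I a) (elt I b)"])
      fix c a b assume "a \<in> {1..r}" "b \<in> {1..r}"
      then have ab: "M + a \<in> {1..card I}" "M + b \<in> {1..card I}" using Mr by auto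
      show "sinv (subpar I ?p) (M + r) (mshift s c (submat I (Lmat s))) (M + a) (M + b) =
        shift s c (tw ?p NI (elt I (M + a)) (elt I (M + b)))"
        unfolding Mr using submat_Lmat_sinv[OF finI NI ab, of c]
        by (simp add: M_def mshift_tw[symmetric]) (simp add: mshift_def)
    qed
    also have "CD s (mshift s ?c (submat I (Lmat s))) (rev [1..<M + 1]) = CD s ?Y EL"
      unfolding EL_def
    proof (rule cdet_cong)
      fix a b assume "a \<in> set (rev [1..<M + 1])" "b \<in> set (rev [1..<M + 1])"
      then have ab: "a \<in> {1..M}" "b \<in> {1..M}" by auto
      then have "bar LENGTH('m) a = bar LENGTH('m) b" by (simp add: bar_def M_def)
      from mshift_Lmat_even[OF this, of s ?c]
      show "mshift s ?c (submat I (Lmat s)) a b = ?Y a b"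
        by (simp add: mshift_def submat_def eE[OF ab(1)] eE[OF ab(2)])
    qed auto
    also have "RD s (\<lambda>a b. shift s ?c (tw ?p NI (elt I (M + a)) (elt I (M + b)))) [1..<r + 1] =
      RD s (\<lambda>a b. ?NY (elt I (M + a)) (elt I (M + b))) [1..<r + 1]"
    proof (rule rdet_cong)
      fix a b assume "a \<in> set [1..<r + 1]" "b \<in> set [1..<r + 1]"
      then have ab: "a \<in> {1..r}" "b \<in> {1..r}" by auto
      have "elt K a \<in> K" "elt K b \<in> K" using ab by (auto intro!: elt_mem[OF finK] simp: cK)
      from this[THEN subsetD[OF KO]]
      have "?p (elt I (M + a)) = ?p (elt I (M + b))"
        unfolding eK[OF ab(1)] eK[OF ab(2)] by (simp add: bar_def)
      then show "shift s ?c (tw ?p NI (elt I (M + a)) (elt I (M + b))) = ?NY (elt I (M + a)) (elt I (M + b))"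
        by (simp add: tw_cong_parity mshift_def)
    qed auto
    also have "\<dots> = RD s ?NY KL"
      unfolding KL_def
    proof (rule relabel_inc)
      show "\<forall>a\<in>{1..r}. \<forall>b\<in>{1..r}. elt I (M + a) < elt I (M + b) \<longleftrightarrow> a < b"
        using elt_less_iff[OF finK] by (simp add: eK cK)
    qed
    finally show ?thesis by (simp add: r_def)
  qed
  let ?d = "2 * int M - 2 * int N"
  have mA: "mshift s c A a b = tw ?p (mshift s (c + ?d) X) (f a) (f b)"
    if "a \<in> {1..card T}" "b \<in> {1..card T}" for a b c
    using sinv_complement(1)[OF X' IU[unfolded M_def N_def] NI, of a b c ?d] that
    by (simp add: A_def[folded cT] f_def T_def M_def N_def)
  have fac2: "berezinian (inverse q) s (revpar (M + N - k) (subpar T ?p)) (M + N - k) 0 A = CD s ?XT TL"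
  proof -
    \<comment> \<open>With \<open>card T = M + N - k\<close> the left side is
      \<open>4M - 2k - 2\<close>: the base shift \<open>2M - 2\<close> lowered by 2 for each of the
      \<open>r = k - M\<close> rows of \<open>K\<close> that precede those of
      \<open>T\<close>.\<close>
    have e: "2 * int (card T) - 2 + ?d = - 2 * int r + ?c"
      using kM kN by (simp add: cT r_def of_nat_diff)
    have "berezinian (inverse q) s (revpar (card T) (subpar T ?p)) (card T) 0 A =
      cdet (\<lambda>x y. asc (inverse q) y x) (mshift s (2 * int (card T) - 2) A) (rev [1..<card T + 1])"
      by (subst berezinian_eq[where W = "\<lambda>_ _. 0"]) simp_all
    also have "\<dots> = cdet (\<lambda>x y. asc (inverse q) y x) (\<lambda>a b. ?XT (f a) (f b)) (rev [1..<card T + 1])"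
    proof (rule cdet_cong)
      fix a b assume "a \<in> set (rev [1..<card T + 1])" "b \<in> set (rev [1..<card T + 1])"
      then have ab: "a \<in> {1..card T}" "b \<in> {1..card T}" by auto
      have "?p (f a) = ?p (f b)"
        using subsetD[OF TO fT[OF ab(1)]] subsetD[OF TO fT[OF ab(2)]] by (simp add: bar_def)
      then show "mshift s (2 * int (card T) - 2) A a b = ?XT (f a) (f b)"
        unfolding mA[OF ab] e by (rule tw_cong_parity)
    qed auto
    also have "\<dots> = CD s ?XT TL"
      unfolding TL_def by (rule relabel_dec) (use f_less in auto)
    finally show ?thesis by (simp add: cT)
  qed
  have rO: "rmatrix s ?Z {M + 1..M + N}" unfolding M_def N_def by (intro rmatrix_mshift rmatrix_odd[OF ne' X'])
  \<comment> \<open>The Schur complement of \<open>X\<close> and the matrix \<open>NI\<close> both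
    invert the block of \<open>L\<close> on \<open>I\<close>, so they agree there.\<close>
  have invI: "eq_on I (schur T X ?S) NI"
  proof -
    have "T \<union> I = {1..M + N}" using IU by (auto simp: T_def)
    then have "inv_on I (schur T X ?S) ?L"
      using X by (intro inv_on_schur[OF finT finI _ _ XT]) (auto simp: T_def intro: inv_on_sym)
    from inv_on_unique[OF finI inv_on_sym[OF this] NI] show ?thesis .
  qed
  have "RD s ?Z OL = RD s (schur (set TL) ?Z (mshift s ?c ?S)) KL * RD s (mshift s (- 2 * int (length KL)) ?Z) TL"
    by (rule RD_schur[OF rO])
      (use OL TL KL KO TO IU inv_on_mshift[OF XT] in \<open>auto simp: K_def T_def\<close>)
  also have "RD s (schur (set TL) ?Z (mshift s ?c ?S)) KL = RD s ?NY KL"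
  proof (rule rdet_cong)
    fix a b assume "a \<in> set KL" "b \<in> set KL"
    then have "a \<in> I" "b \<in> I" by (auto simp: KL K_def)
    then show "schur (set TL) ?Z (mshift s ?c ?S) a b = ?NY a b"
      using eq_onD[OF invI] by (simp add: TL schur_mshift) (simp add: mshift_def)
  qed (use KL in auto)
  also have "mshift s (- 2 * int (length KL)) ?Z = ?XT" by (simp only: mshift_mshift KL(3))
  also have "RD s ?XT TL = CD s ?XT TL"
    by (rule CD_odd[OF ne' X', symmetric]) (use TL TO in \<open>simp_all add: M_def N_def\<close>)
  finally show ?thesis unfolding lhs fac1 fac2 by (simp only: mult.assoc)
qed

theorem theorem4p3:
  fixes I :: "nat set" and M N k :: nat and s :: sign
    and L :: "('m::len0, 'n::len0) uqgl fps mat"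
  defines "M \<equiv> LENGTH('m)" and "N \<equiv> LENGTH('n)" and "L \<equiv> Lmat s"
    and "k \<equiv> card I"
  assumes "M \<noteq> N" and "I \<subseteq> {1..M + N}"
  shows
    "(I \<subseteq> {1..M} \<longrightarrow>
        berezinian q s (bar M) M N L =
          berezinian q s (subpar I (bar M)) k 0 (submat I L) *
          berezinian (inverse q) s (revpar (M + N - k) (subpar ({1..M + N} - I) (bar M))) N (M - k)
            (revmat (M + N - k) (submat ({1..M + N} - I)
              (sinv (bar M) (M + N) (mshift s (2 * int M - 2 * int N) L))))) \<and>
     ({1..M} \<subseteq> I \<longrightarrow>
        berezinian q s (bar M) M N L =
          berezinian q s (subpar I (bar M)) M (k - M) (submat I L) *
          berezinian (inverse q) s (revpar (M + N - k) (subpar ({1..M + N} - I) (bar M))) (M + N - k) 0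
            (revmat (M + N - k) (submat ({1..M + N} - I)
              (sinv (bar M) (M + N) (mshift s (2 * int M - 2 * int N) L)))))"
  using theorem4p3_even[where 'm = 'm and 'n = 'n, of I s] theorem4p3_odd[where 'm = 'm and 'n = 'n, of I s] assms(5,6)
  unfolding M_def N_def L_def k_def by blast

end
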